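(* Assume the standing assumptions (A) and (B) of the context. Consider the mini-batch adaptive stochastic heavy ball method with noisy data described in the context, with fixed batch size $b$ and fixed parameters satisfying $0<\mu_0<4\sigma$, $\mu_1>0$, $\upsilon_0>0$, $\upsilon_1>0$, $0\le \beta<1$ and $\tau>(1+\eta)/(1-\eta)$. Let $\{y^{(l)}:=(y_1^{(l)},\dots,y_N^{(l)})\}_{l\ge 1}$ be a sequence of noisy data satisfying $\|y_i^{(l)}-y_i\|\le \delta_i^{(l)}$ with $\delta_i^{(l)}>0$ for $i=1,\dots,N$ and $\delta^{(l)}:=\max\{\delta_i^{(l)}: i=1,\dots,N\}\to 0$ as $l\to\infty$. For each $l$, let $(\xi_n^{\delta^{(l)}},x_n^{\delta^{(l)}})$ be the iterates and $n_l:=n_{\delta^{(l)}}$ the stopping index produced by the method with data $y^{(l)}$ and noise levels $\delta_i^{(l)}$. Then there exists a random solution $x_*\in B_{2\rho}(x_0)\cap \mathrm{dom}(\Theta)$ of the system $F_i(x)=y_i$, $i=1,\dots,N$, such that $$\lim_{l\to\infty}\left\|x_{n_l}^{\delta^{(l)}}-x_*\right\|=0\quad\text{and}\quad \lim_{l\to\infty}D_{\xi_{n_l}^{\delta^{(l)}}}\Theta\left(x_*,x_{n_l}^{\delta^{(l)}}\right)=0\quad\text{almost surely}$$ and $$\lim_{l\to\infty}\mathbb{E}\left[\left\|x_{n_l}^{\delta^{(l)}}-x_*\right\|^2\right]=0\quad\text{and}\quad \lim_{l\to\infty}\mathbb{E}\left[D_{\xi_{n_l}^{\delta^{(l)}}}\Theta\left(x_*,x_{n_l}^{\delta^{(l)}}\right)\right]=0.$$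 If, further, $\mathrm{Ran}(L_i(x)^* )\subset\overline{\mathrm{Ran}(L_i(x^\dagger)^* )}$ for all $x\in B_{2\rho}(x_0)$ and $i=1,\dots,N$, then $x_*=x^\dagger$ almost surely.
   Context: Setting. Consider the system $F_i(x)=y_i$, $i=1,\dots,N$, where $F_i:\mathrm{dom}(F_i)\subset\mathcal X\to\mathcal Y_i$ are (possibly nonlinear) operators. Put $\mathcal D:=\bigcap_{i=1}^N\mathrm{dom}(F_i)\neq\emptyset$ and $B_\rho(x_0):=\{x\in\mathcal X:\|x-x_0\|\le\rho\}$. $\mathrm{Ran}$ denotes range and $^*$ the adjoint. For a convex $\Theta:\mathcal X\to(-\infty,\infty]$, $\mathrm{dom}(\Theta)=\{x:\Theta(x)<\infty\}$, $\partial\Theta$ is the subdifferential, $\mathrm{dom}(\partial\Theta)$ is the set of $x\in\mathrm{dom}(\Theta)$ with $\partial\Theta(x)\ne\emptyset$, and for $\xi\in\partial\Theta(x)$ the Bregman distance is $D_\xi\Theta(\bar x,x):=\Theta(\bar x)-\Theta(x)-\langle\xi,\bar x-x\rangle$. Fix an initial guess $x_0\in\mathrm{dom}(\partial\Theta)$, $\xi_0\in\partial\Theta(x_0)$. Assumption (A): $\Theta:\mathcal X\to(-\infty,\infty]$ is proper, lower semi-continuous and strongly convex, satisfying $D_\xi\Theta(\bar x,x)\ge\sigma\|\bar x-x\|^2$ for all $\bar x\in\mathcal X$, $x\in\mathrm{dom}(\partial\Theta)$, $\xi\in\partial\Theta(x)$, with a constant $\sigma>0$. Assumption (B): (a) $\mathcal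 X$ is a Hilbert space and each $\mathcal Y_i$ is a uniformly smooth Banach space. (b) There is $\rho>0$ with $B_{2\rho}(x_0)\subset\mathcal D$ and the system has a solution $\tilde x\in\mathrm{dom}(\Theta)$ with $D_{\xi_0}\Theta(\tilde x,x_0)\le\sigma\rho^2$. (c) For each $i$ there is a family of bounded linear operators $\{L_i(x):\mathcal X\to\mathcal Y_i\}_{x\in B_{2\rho}(x_0)}$ such that $x\mapsto L_i(x)$ is continuous on $B_{2\rho}(x_0)$, $\|L_i(x)\|\le B_0$ for all $x\in B_{2\rho}(x_0)$ and all $i$, for some constant $B_0>0$, and there is $0\le\eta<1$ with $\|F_i(x)-F_i(\bar x)-L_i(x)(x-\bar x)\|\le\eta\|F_i(x)-F_i(\bar x)\|$ for all $x,\bar x\in B_{2\rho}(x_0)$ and all $i$. $x^\dagger$ denotes the (unique) solution of the system that minimizes $D_{\xi_0}\Theta(x,x_0)$ over all solutions $x\in\mathrm{dom}(\Theta)\cap\mathcal D$ of the system. Duality mapping: for fixed $1<r<\infty$, $J_r^{\mathcal Y}(y)$ is the element $\zeta\in\mathcal Y^*$ with $\|\zeta\|=\|y\|^{r-1}$ and $\langle\zeta,y\rangle=\|y\|^r$ (single valued for uniformly smooth $\mathcal Y$). Mini-batch method with noisy data. Given $y^\delta=(y_1^\delta,\dots,y_N^\delta)$ with $\|y_i^\delta-y_i\|\le\delta_i$, $\delta_i>0$, $\delta_{\min}:=\min_i\delta_i$, a batch size $1\le b\le N$ and parameters $\mu_0,\mu_1,\upsilon_0,\upsilon_1>0$, $\tau>1$,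 $\beta\in[0,\infty]$. Set $\xi_{-1}^\delta=\xi_0^\delta=\xi_0$, $x_0^\delta=x_0$, $\mathcal A_0=\{1,\dots,N\}$. For $n\ge0$: (i) Sample a subset $I_n\subset\{1,\dots,N\}$ of size $b$ uniformly at random (without replacement within a batch, independently over $n$), and set $\Gamma_n^\delta=\{i\in I_n:\|F_i(x_n^\delta)-y_i^\delta\|>\tau\delta_i\}$. (ii) Set $\mathfrak g_n^\delta=\sum_{i\in\Gamma_n^\delta}L_i(x_n^\delta)^*J_r^{\mathcal Y_i}(F_i(x_n^\delta)-y_i^\delta)$, $$\Phi_n^\delta=\sum_{i\in\Gamma_n^\delta}\left((1-\eta)\|F_i(x_n^\delta)-y_i^\delta\|-(1+\eta)\delta_i\right)\|F_i(x_n^\delta)-y_i^\delta\|^{r-1},\qquad \Psi_n^\delta=\sum_{i\in\Gamma_n^\delta}\|F_i(x_n^\delta)-y_i^\delta\|^r;$$ set $t_n^\delta=\min\left\{\frac{\mu_0\Phi_n^\delta}{\|\mathfrak g_n^\delta\|^2},\mu_1(\Psi_n^\delta)^{\frac2r-1}\right\}$ if $\Gamma_n^\delta\neq\emptyset$ and $t_n^\delta=0$ if $\Gamma_n^\delta=\emptyset$. (iii) Set $\mathfrak m_n^\delta=\xi_n^\delta-\xi_{n-1}^\delta$, $\tilde\gamma_0^\delta=0$, and for $n\ge1$ $\tilde\gamma_n^\delta=\langle\mathfrak m_n^\delta,x_n^\delta-x_{n-1}^\delta\rangle-t_{n-1}^\delta\Phi_{n-1}^\delta+\beta_{n-1}^\delta\tilde\gamma_{n-1}^\delta$.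 If $\|\mathfrak m_n^\delta\|\ge\upsilon_0\delta_{\min}$ and $\tilde\gamma_n^\delta-\frac{t_n^\delta}{2\sigma}\langle\mathfrak g_n^\delta,\mathfrak m_n^\delta\rangle\le-\upsilon_1\delta_{\min}\|\mathfrak m_n^\delta\|^2$, set $\beta_n^\delta=\min\left\{\frac{t_n^\delta\langle\mathfrak g_n^\delta,\mathfrak m_n^\delta\rangle-2\sigma\tilde\gamma_n^\delta}{\|\mathfrak m_n^\delta\|^2},\beta\right\}$; otherwise $\beta_n^\delta=0$. (iv) $\xi_{n+1}^\delta=\xi_n^\delta-t_n^\delta\mathfrak g_n^\delta+\beta_n^\delta\mathfrak m_n^\delta$ and $x_{n+1}^\delta=\arg\min_{x\in\mathcal X}\{\Theta(x)-\langle\xi_{n+1}^\delta,x\rangle\}$. (v) $\mathcal A_{n+1}=\mathcal A_n\setminus I_n$ if $\Gamma_n^\delta=\emptyset$ and $\beta_n^\delta=0$; otherwise $\mathcal A_{n+1}=\{1,\dots,N\}$. (vi) The stopping index $n_\delta$ is the first integer with $\mathcal A_{n_\delta}=\emptyset$ ($n_\delta=\infty$ if there is none). All runs of the method (for different data $y^{(l)}$) are driven by one and the same random sequence of index sets $(I_0,I_1,\dots)$, with the same $x_0$, $\xi_0$, $b$ and parameters; almost sure statements and expectations refer to this sequence. *)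

theory Defs
  imports "HOL-Probability.Probability"
begin

section \<open>Convex functions with values in \<open>(-\<infinity>, \<infinity>]\<close>\<close>

definition proper :: "('x \<Rightarrow> ereal) \<Rightarrow> bool" where
  "proper \<Theta> \<longleftrightarrow> (\<forall>x. \<Theta> x \<noteq> -\<infinity>) \<and> (\<exists>x. \<Theta> x < \<infinity>)"

definition lower_semicontinuous :: "('x::topological_space \<Rightarrow> ereal) \<Rightarrow> bool" where
  "lower_semicontinuous \<Theta> \<longleftrightarrow> (\<forall>x. \<Theta> x \<le> Liminf (at x) \<Theta>)"

definition strongly_convex :: "('x::real_normed_vector \<Rightarrow> ereal) \<Rightarrow> bool" where
  "strongly_convex \<Theta> \<longleftrightarrow> (\<exists>\<kappa>>0. \<forall>x y. \<forall>s\<in>{0..1}.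
     \<Theta> (s *\<^sub>R x + (1 - s) *\<^sub>R y) + ereal (\<kappa> * s * (1 - s) * (norm (x - y))\<^sup>2)
       \<le> ereal s * \<Theta> x + ereal (1 - s) * \<Theta> y)"

definition edom :: "('x \<Rightarrow> ereal) \<Rightarrow> 'x set" where
  "edom \<Theta> = {x. \<Theta> x < \<infinity>}"

text \<open>The dual of the Hilbert space is identified with the space itself, so subgradients are
  vectors and the duality pairing is the inner product.\<close>

definition subdiff :: "('x::real_inner \<Rightarrow> ereal) \<Rightarrow> 'x \<Rightarrow> 'x set" where
  "subdiff \<Theta> x = {\<xi>. \<forall>z. \<Theta> z \<ge> \<Theta> x + ereal (\<xi> \<bullet> (z - x))}"

definition dom_subdiff :: "('x::real_inner \<Rightarrow> ereal) \<Rightarrow> 'x set" where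
  "dom_subdiff \<Theta> = {x \<in> edom \<Theta>. subdiff \<Theta> x \<noteq> {}}"

definition bregman :: "('x::real_inner \<Rightarrow> ereal) \<Rightarrow> 'x \<Rightarrow> 'x \<Rightarrow> 'x \<Rightarrow> ereal" where
  "bregman \<Theta> \<xi> z x = \<Theta> z - \<Theta> x - ereal (\<xi> \<bullet> (z - x))"


section \<open>Banach spaces as complete subspaces of an ambient normed space\<close>

text \<open>A family of Banach spaces \<open>Y i\<close> that may differ from one index to the next is represented
  by complete linear subspaces of one ambient normed space. This loses no generality: finitely many
  Banach spaces embed isometrically into their direct sum. All notions below are those of
  the normed space \<open>Y\<close> itself and never refer to vectors outside \<open>Y\<close>.\<close>

definition smoothness_modulus :: "'y::real_normed_vector set \<Rightarrow> real \<Rightarrow> real" where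
  "smoothness_modulus Y s =
     Sup (insert 0 {norm (u + v) + norm (u - v) - 2 | u v.
                      u \<in> Y \<and> v \<in> Y \<and> norm u = 1 \<and> norm v \<le> s})"
  \<comment> \<open>for \<open>s \<ge> 0\<close>, inserting \<open>0\<close> matters only if \<open>Y = {0}\<close>: otherwise \<open>v = 0\<close> already attains it\<close>

definition uniformly_smooth :: "'y::real_normed_vector set \<Rightarrow> bool" where
  "uniformly_smooth Y \<longleftrightarrow> ((\<lambda>s. smoothness_modulus Y s / s) \<longlongrightarrow> 0) (at_right 0)"

text \<open>A functional on \<open>Y\<close> is represented by a function on the ambient space that
  vanishes off \<open>Y\<close>, which makes the representation unique.\<close>

definition dual_space :: "'y::real_normed_vector set \<Rightarrow> ('y \<Rightarrow> real) set" where
  "dual_space Y = {\<zeta>.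
     (\<forall>u\<in>Y. \<forall>v\<in>Y. \<zeta> (u + v) = \<zeta> u + \<zeta> v) \<and>
     (\<forall>c. \<forall>u\<in>Y. \<zeta> (c *\<^sub>R u) = c * \<zeta> u) \<and>
     (\<exists>K. \<forall>u\<in>Y. \<bar>\<zeta> u\<bar> \<le> K * norm u) \<and>
     (\<forall>u. u \<notin> Y \<longrightarrow> \<zeta> u = 0)}"

definition dual_norm :: "'y::real_normed_vector set \<Rightarrow> ('y \<Rightarrow> real) \<Rightarrow> real" where
  "dual_norm Y \<zeta> = Sup {\<bar>\<zeta> u\<bar> | u. u \<in> Y \<and> norm u \<le> 1}"

definition duality_map :: "real \<Rightarrow> 'y::real_normed_vector set \<Rightarrow> 'y \<Rightarrow> ('y \<Rightarrow> real)" where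
  "duality_map r Y u = (THE \<zeta>. \<zeta> \<in> dual_space Y \<and>
     dual_norm Y \<zeta> = norm u powr (r - 1) \<and> \<zeta> u = norm u powr r)"

text \<open>Adjoint of an operator \<open>A\<close> from a Hilbert space into \<open>Y\<close>, as a map from the dual
  space of \<open>Y\<close> back into the Hilbert space.\<close>

definition dual_adjoint ::
    "('x::real_inner \<Rightarrow>\<^sub>L 'y::real_normed_vector) \<Rightarrow> ('y \<Rightarrow> real) \<Rightarrow> 'x" where
  "dual_adjoint A \<zeta> = (THE g. \<forall>h. g \<bullet> h = \<zeta> (blinfun_apply A h))"

definition ran_adjoint ::
    "'y::real_normed_vector set \<Rightarrow> ('x::real_inner \<Rightarrow>\<^sub>L 'y) \<Rightarrow> 'x set" where
  "ran_adjoint Y A = dual_adjoint A ` dual_space Y"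


section \<open>The system of equations\<close>

definition common_dom :: "nat \<Rightarrow> (nat \<Rightarrow> 'x set) \<Rightarrow> 'x set" where
  "common_dom N domF = (\<Inter>i\<in>{1..N}. domF i)"

definition is_solution ::
    "nat \<Rightarrow> (nat \<Rightarrow> 'x set) \<Rightarrow> (nat \<Rightarrow> 'x \<Rightarrow> 'y) \<Rightarrow> (nat \<Rightarrow> 'y) \<Rightarrow> 'x \<Rightarrow> bool" where
  "is_solution N domF F y x \<longleftrightarrow> x \<in> common_dom N domF \<and> (\<forall>i\<in>{1..N}. F i x = y i)"

definition x_dagger ::
    "('x::real_inner \<Rightarrow> ereal) \<Rightarrow> nat \<Rightarrow> (nat \<Rightarrow> 'x set) \<Rightarrow> (nat \<Rightarrow> 'x \<Rightarrow> 'y) \<Rightarrow> (nat \<Rightarrow> 'y)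
      \<Rightarrow> 'x \<Rightarrow> 'x \<Rightarrow> 'x" where
  "x_dagger \<Theta> N domF F y x0 \<xi>0 =
     (THE x. is_arg_min (\<lambda>x. bregman \<Theta> \<xi>0 x x0) (\<lambda>x. is_solution N domF F y x \<and> x \<in> edom \<Theta>) x)"


section \<open>The mini-batch adaptive heavy ball method for a given sequence of batches\<close>

text \<open>The state at step \<open>n\<close> holds \<open>\<xi>(n-1)\<close>, \<open>\<xi>(n)\<close>, \<open>x(n-1)\<close>, \<open>x(n)\<close>, the index set \<open>A(n)\<close>, and
  \<open>memo = \<beta>(n-1) * \<gamma>(n-1) - t(n-1) * \<Phi>(n-1)\<close>, the part of \<open>\<gamma>(n)\<close> that is inherited from the
  previous step. At \<open>n = 0\<close> the vector \<open>m(0)\<close> and \<open>memo\<close> vanish, so that \<open>\<gamma>(0) = 0\<close>.\<close>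

record 'x hb_state =
  xi_prev :: 'x
  xi_cur :: 'x
  x_prev :: 'x
  x_cur :: 'x
  memo :: real
  active :: "nat set"

locale heavy_ball =
  fixes \<Theta> :: "'x::{real_inner, banach} \<Rightarrow> ereal"
    and Y :: "nat \<Rightarrow> 'y::real_normed_vector set"
    and F :: "nat \<Rightarrow> 'x \<Rightarrow> 'y"
    and L :: "nat \<Rightarrow> 'x \<Rightarrow> ('x \<Rightarrow>\<^sub>L 'y)"
    and N :: nat
    and x0 \<xi>0 :: 'x
    and \<eta> \<sigma> r \<mu>0 \<mu>1 \<upsilon>0 \<upsilon>1 \<beta> \<tau> :: real
    and yd :: "nat \<Rightarrow> 'y"  \<comment> \<open>noisy data\<close>
    and \<delta> :: "nat \<Rightarrow> real"  \<comment> \<open>noise levels\<close>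
    and I :: "nat \<Rightarrow> nat set"  \<comment> \<open>sampled batches\<close>
begin

definition \<delta>min :: real where
  "\<delta>min = Min (\<delta> ` {1..N})"

definition res :: "'x \<Rightarrow> nat \<Rightarrow> real" where
  "res x i = norm (F i x - yd i)"

definition \<Gamma> :: "nat \<Rightarrow> 'x \<Rightarrow> nat set" where
  "\<Gamma> n x = {i \<in> I n. res x i > \<tau> * \<delta> i}"

definition grad :: "nat \<Rightarrow> 'x \<Rightarrow> 'x" where
  "grad n x = (\<Sum>i\<in>\<Gamma> n x. dual_adjoint (L i x) (duality_map r (Y i) (F i x - yd i)))"

definition \<Phi> :: "nat \<Rightarrow> 'x \<Rightarrow> real" where
  "\<Phi> n x = (\<Sum>i\<in>\<Gamma> n x. ((1 - \<eta>) * res x i - (1 + \<eta>) * \<delta> i) * res x i powr (r - 1))"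

definition \<Psi> :: "nat \<Rightarrow> 'x \<Rightarrow> real" where
  "\<Psi> n x = (\<Sum>i\<in>\<Gamma> n x. res x i powr r)"

definition stepsize :: "nat \<Rightarrow> 'x \<Rightarrow> real" where
  "stepsize n x =
     (if \<Gamma> n x \<noteq> {}
      then min (\<mu>0 * \<Phi> n x / (norm (grad n x))\<^sup>2) (\<mu>1 * \<Psi> n x powr (2 / r - 1))
      else 0)"

definition mom :: "'x hb_state \<Rightarrow> 'x" where
  "mom s = xi_cur s - xi_prev s"

definition gam :: "'x hb_state \<Rightarrow> real" where
  "gam s = mom s \<bullet> (x_cur s - x_prev s) + memo s"

definition bet :: "nat \<Rightarrow> 'x hb_state \<Rightarrow> real" where
  "bet n s =
     (let t = stepsize n (x_cur s); g = grad n (x_cur s); m = mom s in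
      if norm m \<ge> \<upsilon>0 * \<delta>min
         \<and> gam s - t / (2 * \<sigma>) * (g \<bullet> m) \<le> - \<upsilon>1 * \<delta>min * (norm m)\<^sup>2
      then min ((t * (g \<bullet> m) - 2 * \<sigma> * gam s) / (norm m)\<^sup>2) \<beta>
      else 0)"

definition xi_next :: "nat \<Rightarrow> 'x hb_state \<Rightarrow> 'x" where
  "xi_next n s =
     xi_cur s - stepsize n (x_cur s) *\<^sub>R grad n (x_cur s) + bet n s *\<^sub>R mom s"

primrec state :: "nat \<Rightarrow> 'x hb_state" where
  "state 0 = \<lparr>xi_prev = \<xi>0, xi_cur = \<xi>0, x_prev = x0, x_cur = x0, memo = 0, active = {1..N}\<rparr>"
| "state (Suc n) = (let s = state n in
     \<lparr>xi_prev = xi_cur s,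
      xi_cur = xi_next n s,
      x_prev = x_cur s,
      x_cur = (ARG_MIN (\<lambda>x. \<Theta> x - ereal (xi_next n s \<bullet> x)) x. True),
      memo = bet n s * gam s - stepsize n (x_cur s) * \<Phi> n (x_cur s),
      active = (if \<Gamma> n (x_cur s) = {} \<and> bet n s = 0 then active s - I n else {1..N})\<rparr>)"

definition x_it :: "nat \<Rightarrow> 'x" where
  "x_it n = x_cur (state n)"

definition xi_it :: "nat \<Rightarrow> 'x" where
  "xi_it n = xi_cur (state n)"

text \<open>The stopping index is \<open>\<infinity>\<close> if the index set never becomes empty.\<close>

definition stop_index :: enat where
  "stop_index = Inf (enat ` {n. active (state n) = {}})"

lemma state_recursion:
  "x_it 0 = x0" "xi_it 0 = \<xi>0" "gam (state 0) = 0" "active (state 0) = {1..N}"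
  "mom (state (Suc n)) = xi_it (Suc n) - xi_it n"
  "gam (state (Suc n)) = mom (state (Suc n)) \<bullet> (x_it (Suc n) - x_it n)
     - stepsize n (x_it n) * \<Phi> n (x_it n) + bet n (state n) * gam (state n)"
  "xi_it (Suc n) = xi_it n - stepsize n (x_it n) *\<^sub>R grad n (x_it n)
     + bet n (state n) *\<^sub>R mom (state n)"
  "x_it (Suc n) = (ARG_MIN (\<lambda>x. \<Theta> x - ereal (xi_it (Suc n) \<bullet> x)) x. True)"
  "active (state (Suc n)) =
     (if \<Gamma> n (x_it n) = {} \<and> bet n (state n) = 0 then active (state n) - I n else {1..N})"
  by (simp_all add: x_it_def xi_it_def mom_def gam_def xi_next_def Let_def)

end


section \<open>Random batches\<close>

definition batches :: "nat \<Rightarrow> nat \<Rightarrow> nat set set" where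
  "batches N b = {S. S \<subseteq> {1..N} \<and> card S = b}"

definition uniform_iid_batches :: "'w measure \<Rightarrow> nat \<Rightarrow> nat \<Rightarrow> (nat \<Rightarrow> 'w \<Rightarrow> nat set) \<Rightarrow> bool" where
  "uniform_iid_batches M N b I \<longleftrightarrow>
     prob_space.indep_vars M (\<lambda>_. count_space (batches N b)) I UNIV \<and>
     (\<forall>n. distr M (count_space (batches N b)) (I n) = uniform_count_measure (batches N b))"

end

theory Submission
  imports Defs
begin

text \<open>
  Why the theorem holds. Fix one sequence of batches. The method with exact data is the method
  itself with \<open>yd = y\<close> and all noise levels \<open>0\<close>: a vanishing momentum vector then makes the
  quotient that defines the momentum parameter a division by zero, whose value \<open>0\<close> is the right
  one. The runs with noisy data are compared with this exact run.

  Monotonicity. The method picks the momentum parameter so as to decrease an upper bound of the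
  next Bregman distance to a solution. That bound contains the inner product of the momentum with
  \<open>x(n) - xh\<close> for the unknown solution \<open>xh\<close>, which the recursively computed number \<open>\<gamma>(n)\<close> dominates. Hence
  the Bregman distance to every solution is non-increasing, and it drops at step \<open>n\<close> by a
  multiple of \<open>\<Psi>(n) powr (2/r)\<close> and of the squared norm of the added momentum (\<open>descent_step\<close>).
  This keeps the iterates in the ball, bounds the sum of all drops, and lets
  every noisy run become stationary. Almost surely every index is sampled infinitely often, so the
  remaining indices are exhausted and the run stops (\<open>eventually_inactive\<close>, \<open>stops\<close>).

  Convergence of the exact run. The sampled residuals are square summable. Since \<open>I n\<close> is
  independent of the iterate \<open>x(n)\<close> and hits every index with probability at least some \<open>p > 0\<close>,
  the sum of all squared residuals, sampled or not, has finite expectation (\<open>W_integral\<close>), so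
  it is finite almost surely. Along the indices at which the residual attains a new minimum the
  iterates then form a Cauchy sequence; lower semicontinuity of the penalty carries the estimate
  over to all indices, and the Bregman distance to the limit tends to \<open>0\<close>
  (\<open>exact_limit\<close>). The limit is the random solution of the theorem.

  Stability. For every fixed \<open>n\<close> the noisy iterates converge to the exact ones (\<open>stability\<close>).
  This rests on the norm continuity of the duality mappings, which is what uniform smoothness
  provides (\<open>duality_map_continuous\<close>), and on the continuity of the product of momentum parameter
  and momentum, which survives at points where the parameter itself is discontinuous
  (\<open>momentum_tendsto\<close>).

  Conclusion. Stop a noisy run at \<open>nl\<close>. If \<open>nl\<close> is at least some index at which the exact
  Bregman distance to the limit is small, then monotonicity and stability make the noisy one small.
  Earlier stopping times can recur only at indices where the exact run has already reached a
  solution and stands still (\<open>D_stopped_tendsto\<close>). Expectations converge by dominated convergence,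
  because the Bregman distance between the limit and \<open>x0\<close> is bounded by an affine function of the
  integrable sum of squared residuals. Under the range condition all \<open>\<xi>(n) - \<xi>0\<close>
  are orthogonal to the difference of the limit and the solution of minimal Bregman distance, which
  forces the two to agree (\<open>limit_is_x_dagger\<close>).
\<close>

section \<open>Minimisation of strongly convex functions\<close>

text \<open>By the midpoint inequality, two near-minimisers are close to each other, so minimising sequences
are Cauchy. Stating lower semicontinuity along sequences on a set \<open>S\<close> lets the same lemma serve for the
Riesz representation, for the update of \<open>x(n)\<close> and for the solution of minimal Bregman distance.\<close>

lemma strongly_convex_minimiser:
  fixes f :: "'a::banach \<Rightarrow> real"
  assumes ne: "S \<noteq> {}"
    and bdd: "\<And>x. x \<in> S \<Longrightarrow> c \<le> f x"
    and mid: "\<And>x z. x \<in> S \<Longrightarrow> z \<in> S \<Longrightarrow> (1/2) *\<^sub>R (x + z) \<in> S \<and>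
        f ((1/2) *\<^sub>R (x + z)) + \<kappa> * (norm (x - z))\<^sup>2 \<le> (f x + f z) / 2"
    and \<kappa>: "\<kappa> > 0"
    and lsc: "\<And>u x a. (\<And>k. u k \<in> S) \<Longrightarrow> u \<longlonglongrightarrow> x \<Longrightarrow> (\<lambda>k. f (u k)) \<longlonglongrightarrow> a \<Longrightarrow> x \<in> S \<and> f x \<le> a"
  shows "\<exists>!x. x \<in> S \<and> (\<forall>z\<in>S. f x \<le> f z)"
proof -
  define m where "m = Inf (f ` S)"
  have bb: "bdd_below (f ` S)"
    using bdd by (auto simp: bdd_below_def)
  have mle: "m \<le> f x" if "x \<in> S" for x
    unfolding m_def using bb that by (simp add: cInf_lower)
  have "\<exists>x\<in>S. f x < m + 1 / real (Suc k)" for k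
  proof -
    have "Inf (f ` S) < m + 1 / real (Suc k)"
      by (simp add: m_def)
    then show ?thesis
      using ne bb by (subst (asm) cInf_less_iff) auto
  qed
  then obtain u where uS: "\<And>k. u k \<in> S" and u: "\<And>k. f (u k) < m + 1 / real (Suc k)"
    by metis
  have fu: "(\<lambda>k. f (u k)) \<longlonglongrightarrow> m"
  proof (rule tendsto_sandwich)
    show "\<forall>\<^sub>F k in sequentially. m \<le> f (u k)" using mle uS by auto
    show "\<forall>\<^sub>F k in sequentially. f (u k) \<le> m + 1 / real (Suc k)" using u by (intro always_eventually allI less_imp_le)
    show "(\<lambda>k. m + 1 / real (Suc k)) \<longlonglongrightarrow> m"
      using LIMSEQ_Suc[OF lim_1_over_n] tendsto_add[OF tendsto_const[of m]] by fastforce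
  qed auto
  have close: "(norm (x - z))\<^sup>2 \<le> (f x + f z - 2 * m) / (2 * \<kappa>)" if "x \<in> S" "z \<in> S" for x z
  proof -
    have "m + \<kappa> * (norm (x - z))\<^sup>2 \<le> (f x + f z) / 2"
      using mid[OF that] mle[of "(1/2) *\<^sub>R (x + z)"] by linarith
    then show ?thesis using \<kappa> by (simp add: field_simps)
  qed
  have "Cauchy u"
  proof (rule metric_CauchyI)
    fix e :: real assume e: "0 < e"
    have "\<forall>\<^sub>F k in sequentially. f (u k) < m + \<kappa> * e\<^sup>2"
      using fu \<kappa> e by (intro order_tendstoD(2)) auto
    then obtain K where K: "\<And>k. k \<ge> K \<Longrightarrow> f (u k) < m + \<kappa> * e\<^sup>2"
      by (auto simp: eventually_sequentially)
    show "\<exists>K. \<forall>k\<ge>K. \<forall>j\<ge>K. dist (u k) (u j) < e"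
    proof (intro exI allI impI)
      fix k j assume "k \<ge> K" "j \<ge> K"
      then have "f (u k) + f (u j) - 2 * m < e\<^sup>2 * (2 * \<kappa>)"
        using K[of k] K[of j] by (simp add: algebra_simps)
      then have "(norm (u k - u j))\<^sup>2 < e\<^sup>2"
        using close[OF uS[of k] uS[of j]] \<kappa>
        by (smt (verit, best) pos_divide_less_eq mult_pos_pos)
      then show "dist (u k) (u j) < e"
        using e by (simp add: dist_norm power_less_imp_less_base)
    qed
  qed
  then obtain x where x: "u \<longlonglongrightarrow> x"
    using Cauchy_convergent_iff convergent_def by blast
  have xS: "x \<in> S" and fx: "f x \<le> m"
    using lsc[OF uS x fu] by auto
  show ?thesis
  proof (rule ex1I[of _ x])
    show "x \<in> S \<and> (\<forall>z\<in>S. f x \<le> f z)"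
      using xS fx mle by force
    fix z assume z: "z \<in> S \<and> (\<forall>v\<in>S. f z \<le> f v)"
    then have "f z \<le> m" using xS fx by force
    then have "(f z + f x - 2 * m) / (2 * \<kappa>) \<le> 0"
      using fx \<kappa> by (simp add: divide_le_0_iff)
    then have "(norm (z - x))\<^sup>2 \<le> 0"
      using close[of z x] z xS by linarith
    then show "z = x" by simp
  qed
qed

section \<open>Riesz representation and adjoints\<close>

lemma midpoint_norm_identity:
  fixes x z :: "'a::real_inner"
  shows "(norm ((1/2) *\<^sub>R (x + z)))\<^sup>2 + (norm (x - z))\<^sup>2 / 4 = ((norm x)\<^sup>2 + (norm z)\<^sup>2) / 2"
  by (simp add: power2_norm_eq_inner inner_simps inner_commute field_simps)

text \<open>The representing vector is the minimiser of the strongly convex function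
\<open>(norm h)\<^sup>2 / 2 - \<phi> h\<close>.\<close>

lemma riesz_representation:
  fixes \<phi> :: "'a::{real_inner, banach} \<Rightarrow> real"
  assumes "bounded_linear \<phi>"
  shows "\<exists>!g. \<forall>h. g \<bullet> h = \<phi> h"
proof -
  interpret bounded_linear \<phi> by fact
  obtain K where K: "\<And>h. \<bar>\<phi> h\<bar> \<le> norm h * K" 
    using bounded by (metis real_norm_def)
  define f where "f h = (norm h)\<^sup>2 / 2 - \<phi> h" for h
  have "\<exists>!x. x \<in> UNIV \<and> (\<forall>z\<in>UNIV. f x \<le> f z)"
  proof (rule strongly_convex_minimiser[where \<kappa> = "1/8" and c = "- K\<^sup>2 / 2"])
    show "- K\<^sup>2 / 2 \<le> f x" for x
    proof -
      have "(norm x - K)\<^sup>2 \<ge> 0" by simp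
      then have "norm x * K \<le> (norm x)\<^sup>2 / 2 + K\<^sup>2 / 2"
        by (simp add: power2_diff)
      then show ?thesis using K[of x] by (auto simp: f_def)
    qed
    show "(1/2) *\<^sub>R (x + z) \<in> UNIV \<and> f ((1/2) *\<^sub>R (x + z)) + 1/8 * (norm (x - z))\<^sup>2 \<le> (f x + f z) / 2" for x z
      using midpoint_norm_identity[of x z] by (simp add: f_def scale add field_simps)
    show "x \<in> UNIV \<and> f x \<le> a" if "u \<longlonglongrightarrow> x" "(\<lambda>k. f (u k)) \<longlonglongrightarrow> a" for u x a
    proof -
      have "(\<lambda>k. f (u k)) \<longlonglongrightarrow> f x"
        unfolding f_def by (intro tendsto_intros tendsto that) auto
      then show ?thesis using that LIMSEQ_unique by blast
    qed
  qed auto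
  then obtain g where g: "\<And>z. f g \<le> f z" by auto
  have eq: "g \<bullet> h = \<phi> h" for h
  proof -
    define a where "a = g \<bullet> h - \<phi> h"
    \<comment> \<open>the quadratic in \<open>s\<close> below is minimal at \<open>0\<close>, so its linear coefficient vanishes\<close>
    have q: "0 \<le> s * a + s\<^sup>2 * (norm h)\<^sup>2 / 2" for s
    proof -
      have "f (g + s *\<^sub>R h) - f g = s * a + s\<^sup>2 * (norm h)\<^sup>2 / 2"
        unfolding f_def a_def power2_norm_eq_inner add scale
        by (simp add: inner_simps inner_commute power2_eq_square algebra_simps)
      then show ?thesis using g[of "g + s *\<^sub>R h"] by simp
    qed
    have "a = 0"
    proof (rule ccontr)
      assume "a \<noteq> 0"
      define n where "n = 1 + (norm h)\<^sup>2"
      have n: "0 < n" by (simp add: n_def add_pos_nonneg)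
      define s where "s = - a / n"
      have "s * a + s\<^sup>2 * (norm h)\<^sup>2 / 2 \<le> s * a + s\<^sup>2 * n / 2"
        by (simp add: n_def algebra_simps)
      also have "s\<^sup>2 * n = - (s * a)"
        using n by (simp add: s_def power2_eq_square field_simps)
      also have "s * a + - (s * a) / 2 < 0"
      proof -
        have "s * a = - (a\<^sup>2 / n)" by (simp add: s_def power2_eq_square)
        moreover have "0 < a\<^sup>2 / n" using \<open>a \<noteq> 0\<close> n by simp
        ultimately show ?thesis by linarith
      qed
      finally show False using q[of s] by linarith
    qed
    then show ?thesis by (simp add: a_def)
  qed
  show ?thesis
  proof (rule ex1I[of _ g])
    show "\<forall>h. g \<bullet> h = \<phi> h" using eq by simp
    fix g' assume "\<forall>h. g' \<bullet> h = \<phi> h"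
    then have "(g' - g) \<bullet> (g' - g) = 0" using eq by (simp add: inner_diff_left)
    then show "g' = g" by simp
  qed
qed

lemma dual_adjoint_inner:
  fixes A :: "'x::{real_inner, banach} \<Rightarrow>\<^sub>L 'y::real_normed_vector"
  assumes \<zeta>: "\<zeta> \<in> dual_space Y" and A: "\<And>h. blinfun_apply A h \<in> Y"
  shows "dual_adjoint A \<zeta> \<bullet> h = \<zeta> (blinfun_apply A h)"
proof -
  obtain K where K: "\<And>u. u \<in> Y \<Longrightarrow> \<bar>\<zeta> u\<bar> \<le> K * norm u"
    using \<zeta> unfolding dual_space_def by blast
  have "bounded_linear (\<lambda>h. \<zeta> (blinfun_apply A h))"
  proof (rule bounded_linear_intro[where K = "\<bar>K\<bar> * norm A"])
    show "\<zeta> (blinfun_apply A (x + z)) = \<zeta> (blinfun_apply A x) + \<zeta> (blinfun_apply A z)" for x z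
      using \<zeta> A by (simp add: dual_space_def blinfun.add_right)
    show "\<zeta> (blinfun_apply A (s *\<^sub>R x)) = s *\<^sub>R \<zeta> (blinfun_apply A x)" for s x
      using \<zeta> A by (simp add: dual_space_def blinfun.scaleR_right)
    show "norm (\<zeta> (blinfun_apply A x)) \<le> norm x * (\<bar>K\<bar> * norm A)" for x
    proof -
      have "\<bar>\<zeta> (blinfun_apply A x)\<bar> \<le> \<bar>K\<bar> * norm (blinfun_apply A x)"
        using K[OF A[of x]] by (meson abs_ge_self mult_right_mono norm_ge_zero order_trans)
      also have "\<dots> \<le> \<bar>K\<bar> * (norm A * norm x)"
        by (intro mult_left_mono norm_blinfun) auto
      finally show ?thesis by (simp add: mult_ac)
    qed
  qed
  from theI'[OF riesz_representation[OF this]] show ?thesis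
    unfolding dual_adjoint_def by blast
qed



lemma norm_le_if_inner_le:
  fixes g :: "'a::real_inner"
  assumes "\<And>h. g \<bullet> h \<le> K * norm h" "0 \<le> K"
  shows "norm g \<le> K"
proof (cases "g = 0")
  case False
  have "norm g * norm g \<le> K * norm g"
    using assms(1)[of g] by (simp add: dot_square_norm power2_eq_square)
  then show ?thesis using False by simp
qed (use assms in simp)

lemma norm_dual_adjoint_le:
  fixes A :: "'x::{real_inner, banach} \<Rightarrow>\<^sub>L 'y::real_normed_vector"
  assumes \<zeta>: "\<zeta> \<in> dual_space Y" and A: "\<And>h. blinfun_apply A h \<in> Y"
    and K: "\<And>u. u \<in> Y \<Longrightarrow> \<bar>\<zeta> u\<bar> \<le> K * norm u" "0 \<le> K"
  shows "norm (dual_adjoint A \<zeta>) \<le> K * norm A"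
proof (rule norm_le_if_inner_le)
  fix h
  have "\<zeta> (blinfun_apply A h) \<le> K * norm (blinfun_apply A h)"
    using K(1)[OF A[of h]] by linarith
  also have "\<dots> \<le> K * (norm A * norm h)"
    by (intro mult_left_mono norm_blinfun K)
  finally show "dual_adjoint A \<zeta> \<bullet> h \<le> K * norm A * norm h"
    by (simp add: dual_adjoint_inner[OF \<zeta> A] mult_ac)
qed (use K in simp)

lemma norm_dual_adjoint_diff_le:
  fixes A A' :: "'x::{real_inner, banach} \<Rightarrow>\<^sub>L 'y::real_normed_vector"
  assumes \<zeta>: "\<zeta> \<in> dual_space Y" and A: "\<And>h. blinfun_apply A h \<in> Y"
    and \<zeta>': "\<zeta>' \<in> dual_space Y" and A': "\<And>h. blinfun_apply A' h \<in> Y"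
    and Y: "subspace Y"
    and K: "\<And>u. u \<in> Y \<Longrightarrow> \<bar>\<zeta>' u\<bar> \<le> K * norm u" "0 \<le> K"
    and e: "\<And>u. u \<in> Y \<Longrightarrow> \<bar>\<zeta> u - \<zeta>' u\<bar> \<le> e * norm u" "0 \<le> e"
  shows "norm (dual_adjoint A \<zeta> - dual_adjoint A' \<zeta>') \<le> e * norm A + K * norm (A - A')"
proof (rule norm_le_if_inner_le)
  fix h
  have sub: "blinfun_apply (A - A') h \<in> Y"
    using A A' Y by (simp add: blinfun.diff_left subspace_diff)
  have "\<zeta>' (blinfun_apply A h) = \<zeta>' (blinfun_apply (A - A') h) + \<zeta>' (blinfun_apply A' h)"
  proof -
    have "\<zeta>' (blinfun_apply (A - A') h + blinfun_apply A' h)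
        = \<zeta>' (blinfun_apply (A - A') h) + \<zeta>' (blinfun_apply A' h)"
      using \<zeta>' sub A' unfolding dual_space_def by blast
    then show ?thesis by (simp add: blinfun.diff_left)
  qed
  then have "\<zeta> (blinfun_apply A h) - \<zeta>' (blinfun_apply A' h)
      = (\<zeta> (blinfun_apply A h) - \<zeta>' (blinfun_apply A h)) + \<zeta>' (blinfun_apply (A - A') h)"
    by simp
  also have "\<dots> \<le> e * norm (blinfun_apply A h) + K * norm (blinfun_apply (A - A') h)"
    using e(1)[OF A[of h]] K(1)[OF sub] by linarith
  also have "\<dots> \<le> e * (norm A * norm h) + K * (norm (A - A') * norm h)"
    by (intro add_mono mult_left_mono norm_blinfun K e)
  finally show "(dual_adjoint A \<zeta> - dual_adjoint A' \<zeta>') \<bullet> h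
      \<le> (e * norm A + K * norm (A - A')) * norm h"
    by (simp add: dual_adjoint_inner[OF \<zeta> A] dual_adjoint_inner[OF \<zeta>' A'] inner_diff_left
        algebra_simps)
qed (use K e in simp)

section \<open>Duality mappings of uniformly smooth spaces\<close>


text \<open>The only form in which uniform smoothness enters below: at a single suitable scale \<open>s\<close>, uniformly on the
unit sphere.\<close>

lemma uniformly_smooth_bound:
  fixes Y :: "'y::real_normed_vector set"
  assumes "uniformly_smooth Y" "0 < e"
  obtains s where "0 < s"
    "\<And>u v. u \<in> Y \<Longrightarrow> v \<in> Y \<Longrightarrow> norm u = 1 \<Longrightarrow> norm v \<le> s \<Longrightarrow>
      norm (u + v) + norm (u - v) - 2 \<le> e * s"
proof -
  have "\<forall>\<^sub>F s in at_right 0. smoothness_modulus Y s / s < e"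
    using assms unfolding uniformly_smooth_def by (rule order_tendstoD(2))
  then obtain d where d: "d > 0" "\<And>s. 0 < s \<Longrightarrow> s < d \<Longrightarrow> smoothness_modulus Y s / s < e"
    by (auto simp: eventually_at_right_field)
  define s where "s = d / 2"
  have s: "0 < s" "smoothness_modulus Y s < e * s"
    using d(1) d(2)[of s] by (auto simp: s_def field_simps)
  have "norm (u + v) + norm (u - v) - 2 \<le> e * s"
    if uv: "u \<in> Y" "v \<in> Y" "norm u = 1" "norm v \<le> s" for u v
  proof -
    let ?A = "insert 0 {norm (u + v) + norm (u - v) - 2 | u v.
                      u \<in> Y \<and> v \<in> Y \<and> norm u = 1 \<and> norm v \<le> s}"
    have "bdd_above ?A"
    proof (rule bdd_aboveI[of _ "2 * s"])
      fix a assume "a \<in> ?A"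
      then consider "a = 0" | u v :: 'y where "a = norm (u + v) + norm (u - v) - 2" "norm u = 1" "norm v \<le> s"
        by blast
      then show "a \<le> 2 * s"
      proof cases
        case 2
        then show ?thesis using norm_triangle_ineq[of u v] norm_triangle_ineq4[of u v] by linarith
      qed (use s in simp)
    qed
    then have "norm (u + v) + norm (u - v) - 2 \<le> smoothness_modulus Y s"
      unfolding smoothness_modulus_def using uv by (intro cSup_upper) auto
    then show ?thesis using s by linarith
  qed
  then show ?thesis using that s by blast
qed

definition norming :: "'y::real_normed_vector set \<Rightarrow> 'y \<Rightarrow> ('y \<Rightarrow> real) \<Rightarrow> bool" where
  "norming Y u \<zeta> \<longleftrightarrow> \<zeta> \<in> dual_space Y \<and> (\<forall>v\<in>Y. \<bar>\<zeta> v\<bar> \<le> norm v) \<and> \<zeta> u = norm u"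

lemma dual_space_linear:
  assumes "\<zeta> \<in> dual_space Y" "u \<in> Y"
  shows "v \<in> Y \<Longrightarrow> \<zeta> (u + v) = \<zeta> u + \<zeta> v" "\<zeta> (c *\<^sub>R u) = c * \<zeta> u" "\<zeta> (- u) = - \<zeta> u"
proof -
  show 1: "\<zeta> (c *\<^sub>R u) = c * \<zeta> u" for c
    using assms by (simp add: dual_space_def)
  show "\<zeta> (- u) = - \<zeta> u" using 1[of "- 1"] by simp
  show "v \<in> Y \<Longrightarrow> \<zeta> (u + v) = \<zeta> u + \<zeta> v"
    using assms by (simp add: dual_space_def)
qed

lemma dual_space_diff:
  assumes "\<zeta> \<in> dual_space Y" "subspace Y" "u \<in> Y" "v \<in> Y"
  shows "\<zeta> (u - v) = \<zeta> u - \<zeta> v"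
  using dual_space_linear(1)[OF assms(1,3), of "- v"] dual_space_linear(3)[OF assms(1,4)]
    subspace_neg[OF assms(2,4)] by simp

lemma dual_space_zero:
  assumes "\<zeta> \<in> dual_space Y" "subspace Y"
  shows "\<zeta> 0 = 0"
  using dual_space_diff[OF assms subspace_0[OF assms(2)] subspace_0[OF assms(2)]] by simp

text \<open>Evaluating the two functionals at \<open>w + v\<close> and \<open>u - v\<close>, with \<open>v\<close> scaled to norm \<open>s\<close>, bounds their
difference by the second difference of the norm at \<open>u\<close>. For \<open>u = w\<close> this gives uniqueness of
norming functionals, for \<open>w\<close> near \<open>u\<close> their continuous dependence on \<open>u\<close>.\<close>

lemma norming_functionals_close:
  fixes Y :: "'y::real_normed_vector set"
  assumes Y: "subspace Y" and s: "0 < s"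
    and smooth: "\<And>u v. u \<in> Y \<Longrightarrow> v \<in> Y \<Longrightarrow> norm u = 1 \<Longrightarrow> norm v \<le> s \<Longrightarrow>
      norm (u + v) + norm (u - v) - 2 \<le> e * s"
    and u: "u \<in> Y" "norm u = 1" "norming Y u \<zeta>" and w: "w \<in> Y" "norm w = 1" "norming Y w \<zeta>'"
    and close: "norm (w - u) \<le> e * s" and v: "v \<in> Y"
  shows "\<zeta>' v - \<zeta> v \<le> 2 * e * norm v"
proof (cases "v = 0")
  case True
  then show ?thesis
    using dual_space_zero[of \<zeta> Y] dual_space_zero[of \<zeta>' Y] Y u w by (simp add: norming_def)
next
  case False
  define v' where "v' = (s / norm v) *\<^sub>R v"
  have v': "v' \<in> Y" "norm v' = s"
    using Y v False s by (auto simp: v'_def subspace_scale)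
  have "\<zeta>' (w + v') \<le> norm (w + v')" "\<zeta> (u - v') \<le> norm (u - v')"
    using u w v' Y by (auto simp: norming_def abs_le_iff subspace_add subspace_diff)
  then have "\<zeta>' v' - \<zeta> v' \<le> norm (w + v') + norm (u - v') - 2"
    using u w v' Y dual_space_linear(1)[of \<zeta>' Y w v'] dual_space_diff[of \<zeta> Y u v']
    by (simp add: norming_def)
  also have "norm (w + v') \<le> norm (u + v') + norm (w - u)"
    using norm_triangle_ineq[of "u + v'" "w - u"] by (simp add: add.commute)
  finally have "\<zeta>' v' - \<zeta> v' \<le> 2 * e * s"
    using smooth[OF u(1) v'(1) u(2)] v'(2) close by simp
  moreover have "\<zeta>' v' - \<zeta> v' = (s / norm v) * (\<zeta>' v - \<zeta> v)"
  proof -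
    have "\<zeta>' v' = (s / norm v) * \<zeta>' v" "\<zeta> v' = (s / norm v) * \<zeta> v"
      using u w v unfolding v'_def norming_def by (blast intro: dual_space_linear(2))+
    then show ?thesis by (simp add: algebra_simps)
  qed
  ultimately have "s * (\<zeta>' v - \<zeta> v) \<le> s * (2 * e * norm v)"
    using False by (simp add: field_simps)
  then show ?thesis using s by simp
qed

text \<open>The norming functional is the directional derivative of the norm at \<open>u\<close>. By convexity the
difference quotients are monotone in the step, so their infimum \<open>p\<close> is a sublinear functional; smoothness
makes it odd, and an odd sublinear functional is linear. No extension theorem is involved.\<close>

lemma norming_functional_exists:
  fixes Y :: "'y::real_normed_vector set"
  assumes Y: "subspace Y" and sm: "uniformly_smooth Y" and u: "u \<in> Y" "norm u = 1"
  shows "\<exists>\<zeta>. norming Y u \<zeta>"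
proof -
  define q where "q v t = (norm (u + t *\<^sub>R v) - 1) / t" for v and t :: real
  define p where "p v = (INF t\<in>{0<..}. q v t)" for v
  have q_bd: "\<bar>q v t\<bar> \<le> norm v" if "0 < t" for v t
  proof -
    have "\<bar>norm (u + t *\<^sub>R v) - norm u\<bar> \<le> norm (t *\<^sub>R v)"
      by (smt (verit) norm_triangle_ineq3 add_diff_cancel_left')
    then show ?thesis using that u by (simp add: q_def field_simps)
  qed
  have q_mono: "q v t \<le> q v t'" if "0 < t" "t \<le> t'" for v t t'
  proof -
    have "u + t *\<^sub>R v = (1 - t / t') *\<^sub>R u + (t / t') *\<^sub>R (u + t' *\<^sub>R v)"
      using that by (simp add: algebra_simps)
    then have "norm (u + t *\<^sub>R v) \<le> (1 - t / t') * norm u + (t / t') * norm (u + t' *\<^sub>R v)"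
      using that norm_triangle_ineq[of "(1 - t / t') *\<^sub>R u" "(t / t') *\<^sub>R (u + t' *\<^sub>R v)"] by simp
    then have "norm (u + t *\<^sub>R v) - 1 \<le> (t / t') * (norm (u + t' *\<^sub>R v) - 1)"
      using u by (simp add: algebra_simps)
    then show ?thesis
      using that by (simp add: q_def field_simps)
  qed
  have bdd: "bdd_below (q v ` {0<..})" for v
    using q_bd[of _ v] by (intro bdd_belowI2[of _ "- norm v"]) (auto simp: abs_le_iff, smt (verit))
  have p_le: "p v \<le> q v t" if "0 < t" for v t
    unfolding p_def using bdd that by (intro cINF_lower) auto
  have p_ge: "a \<le> p v" if "\<And>t. 0 < t \<Longrightarrow> a \<le> q v t" for a v
    unfolding p_def using that by (intro cINF_greatest) auto
  have p_bd: "\<bar>p v\<bar> \<le> norm v" for v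
  proof -
    have "- norm v \<le> p v"
    proof (rule p_ge)
      show "- norm v \<le> q v t" if "0 < t" for t using q_bd[OF that, of v] by linarith
    qed
    then show ?thesis using p_le[of 1 v] q_bd[of 1 v] by linarith
  qed
  have p_sub: "p (v + w) \<le> p v + p w" for v w
  proof -
    have half: "p (v + w) \<le> q v t + q w t'" if "0 < t" "0 < t'" for t t'
    proof -
      define m where "m = min t t'"
      have m: "0 < m" "m \<le> t" "m \<le> t'" using that by (auto simp: m_def)
      have "2 *\<^sub>R (u + (m / 2) *\<^sub>R (v + w)) = (u + m *\<^sub>R v) + (u + m *\<^sub>R w)"
        by (simp add: algebra_simps scaleR_2)
      then have "2 * norm (u + (m / 2) *\<^sub>R (v + w)) \<le> norm (u + m *\<^sub>R v) + norm (u + m *\<^sub>R w)"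
        by (metis norm_triangle_ineq norm_scaleR abs_numeral)
      then have "(2 * norm (u + (m / 2) *\<^sub>R (v + w)) - 2) / m
          \<le> (norm (u + m *\<^sub>R v) + norm (u + m *\<^sub>R w) - 2) / m"
        using m by (intro divide_right_mono) auto
      moreover have "q (v + w) (m / 2) = (2 * norm (u + (m / 2) *\<^sub>R (v + w)) - 2) / m"
        by (simp add: q_def diff_divide_distrib mult.commute)
      moreover have "q v m + q w m = (norm (u + m *\<^sub>R v) + norm (u + m *\<^sub>R w) - 2) / m"
        by (simp add: q_def diff_divide_distrib add_divide_distrib)
      ultimately have "q (v + w) (m / 2) \<le> q v m + q w m" by linarith
      then show ?thesis
        using p_le[of "m/2" "v + w"] m q_mono[of m t v] q_mono[of m t' w] by simp
    qed
    have "p (v + w) - q v t \<le> p w" if "0 < t" for t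
      using half[OF that] by (intro p_ge) (simp add: algebra_simps)
    then have "p (v + w) - p w \<le> p v"
      by (intro p_ge) (simp add: algebra_simps)
    then show ?thesis by simp
  qed
  have p0: "p 0 = 0" using p_bd[of 0] by simp
  have p_neg: "p (- v) = - p v" if v: "v \<in> Y" for v
  proof (rule antisym)
    show "- p v \<le> p (- v)" using p_sub[of v "- v"] p0 by simp
    have eps: "p v + p (- v) \<le> e * norm v" if e: "0 < e" for e
    proof (cases "v = 0")
      case False
      obtain s where s: "0 < s" "\<And>u v. u \<in> Y \<Longrightarrow> v \<in> Y \<Longrightarrow> norm u = 1 \<Longrightarrow> norm v \<le> s \<Longrightarrow>
          norm (u + v) + norm (u - v) - 2 \<le> e * s"
        using uniformly_smooth_bound[OF sm e] by blast
      define t where "t = s / norm v"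
      have t: "0 < t" using s False by (simp add: t_def)
      have "norm (u + t *\<^sub>R v) + norm (u - t *\<^sub>R v) - 2 \<le> e * s"
        using s(1) v False Y u by (intro s(2)) (auto simp: t_def subspace_scale)
      then have "(norm (u + t *\<^sub>R v) + norm (u - t *\<^sub>R v) - 2) / t \<le> e * s / t"
        using t by (intro divide_right_mono) auto
      then have "q v t + q (- v) t \<le> e * s / t"
        by (simp add: q_def diff_divide_distrib add_divide_distrib)
      also have "e * s / t = e * norm v" using s by (simp add: t_def)
      finally show ?thesis using p_le[OF t, of v] p_le[OF t, of "- v"] by linarith
    qed (use p0 in simp)
    have "p v + p (- v) \<le> 0"
    proof (rule field_le_epsilon)
      fix e :: real assume e: "0 < e"
      have "p v + p (- v) \<le> e / (1 + norm v) * norm v"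
        using e by (intro eps) (simp add: add_pos_nonneg)
      also have "\<dots> \<le> e" using e by (simp add: field_simps add_pos_nonneg)
      finally show "p v + p (- v) \<le> 0 + e" by simp
    qed
    then show "p (- v) \<le> - p v" by simp
  qed
  have p_add: "p (v + w) = p v + p w" if "v \<in> Y" "w \<in> Y" for v w
    using p_sub[of v w] p_sub[of "- v" "- w"] p_neg[OF that(1)] p_neg[OF that(2)]
      p_neg[OF subspace_add[OF Y that]] by simp
  have p_pos: "p (c *\<^sub>R v) = c * p v" if c: "0 < c" for c v
  proof -
    have q: "q (c *\<^sub>R v) t = c * q v (t * c)" if "0 < t" for t v c
      using that by (cases "c = 0") (auto simp: q_def u)
    have le: "c * p v \<le> p (c *\<^sub>R v)" if "0 < c" for c v
      using that p_le[of _ v] q by (intro p_ge) (auto simp: mult_le_cancel_left)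
    from le[OF c, of v] le[of "1 / c" "c *\<^sub>R v"] c show ?thesis
      by (simp add: field_simps)
  qed
  have p_hom: "p (c *\<^sub>R v) = c * p v" if v: "v \<in> Y" for c v
  proof -
    consider "c > 0" | "c = 0" | "c < 0" by linarith
    then show ?thesis
    proof cases
      case 3
      then have "p (c *\<^sub>R v) = p ((- c) *\<^sub>R (- v))" by simp
      also have "\<dots> = (- c) * p (- v)" using 3 by (intro p_pos) simp
      finally show ?thesis using p_neg[OF v] by simp
    qed (use p0 p_pos in auto)
  qed
  define \<zeta> where "\<zeta> v = (if v \<in> Y then p v else 0)" for v
  have pu: "p u = 1"
  proof (rule antisym)
    show "p u \<le> 1" using p_bd[of u] u by simp
    show "1 \<le> p u"
    proof (rule p_ge)
      fix t :: real assume "0 < t"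
      moreover from this have "norm (u + t *\<^sub>R u) = 1 + t"
        using u by (metis abs_of_pos add_pos_pos mult.right_neutral norm_scaleR scaleR_left_distrib
            scaleR_one zero_less_one)
      ultimately show "1 \<le> q u t" by (simp add: q_def)
    qed
  qed
  have "\<zeta> \<in> dual_space Y"
    unfolding dual_space_def using p_add p_hom Y
    by (auto simp: \<zeta>_def subspace_add subspace_scale intro!: exI[of _ 1] p_bd)
       (metis subspace_scale)?
  moreover have "\<forall>v\<in>Y. \<bar>\<zeta> v\<bar> \<le> norm v" "\<zeta> u = norm u"
    using p_bd pu u by (auto simp: \<zeta>_def)
  ultimately show ?thesis unfolding norming_def by blast
qed

lemma dual_norm_bound:
  fixes Y :: "'y::real_normed_vector set"
  assumes Y: "subspace Y" and \<zeta>: "\<zeta> \<in> dual_space Y" and v: "v \<in> Y"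
  shows "\<bar>\<zeta> v\<bar> \<le> dual_norm Y \<zeta> * norm v"
proof (cases "v = 0")
  case True
  then show ?thesis using dual_space_zero[OF \<zeta> Y] by simp
next
  case False
  obtain K where K: "\<And>u. u \<in> Y \<Longrightarrow> \<bar>\<zeta> u\<bar> \<le> K * norm u"
    using \<zeta> unfolding dual_space_def by blast
  have "bdd_above {\<bar>\<zeta> u\<bar> | u. u \<in> Y \<and> norm u \<le> 1}"
  proof (rule bdd_aboveI[of _ "\<bar>K\<bar>"])
    fix a assume "a \<in> {\<bar>\<zeta> u\<bar> | u. u \<in> Y \<and> norm u \<le> 1}"
    then obtain u where u: "a = \<bar>\<zeta> u\<bar>" "u \<in> Y" "norm u \<le> 1" by auto
    have "K * norm u \<le> \<bar>K\<bar> * 1"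
      using u by (intro mult_mono) auto
    then show "a \<le> \<bar>K\<bar>" using K[OF u(2)] u(1) by linarith
  qed
  then have "\<bar>\<zeta> ((1 / norm v) *\<^sub>R v)\<bar> \<le> dual_norm Y \<zeta>"
    unfolding dual_norm_def using v False Y by (intro cSup_upper) (auto simp: subspace_scale)
  also have "\<zeta> ((1 / norm v) *\<^sub>R v) = \<zeta> v / norm v"
    using dual_space_linear(2)[OF \<zeta> v] by simp
  finally show ?thesis using False by (simp add: field_simps)
qed

lemma dual_space_scale:
  "\<zeta> \<in> dual_space Y \<Longrightarrow> (\<lambda>v. c * \<zeta> v) \<in> dual_space Y"
proof -
  assume a: "\<zeta> \<in> dual_space Y"
  then obtain K where K: "\<And>u. u \<in> Y \<Longrightarrow> \<bar>\<zeta> u\<bar> \<le> K * norm u"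
    unfolding dual_space_def by blast
  have "\<bar>c * \<zeta> u\<bar> \<le> (\<bar>c\<bar> * K) * norm u" if "u \<in> Y" for u
    using mult_left_mono[OF K[OF that], of "\<bar>c\<bar>"] by (simp add: abs_mult mult_ac)
  then have "\<exists>K. \<forall>u\<in>Y. \<bar>c * \<zeta> u\<bar> \<le> K * norm u" by blast
  then show ?thesis
    using a by (simp add: dual_space_def algebra_simps)
qed

lemma dual_norm_eqI:
  fixes Y :: "'y::real_normed_vector set"
  assumes "v \<in> Y" "norm v \<le> 1" "\<bar>\<zeta> v\<bar> = K" "\<And>u. u \<in> Y \<Longrightarrow> \<bar>\<zeta> u\<bar> \<le> K * norm u"
  shows "dual_norm Y \<zeta> = K"
  unfolding dual_norm_def
proof (rule cSup_eq_maximum)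
  show "K \<in> {\<bar>\<zeta> u\<bar> |u. u \<in> Y \<and> norm u \<le> 1}" using assms by auto
  fix a assume "a \<in> {\<bar>\<zeta> u\<bar> |u. u \<in> Y \<and> norm u \<le> 1}"
  then obtain u where u: "a = \<bar>\<zeta> u\<bar>" "u \<in> Y" "norm u \<le> 1" by auto
  have "0 \<le> K" using assms(3) by linarith
  then have "K * norm u \<le> K * 1" using u by (intro mult_left_mono) auto
  then show "a \<le> K" using assms(4)[OF u(2)] u(1) by linarith
qed

lemma norming_functional_unique:
  fixes Y :: "'y::real_normed_vector set"
  assumes Y: "subspace Y" and sm: "uniformly_smooth Y" and u: "u \<in> Y" "norm u = 1"
    and z: "norming Y u \<zeta>" "norming Y u \<zeta>'"
  shows "\<zeta> = \<zeta>'"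
proof
  fix v
  have le: "\<zeta>2 v \<le> \<zeta>1 v" if z: "norming Y u \<zeta>1" "norming Y u \<zeta>2" "v \<in> Y" for \<zeta>1 \<zeta>2
  proof (rule field_le_epsilon)
    fix e :: real assume e: "0 < e"
    define e' where "e' = e / (2 * (1 + norm v))"
    have n: "0 < 1 + norm v" by (simp add: add_pos_nonneg)
    have e': "0 < e'" using e n by (simp add: e'_def)
    obtain s where s: "0 < s" "\<And>u v. u \<in> Y \<Longrightarrow> v \<in> Y \<Longrightarrow> norm u = 1 \<Longrightarrow> norm v \<le> s \<Longrightarrow>
          norm (u + v) + norm (u - v) - 2 \<le> e' * s"
      using uniformly_smooth_bound[OF sm e'] by blast
    have "\<zeta>2 v - \<zeta>1 v \<le> 2 * e' * norm v"
    proof (rule norming_functionals_close[OF Y s(1) _ u z(1) u z(2) _ z(3)])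
      show "norm (u - u) \<le> e' * s" using e' s(1) by simp
    qed (rule s(2))
    also have "\<dots> \<le> e" using e n by (simp add: e'_def field_simps)
    finally show "\<zeta>2 v \<le> \<zeta>1 v + e" by simp
  qed
  show "\<zeta> v = \<zeta>' v"
  proof (cases "v \<in> Y")
    case True
    then show ?thesis using le[OF z] le[OF z(2,1)] by simp
  next
    case False
    then show ?thesis using z by (auto simp: norming_def dual_space_def)
  qed
qed

text \<open>The duality mapping at \<open>u \<noteq> 0\<close> is the multiple by \<open>norm u powr (r - 1)\<close> of the unique norming
functional of the normalised vector.\<close>

lemma duality_map_characterisation:
  fixes Y :: "'y::real_normed_vector set"
  assumes Y: "subspace Y" and sm: "uniformly_smooth Y" and r: "1 < r" and u: "u \<in> Y"
  shows "\<exists>!\<zeta>. \<zeta> \<in> dual_space Y \<and> dual_norm Y \<zeta> = norm u powr (r - 1) \<and> \<zeta> u = norm u powr r"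
    and "u \<noteq> 0 \<Longrightarrow> \<exists>\<zeta>. norming Y ((1 / norm u) *\<^sub>R u) \<zeta> \<and>
           duality_map r Y u = (\<lambda>v. norm u powr (r - 1) * \<zeta> v)"
proof -
  let ?P = "\<lambda>\<zeta>. \<zeta> \<in> dual_space Y \<and> dual_norm Y \<zeta> = norm u powr (r - 1) \<and> \<zeta> u = norm u powr r"
  have "(\<exists>!\<zeta>. ?P \<zeta>) \<and> (u \<noteq> 0 \<longrightarrow> (\<exists>\<zeta>. norming Y ((1 / norm u) *\<^sub>R u) \<zeta> \<and>
           duality_map r Y u = (\<lambda>v. norm u powr (r - 1) * \<zeta> v)))"
  proof (cases "u = 0")
    case True
    have "\<exists>!\<zeta>. ?P \<zeta>"
    proof (rule ex1I[of _ "\<lambda>_. 0"])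
      have "(\<lambda>_. 0) \<in> dual_space Y" by (auto simp: dual_space_def intro: exI[of _ 0])
      then show "?P (\<lambda>_. 0)"
        using True subspace_0[OF Y] r by (auto intro!: dual_norm_eqI[of 0])
      fix \<zeta> assume P: "?P \<zeta>"
      then have "\<zeta> v = 0" if "v \<in> Y" for v
        using dual_norm_bound[OF Y _ that, of \<zeta>] True by simp
      moreover have "\<zeta> v = 0" if "v \<notin> Y" for v
        using P that by (auto simp: dual_space_def)
      ultimately show "\<zeta> = (\<lambda>_. 0)" by blast
    qed
    then show ?thesis using True by simp
  next
    case False
    define w where "w = (1 / norm u) *\<^sub>R u"
    define k where "k = norm u powr (r - 1)"
    have k: "k > 0" using False by (simp add: k_def)
    have kr: "norm u powr r = k * norm u"
      using powr_add[of "norm u" "r - 1" 1] False by (simp add: k_def)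
    have w: "w \<in> Y" "norm w = 1" using u Y False by (auto simp: w_def subspace_scale)
    have uw: "u = norm u *\<^sub>R w" using False by (simp add: w_def)
    obtain \<zeta>0 where z0: "norming Y w \<zeta>0" using norming_functional_exists[OF Y sm w] by blast
    have P0: "?P (\<lambda>v. k * \<zeta>0 v)"
    proof (intro conjI)
      show "(\<lambda>v. k * \<zeta>0 v) \<in> dual_space Y"
        using z0 by (intro dual_space_scale) (simp add: norming_def)
      have "dual_norm Y (\<lambda>v. k * \<zeta>0 v) = k"
        using w z0 k by (intro dual_norm_eqI[of w]) (auto simp: norming_def abs_mult)
      then show "dual_norm Y (\<lambda>v. k * \<zeta>0 v) = norm u powr (r - 1)" by (simp add: k_def)
      have "\<zeta>0 u = norm u"
        using z0 w dual_space_linear(2)[of \<zeta>0 Y w "norm u"] uw by (simp add: norming_def)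
      then show "k * \<zeta>0 u = norm u powr r" using kr by simp
    qed
    have uniq: "\<zeta> = (\<lambda>v. k * \<zeta>0 v)" if P: "?P \<zeta>" for \<zeta>
    proof -
      have "norming Y w (\<lambda>v. (1 / k) * \<zeta> v)"
        unfolding norming_def
      proof (intro conjI ballI)
        show "(\<lambda>v. 1 / k * \<zeta> v) \<in> dual_space Y" using P by (intro dual_space_scale) simp
        show "\<bar>1 / k * \<zeta> v\<bar> \<le> norm v" if "v \<in> Y" for v
          using dual_norm_bound[OF Y _ that, of \<zeta>] P k
          by (simp add: k_def[symmetric] field_simps abs_mult)
        have "\<zeta> w = \<zeta> u / norm u"
          using P u dual_space_linear(2)[of \<zeta> Y u] by (simp add: w_def)
        then show "1 / k * \<zeta> w = norm w"
          using P kr k w False by simp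
      qed
      then have "(\<lambda>v. (1 / k) * \<zeta> v) = \<zeta>0"
        using norming_functional_unique[OF Y sm w _ z0] by blast
      then have "(1 / k) * \<zeta> v = \<zeta>0 v" for v by meson
      then show ?thesis using k by (auto simp: field_simps)
    qed
    have "duality_map r Y u = (\<lambda>v. k * \<zeta>0 v)"
      unfolding duality_map_def
      by (rule the_equality[where P = ?P and a = "\<lambda>v. k * \<zeta>0 v", OF P0]) (rule uniq)
    then have "\<exists>\<zeta>. norming Y ((1 / norm u) *\<^sub>R u) \<zeta> \<and>
           duality_map r Y u = (\<lambda>v. norm u powr (r - 1) * \<zeta> v)"
      using z0 unfolding w_def k_def by blast
    moreover have "\<exists>!\<zeta>. ?P \<zeta>"
      by (rule ex1I[where P = ?P and a = "\<lambda>v. k * \<zeta>0 v", OF P0]) (rule uniq)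
    ultimately show ?thesis by blast
  qed
  then show "\<exists>!\<zeta>. ?P \<zeta>" "u \<noteq> 0 \<Longrightarrow> \<exists>\<zeta>. norming Y ((1 / norm u) *\<^sub>R u) \<zeta> \<and>
           duality_map r Y u = (\<lambda>v. norm u powr (r - 1) * \<zeta> v)" by auto
qed

lemma duality_map_properties:
  fixes Y :: "'y::real_normed_vector set"
  assumes Y: "subspace Y" and sm: "uniformly_smooth Y" and r: "1 < r" and u: "u \<in> Y"
  shows "duality_map r Y u \<in> dual_space Y"
    and "duality_map r Y u u = norm u powr r"
    and "v \<in> Y \<Longrightarrow> \<bar>duality_map r Y u v\<bar> \<le> norm u powr (r - 1) * norm v"
  using theI'[OF duality_map_characterisation(1)[OF Y sm r u]] dual_norm_bound[OF Y, of "duality_map r Y u" v]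
  by (auto simp: duality_map_def)

lemma duality_map_continuous:
  fixes Y :: "'y::real_normed_vector set"
  assumes Y: "subspace Y" and sm: "uniformly_smooth Y" and r: "1 < r"
    and u: "u \<in> Y" "u \<noteq> 0" and ul: "\<And>l. ul l \<in> Y" "ul \<longlonglongrightarrow> u" and e: "0 < e"
  shows "\<forall>\<^sub>F l in sequentially. \<forall>v\<in>Y. \<bar>duality_map r Y (ul l) v - duality_map r Y u v\<bar> \<le> e * norm v"
proof -
  define w where "w x = (1 / norm x) *\<^sub>R x" for x :: 'y
  define k where "k x = norm x powr (r - 1)" for x :: 'y
  have k: "k u > 0" using u by (simp add: k_def)
  define e' where "e' = e / (4 * (k u + 1))"
  have e': "0 < e'" using e k by (simp add: e'_def)
  obtain s where s: "0 < s" "\<And>u v. u \<in> Y \<Longrightarrow> v \<in> Y \<Longrightarrow> norm u = 1 \<Longrightarrow> norm v \<le> s \<Longrightarrow>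
          norm (u + v) + norm (u - v) - 2 \<le> e' * s"
    using uniformly_smooth_bound[OF sm e'] by blast
  have "(\<lambda>l. w (ul l)) \<longlonglongrightarrow> w u"
    unfolding w_def using u by (intro tendsto_intros ul) auto
  then have ev1: "\<forall>\<^sub>F l in sequentially. dist (w (ul l)) (w u) < e' * s"
    using e' s by (intro tendstoD) auto
  have "(\<lambda>l. k (ul l)) \<longlonglongrightarrow> k u"
    unfolding k_def using u by (intro tendsto_intros ul) auto
  then have ev2: "\<forall>\<^sub>F l in sequentially. dist (k (ul l)) (k u) < min (e / 2) 1"
    using e by (intro tendstoD) auto
  have ev3: "\<forall>\<^sub>F l in sequentially. ul l \<noteq> 0"
    using tendsto_imp_eventually_ne[OF ul(2) u(2)] .
  show ?thesis using ev1 ev2 ev3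
  proof eventually_elim
    case (elim l)
    have w: "w x \<in> Y" "norm (w x) = 1" if "x \<in> Y" "x \<noteq> 0" for x
      using that Y by (auto simp: w_def subspace_scale)
    obtain \<zeta> where z: "norming Y (w u) \<zeta>" "duality_map r Y u = (\<lambda>v. k u * \<zeta> v)"
      using duality_map_characterisation(2)[OF Y sm r u] by (auto simp: w_def k_def)
    obtain \<zeta>' where z': "norming Y (w (ul l)) \<zeta>'" "duality_map r Y (ul l) = (\<lambda>v. k (ul l) * \<zeta>' v)"
      using duality_map_characterisation(2)[OF Y sm r ul(1)] elim by (auto simp: w_def k_def)
    show ?case
    proof
      fix v assume v: "v \<in> Y"
      have "norm (w (ul l) - w u) \<le> e' * s" "norm (w u - w (ul l)) \<le> e' * s"
        using elim by (auto simp: dist_norm norm_minus_commute)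
      then have "\<zeta>' v - \<zeta> v \<le> 2 * e' * norm v" "\<zeta> v - \<zeta>' v \<le> 2 * e' * norm v"
        using norming_functionals_close[OF Y s(1) s(2) w[OF u] z(1) w[OF ul(1) elim(3)] z'(1) _ v]
          norming_functionals_close[OF Y s(1) s(2) w[OF ul(1) elim(3)] z'(1) w[OF u] z(1) _ v]
        by blast+
      then have "\<bar>\<zeta>' v - \<zeta> v\<bar> \<le> 2 * e' * norm v" by linarith
      then have 1: "\<bar>k (ul l) * (\<zeta>' v - \<zeta> v)\<bar> \<le> (k u + 1) * (2 * e' * norm v)"
        using elim k unfolding abs_mult by (intro mult_mono) (auto simp: dist_real_def)
      have "\<bar>\<zeta> v\<bar> \<le> norm v" using z v by (simp add: norming_def)
      then have 2: "\<bar>(k (ul l) - k u) * \<zeta> v\<bar> \<le> e / 2 * norm v"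
        using elim e unfolding abs_mult by (intro mult_mono) (auto simp: dist_real_def)
      have "(k u + 1) * (2 * e' * norm v) = e / 2 * norm v"
        using k by (simp add: e'_def field_simps)
      moreover have "k (ul l) * \<zeta>' v - k u * \<zeta> v = k (ul l) * (\<zeta>' v - \<zeta> v) + (k (ul l) - k u) * \<zeta> v"
        by (simp add: algebra_simps)
      ultimately show "\<bar>duality_map r Y (ul l) v - duality_map r Y u v\<bar> \<le> e * norm v"
        using 1 2 unfolding z z' by linarith
    qed
  qed
qed

section \<open>The penalty functional and the system\<close>

lemma lower_semicontinuous_open:
  fixes \<Theta> :: "'x::topological_space \<Rightarrow> ereal"
  assumes lsc: "lower_semicontinuous \<Theta>"
  shows "open {x. a < \<Theta> x}"
proof (subst open_subopen, intro ballI)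
  fix x assume x: "x \<in> {x. a < \<Theta> x}"
  then have "a < Liminf (at x) \<Theta>"
    using lsc unfolding lower_semicontinuous_def by (auto intro: less_le_trans)
  then have "\<forall>\<^sub>F z in at x. a < \<Theta> z"
    by (rule less_LiminfD)
  then have "\<forall>\<^sub>F z in nhds x. a < \<Theta> z"
    unfolding eventually_at_filter using x by (auto elim!: eventually_mono)
  then show "\<exists>T. open T \<and> x \<in> T \<and> T \<subseteq> {x. a < \<Theta> x}"
    unfolding eventually_nhds by auto
qed

lemma lower_semicontinuous_sequence:
  fixes \<Theta> :: "'x::topological_space \<Rightarrow> ereal"
  assumes lsc: "lower_semicontinuous \<Theta>" and u: "u \<longlonglongrightarrow> x"
    and le: "\<And>k. \<Theta> (u k) \<le> ereal (c k)" and c: "c \<longlonglongrightarrow> a"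
  shows "\<Theta> x \<le> ereal a"
proof (rule ccontr)
  assume "\<not> \<Theta> x \<le> ereal a"
  then obtain b where b: "ereal a < ereal b" "ereal b < \<Theta> x"
    using ereal_dense2[of "ereal a" "\<Theta> x"] by (meson not_le)
  have "\<forall>\<^sub>F k in sequentially. u k \<in> {z. ereal b < \<Theta> z}"
    using b(2) by (intro topological_tendstoD[OF u lower_semicontinuous_open[OF lsc]]) simp
  moreover have "\<forall>\<^sub>F k in sequentially. c k < b"
    using c b(1) by (intro order_tendstoD(2)) auto
  ultimately have "\<forall>\<^sub>F k in sequentially. False"
  proof eventually_elim
    case (elim k)
    then show ?case using le[of k] by (metis ereal_less_eq(3) leD less_imp_le mem_Collect_eq order_trans)
  qed
  then show False by simp
qed

locale nonlinear_system =
  fixes \<Theta> :: "'x::{real_inner, banach} \<Rightarrow> ereal"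
    and Y :: "nat \<Rightarrow> 'y::real_normed_vector set"
    and domF :: "nat \<Rightarrow> 'x set"
    and F :: "nat \<Rightarrow> 'x \<Rightarrow> 'y"
    and L :: "nat \<Rightarrow> 'x \<Rightarrow> ('x \<Rightarrow>\<^sub>L 'y)"
    and y :: "nat \<Rightarrow> 'y"
    and N :: nat
    and x0 \<xi>0 :: 'x
    and \<sigma> \<rho> B0 \<eta> r \<mu>0 \<mu>1 \<upsilon>0 \<upsilon>1 \<beta> \<tau> :: real
  assumes N_pos: "1 \<le> N"
    and Y_subspace: "\<And>i. i \<in> {1..N} \<Longrightarrow> subspace (Y i)"
    and Y_smooth: "\<And>i. i \<in> {1..N} \<Longrightarrow> uniformly_smooth (Y i)"
    and F_range: "\<And>i x. i \<in> {1..N} \<Longrightarrow> x \<in> domF i \<Longrightarrow> F i x \<in> Y i"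
    and y_range: "\<And>i. i \<in> {1..N} \<Longrightarrow> y i \<in> Y i"
    and \<Theta>_proper: "proper \<Theta>" and \<Theta>_lsc: "lower_semicontinuous \<Theta>" and \<Theta>_sc: "strongly_convex \<Theta>"
    and \<sigma>: "\<sigma> > 0"
    and bregman_ge: "\<And>z x \<xi>. x \<in> dom_subdiff \<Theta> \<Longrightarrow> \<xi> \<in> subdiff \<Theta> x \<Longrightarrow>
          bregman \<Theta> \<xi> z x \<ge> ereal (\<sigma> * (norm (z - x))\<^sup>2)"
    and init: "\<xi>0 \<in> subdiff \<Theta> x0"
    and \<rho>: "\<rho> > 0" and ball_dom: "cball x0 (2 * \<rho>) \<subseteq> common_dom N domF"
    and solvable: "\<exists>x\<in>edom \<Theta>. is_solution N domF F y x \<and> bregman \<Theta> \<xi>0 x x0 \<le> ereal (\<sigma> * \<rho>\<^sup>2)"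
    and L_range: "\<And>i x h. i \<in> {1..N} \<Longrightarrow> x \<in> cball x0 (2 * \<rho>) \<Longrightarrow> blinfun_apply (L i x) h \<in> Y i"
    and L_cont: "\<And>i. i \<in> {1..N} \<Longrightarrow> continuous_on (cball x0 (2 * \<rho>)) (L i)"
    and B0: "B0 > 0"
    and L_bound: "\<And>i x. i \<in> {1..N} \<Longrightarrow> x \<in> cball x0 (2 * \<rho>) \<Longrightarrow> norm (L i x) \<le> B0"
    and \<eta>: "0 \<le> \<eta>" "\<eta> < 1"
    and tcc: "\<And>i x z. i \<in> {1..N} \<Longrightarrow> x \<in> cball x0 (2 * \<rho>) \<Longrightarrow> z \<in> cball x0 (2 * \<rho>) \<Longrightarrow>
        norm (F i x - F i z - blinfun_apply (L i x) (x - z)) \<le> \<eta> * norm (F i x - F i z)"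
    and r: "1 < r"
    and \<mu>0: "0 < \<mu>0" "\<mu>0 < 4 * \<sigma>"
    and \<mu>1: "\<mu>1 > 0"
    and \<upsilon>: "\<upsilon>0 > 0" "\<upsilon>1 > 0"
    and \<beta>: "0 \<le> \<beta>" "\<beta> < 1"
    and \<tau>: "\<tau> > (1 + \<eta>) / (1 - \<eta>)"
begin

definition \<theta> :: "'x \<Rightarrow> real" where
  "\<theta> x = real_of_ereal (\<Theta> x)"

definition D :: "'x \<Rightarrow> 'x \<Rightarrow> 'x \<Rightarrow> real" where
  "D \<xi> z x = \<theta> z - \<theta> x - \<xi> \<bullet> (z - x)"

definition Sol :: "'x set" where
  "Sol = {x \<in> cball x0 (2 * \<rho>). x \<in> edom \<Theta> \<and> (\<forall>i\<in>{1..N}. F i x = y i)}"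

lemma \<Theta>_real: "x \<in> edom \<Theta> \<Longrightarrow> \<Theta> x = ereal (\<theta> x)"
  using \<Theta>_proper unfolding edom_def proper_def \<theta>_def
  by (cases "\<Theta> x") auto

lemma subdiff_imp_edom:
  assumes "\<xi> \<in> subdiff \<Theta> x" shows "x \<in> edom \<Theta>"
proof -
  obtain z where z: "\<Theta> z < \<infinity>" using \<Theta>_proper by (auto simp: proper_def)
  have "\<Theta> x + ereal (\<xi> \<bullet> (z - x)) \<le> \<Theta> z" using assms by (auto simp: subdiff_def)
  then show ?thesis using z by (auto simp: edom_def less_top[symmetric])
qed

lemma bregman_real: "z \<in> edom \<Theta> \<Longrightarrow> x \<in> edom \<Theta> \<Longrightarrow> bregman \<Theta> \<xi> z x = ereal (D \<xi> z x)"
  by (simp add: bregman_def D_def \<Theta>_real)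

lemma D_ge:
  assumes "\<xi> \<in> subdiff \<Theta> x" "z \<in> edom \<Theta>"
  shows "D \<xi> z x \<ge> \<sigma> * (norm (z - x))\<^sup>2"
proof -
  have x: "x \<in> edom \<Theta>" using subdiff_imp_edom assms by blast
  then have "ereal (\<sigma> * (norm (z - x))\<^sup>2) \<le> bregman \<Theta> \<xi> z x"
    using assms by (intro bregman_ge) (auto simp: dom_subdiff_def)
  then show ?thesis using bregman_real[OF assms(2) x] by simp
qed

lemma D_nonneg: "\<xi> \<in> subdiff \<Theta> x \<Longrightarrow> z \<in> edom \<Theta> \<Longrightarrow> 0 \<le> D \<xi> z x"
  using D_ge[of \<xi> x z] \<sigma> by (smt (verit) mult_nonneg_nonneg zero_le_power2)

text \<open>Iterates depend on the dual variables \<open>\<xi>(n)\<close> in a Lipschitz way, so it suffices to control the latter.\<close>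

lemma subgradient_monotone:
  assumes "\<xi> \<in> subdiff \<Theta> x" "\<xi>' \<in> subdiff \<Theta> x'"
  shows "2 * \<sigma> * norm (x - x') \<le> norm (\<xi> - \<xi>')"
proof (cases "x = x'")
  case False
  have "D \<xi> x' x + D \<xi>' x x' \<ge> \<sigma> * (norm (x' - x))\<^sup>2 + \<sigma> * (norm (x - x'))\<^sup>2"
    using D_ge assms subdiff_imp_edom by (intro add_mono) auto
  then have "2 * \<sigma> * (norm (x - x'))\<^sup>2 \<le> (\<xi> - \<xi>') \<bullet> (x - x')"
    by (simp add: D_def norm_minus_commute inner_simps)
  also have "\<dots> \<le> norm (\<xi> - \<xi>') * norm (x - x')" by (rule norm_cauchy_schwarz)
  finally show ?thesis using False by (simp add: power2_eq_square)
qed simp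

lemma edom_sequence:
  assumes "\<And>k. u k \<in> edom \<Theta>" "u \<longlonglongrightarrow> x" "\<And>k. \<theta> (u k) \<le> c k" "c \<longlonglongrightarrow> a"
  shows "x \<in> edom \<Theta>" "\<theta> x \<le> a"
proof -
  have "\<Theta> x \<le> ereal a"
    using assms \<Theta>_real by (intro lower_semicontinuous_sequence[OF \<Theta>_lsc assms(2) _ assms(4)]) simp
  then show 1: "x \<in> edom \<Theta>" by (auto simp: edom_def less_top[symmetric])
  show "\<theta> x \<le> a" using \<open>\<Theta> x \<le> ereal a\<close> \<Theta>_real[OF 1] by simp
qed

lemma \<theta>_midpoint:
  obtains \<kappa> where "\<kappa> > 0" "\<And>x z. x \<in> edom \<Theta> \<Longrightarrow> z \<in> edom \<Theta> \<Longrightarrow>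
    (1/2) *\<^sub>R (x + z) \<in> edom \<Theta> \<and> \<theta> ((1/2) *\<^sub>R (x + z)) + \<kappa> * (norm (x - z))\<^sup>2 \<le> (\<theta> x + \<theta> z) / 2"
proof -
  obtain \<kappa> where k: "\<kappa> > 0" "\<And>x y s. s \<in> {0..1} \<Longrightarrow>
     \<Theta> (s *\<^sub>R x + (1 - s) *\<^sub>R y) + ereal (\<kappa> * s * (1 - s) * (norm (x - y))\<^sup>2)
       \<le> ereal s * \<Theta> x + ereal (1 - s) * \<Theta> y"
    using \<Theta>_sc unfolding strongly_convex_def by blast
  show ?thesis
  proof (rule that[of "\<kappa> / 4"])
    fix x z assume xz: "x \<in> edom \<Theta>" "z \<in> edom \<Theta>"
    have "\<Theta> ((1/2) *\<^sub>R x + (1 - 1/2) *\<^sub>R z) + ereal (\<kappa> * (1/2) * (1 - 1/2) * (norm (x - z))\<^sup>2)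
       \<le> ereal (1/2) * \<Theta> x + ereal (1 - 1/2) * \<Theta> z"
      by (rule k(2)) simp
    moreover have "(1/2) *\<^sub>R x + (1 - 1/2) *\<^sub>R z = (1/2) *\<^sub>R (x + z)"
      by (simp add: algebra_simps)
    ultimately have *: "\<Theta> ((1/2) *\<^sub>R (x + z)) + ereal (\<kappa> / 4 * (norm (x - z))\<^sup>2) \<le> ereal ((\<theta> x + \<theta> z) / 2)"
      using xz by (simp add: \<Theta>_real add_divide_distrib)
    then have e: "(1/2) *\<^sub>R (x + z) \<in> edom \<Theta>"
      by (auto simp: edom_def less_top[symmetric])
    show "(1/2) *\<^sub>R (x + z) \<in> edom \<Theta> \<and>
      \<theta> ((1/2) *\<^sub>R (x + z)) + \<kappa> / 4 * (norm (x - z))\<^sup>2 \<le> (\<theta> x + \<theta> z) / 2"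
      using * e by (simp add: \<Theta>_real[OF e])
  qed (use k in simp)
qed

text \<open>The subgradient at \<open>x0\<close> bounds the tilted penalty from below by a quadratic, so strongly convex
minimisation applies for every tilt \<open>\<xi>\<close>.\<close>

lemma tilted_minimiser:
  assumes S: "S \<subseteq> edom \<Theta>" "S \<noteq> {}"
    and mid: "\<And>x z. x \<in> S \<Longrightarrow> z \<in> S \<Longrightarrow> (1/2) *\<^sub>R (x + z) \<in> edom \<Theta> \<Longrightarrow> (1/2) *\<^sub>R (x + z) \<in> S"
    and cl: "\<And>u x. (\<And>k. u k \<in> S) \<Longrightarrow> u \<longlonglongrightarrow> x \<Longrightarrow> x \<in> edom \<Theta> \<Longrightarrow> x \<in> S"
  shows "\<exists>!x. x \<in> S \<and> (\<forall>z\<in>S. \<theta> x - \<xi> \<bullet> x \<le> \<theta> z - \<xi> \<bullet> z)"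
proof -
  obtain \<kappa> where k: "\<kappa> > 0" "\<And>x z. x \<in> edom \<Theta> \<Longrightarrow> z \<in> edom \<Theta> \<Longrightarrow>
    (1/2) *\<^sub>R (x + z) \<in> edom \<Theta> \<and> \<theta> ((1/2) *\<^sub>R (x + z)) + \<kappa> * (norm (x - z))\<^sup>2 \<le> (\<theta> x + \<theta> z) / 2"
    using \<theta>_midpoint by blast
  show ?thesis
  proof (rule strongly_convex_minimiser[OF S(2) _ _ k(1)])
    show "\<theta> x0 - \<xi> \<bullet> x0 - (norm (\<xi>0 - \<xi>))\<^sup>2 / (4 * \<sigma>) \<le> \<theta> x - \<xi> \<bullet> x" if x: "x \<in> S" for x
    proof -
      define a b where "a = norm (\<xi>0 - \<xi>)" and "b = norm (x - x0)"
      have "D \<xi>0 x x0 \<ge> \<sigma> * b\<^sup>2" unfolding b_def using D_ge[OF init] x S by auto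
      moreover have "- (a * b) \<le> (\<xi>0 - \<xi>) \<bullet> (x - x0)"
        unfolding a_def b_def using Cauchy_Schwarz_ineq2[of "\<xi>0 - \<xi>" "x - x0"] by linarith
      moreover have "a * b \<le> \<sigma> * b\<^sup>2 + a\<^sup>2 / (4 * \<sigma>)"
      proof -
        have "0 \<le> (2 * \<sigma> * b - a)\<^sup>2 / (4 * \<sigma>)" using \<sigma> by simp
        also have "\<dots> = \<sigma> * b\<^sup>2 + a\<^sup>2 / (4 * \<sigma>) - a * b"
          using \<sigma> by (simp add: power2_eq_square field_simps)
        finally show ?thesis by simp
      qed
      ultimately show ?thesis
        unfolding D_def a_def[symmetric] by (simp add: inner_simps)
    qed
    show "(1/2) *\<^sub>R (x + z) \<in> S \<and> (\<theta> ((1/2) *\<^sub>R (x + z)) - \<xi> \<bullet> ((1/2) *\<^sub>R (x + z)))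
        + \<kappa> * (norm (x - z))\<^sup>2 \<le> ((\<theta> x - \<xi> \<bullet> x) + (\<theta> z - \<xi> \<bullet> z)) / 2"
      if "x \<in> S" "z \<in> S" for x z
    proof -
      have K: "(1/2) *\<^sub>R (x + z) \<in> edom \<Theta>"
        "\<theta> ((1/2) *\<^sub>R (x + z)) + \<kappa> * (norm (x - z))\<^sup>2 \<le> (\<theta> x + \<theta> z) / 2"
        using k(2)[of x z] that S(1) by blast+
      have "\<xi> \<bullet> ((1/2) *\<^sub>R (x + z)) = (\<xi> \<bullet> x + \<xi> \<bullet> z) / 2" by (simp add: inner_simps)
      then have "(\<theta> ((1/2) *\<^sub>R (x + z)) - \<xi> \<bullet> ((1/2) *\<^sub>R (x + z))) + \<kappa> * (norm (x - z))\<^sup>2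
          \<le> ((\<theta> x - \<xi> \<bullet> x) + (\<theta> z - \<xi> \<bullet> z)) / 2"
        using K(2) by argo
      then show ?thesis using mid[OF that K(1)] by blast
    qed
    show "x \<in> S \<and> \<theta> x - \<xi> \<bullet> x \<le> a"
      if u: "\<And>k. u k \<in> S" "u \<longlonglongrightarrow> x" "(\<lambda>k. \<theta> (u k) - \<xi> \<bullet> u k) \<longlonglongrightarrow> a" for u x a
    proof -
      have lim: "(\<lambda>k. (\<theta> (u k) - \<xi> \<bullet> u k) + \<xi> \<bullet> u k) \<longlonglongrightarrow> a + \<xi> \<bullet> x"
        by (intro tendsto_intros u)
      have uk: "u k \<in> edom \<Theta>" for k using u S by auto
      have "x \<in> edom \<Theta>" "\<theta> x \<le> a + \<xi> \<bullet> x"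
        using edom_sequence[OF uk u(2) _ lim] by auto
      then show ?thesis using cl u by auto
    qed
  qed
qed

lemma argmin_subdiff:
  "\<xi> \<in> subdiff \<Theta> (ARG_MIN (\<lambda>x. \<Theta> x - ereal (\<xi> \<bullet> x)) x. True)"
proof -
  have "x0 \<in> edom \<Theta>" using subdiff_imp_edom[OF init] .
  then obtain x where x: "x \<in> edom \<Theta>" "\<And>z. z \<in> edom \<Theta> \<Longrightarrow> \<theta> x - \<xi> \<bullet> x \<le> \<theta> z - \<xi> \<bullet> z"
    using tilted_minimiser[of "edom \<Theta>" \<xi>] by blast
  let ?f = "\<lambda>x. \<Theta> x - ereal (\<xi> \<bullet> x)"
  have "is_arg_min ?f (\<lambda>_. True) x"
  proof -
    have "?f x \<le> ?f z" for z
    proof (cases "z \<in> edom \<Theta>")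
      case True
      then show ?thesis using x(2)[OF True] by (simp add: \<Theta>_real x(1))
    next
      case False
      then have "\<Theta> z = \<infinity>" by (simp add: edom_def)
      then show ?thesis by simp
    qed
    then show ?thesis by (simp add: is_arg_min_linorder)
  qed
  then have "is_arg_min ?f (\<lambda>_. True) (arg_min ?f (\<lambda>_. True))"
    unfolding arg_min_def by (rule someI)
  then have a: "?f (arg_min ?f (\<lambda>_. True)) \<le> ?f z" for z
    by (simp add: is_arg_min_linorder)
  define w where "w = arg_min ?f (\<lambda>_. True)"
  have w: "w \<in> edom \<Theta>"
    using a[of x] x(1) \<Theta>_real[OF x(1)] by (cases "\<Theta> w") (auto simp: w_def[symmetric] edom_def)
  have "\<Theta> w + ereal (\<xi> \<bullet> (z - w)) \<le> \<Theta> z" for z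
  proof (cases "z \<in> edom \<Theta>")
    case True
    then show ?thesis
      using a[of z] by (simp add: \<Theta>_real w w_def[symmetric] inner_simps)
  next
    case False
    then have "\<Theta> z = \<infinity>" by (simp add: edom_def)
    then show ?thesis by simp
  qed
  then show ?thesis
    unfolding w_def[symmetric] by (simp add: subdiff_def)
qed

lemma F_in_Y: "i \<in> {1..N} \<Longrightarrow> x \<in> cball x0 (2 * \<rho>) \<Longrightarrow> F i x \<in> Y i"
  using ball_dom F_range unfolding common_dom_def by blast

text \<open>The tangential cone condition makes \<open>F\<close> comparable with its linearisation. In particular, two points
of the ball have the same image under \<open>F i\<close> iff the linearisation annihilates their difference.\<close>

lemma F_linearised_bound:
  assumes "i \<in> {1..N}" "x \<in> cball x0 (2 * \<rho>)" "z \<in> cball x0 (2 * \<rho>)"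
  shows "norm (blinfun_apply (L i x) (x - z)) \<le> (1 + \<eta>) * norm (F i x - F i z)"
    and "(1 - \<eta>) * norm (F i x - F i z) \<le> norm (blinfun_apply (L i x) (x - z))"
proof -
  have "\<bar>norm (F i x - F i z) - norm (blinfun_apply (L i x) (x - z))\<bar> \<le> \<eta> * norm (F i x - F i z)"
    using tcc[OF assms] norm_triangle_ineq3[of "F i x - F i z" "blinfun_apply (L i x) (x - z)"] by linarith
  then show "norm (blinfun_apply (L i x) (x - z)) \<le> (1 + \<eta>) * norm (F i x - F i z)"
    "(1 - \<eta>) * norm (F i x - F i z) \<le> norm (blinfun_apply (L i x) (x - z))"
    by (auto simp: algebra_simps)
qed

lemma F_sequence:
  assumes "i \<in> {1..N}" "\<And>k. u k \<in> cball x0 (2 * \<rho>)" "u \<longlonglongrightarrow> x"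
  shows "x \<in> cball x0 (2 * \<rho>)" "(\<lambda>k. F i (u k)) \<longlonglongrightarrow> F i x"
proof -
  show x: "x \<in> cball x0 (2 * \<rho>)"
    using closed_sequentially[OF closed_cball] assms by blast
  have "norm (F i (u k) - F i x) \<le> B0 / (1 - \<eta>) * norm (u k - x)" for k
  proof -
    have "(1 - \<eta>) * norm (F i (u k) - F i x) \<le> norm (blinfun_apply (L i (u k)) (u k - x))"
      using F_linearised_bound(2) assms x by blast
    also have "\<dots> \<le> norm (L i (u k)) * norm (u k - x)" by (rule norm_blinfun)
    also have "\<dots> \<le> B0 * norm (u k - x)"
      using L_bound assms by (intro mult_right_mono) auto
    finally show ?thesis using \<eta> by (simp add: field_simps)
  qed
  moreover have "(\<lambda>k. B0 / (1 - \<eta>) * norm (u k - x)) \<longlonglongrightarrow> 0"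
    using assms(3) by (intro tendsto_mult_right_zero) (simp add: tendsto_norm_zero LIM_zero)
  ultimately have "(\<lambda>k. F i (u k) - F i x) \<longlonglongrightarrow> 0"
    by (rule Lim_null_comparison[OF always_eventually[OF allI]])
  then show "(\<lambda>k. F i (u k)) \<longlonglongrightarrow> F i x" by (rule LIM_zero_cancel)
qed

lemma \<tau>_pos: "0 < \<tau>" and margin_pos: "0 < (1 - \<eta>) - (1 + \<eta>) / \<tau>"
proof -
  have "0 < (1 + \<eta>) / (1 - \<eta>)" using \<eta> by simp
  then show *: "0 < \<tau>" using \<tau> by linarith
  show "0 < (1 - \<eta>) - (1 + \<eta>) / \<tau>" using \<tau> * \<eta> by (simp add: field_simps)
qed

lemma Sol_near: obtains xt where "xt \<in> Sol" "D \<xi>0 xt x0 \<le> \<sigma> * \<rho>\<^sup>2" "norm (xt - x0) \<le> \<rho>"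
proof -
  obtain xt where xt: "xt \<in> edom \<Theta>" "is_solution N domF F y xt" "bregman \<Theta> \<xi>0 xt x0 \<le> ereal (\<sigma> * \<rho>\<^sup>2)"
    using solvable by blast
  then have D: "D \<xi>0 xt x0 \<le> \<sigma> * \<rho>\<^sup>2"
    using bregman_real[OF xt(1) subdiff_imp_edom[OF init]] by simp
  have n: "norm (xt - x0) \<le> \<rho>"
  proof -
    have "\<sigma> * (norm (xt - x0))\<^sup>2 \<le> \<sigma> * \<rho>\<^sup>2" using D_ge[OF init xt(1)] D by linarith
    then have "(norm (xt - x0))\<^sup>2 \<le> \<rho>\<^sup>2" using \<sigma> by simp
    then show ?thesis using \<rho> by (rule power2_le_imp_le[OF _ less_imp_le])
  qed
  have "norm (x0 - xt) \<le> 2 * \<rho>" using n \<rho> by (simp add: norm_minus_commute)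
  then have "xt \<in> Sol"
    using xt by (simp add: Sol_def is_solution_def dist_norm)
  then show ?thesis using that D n by blast
qed

end

section \<open>One run of the method\<close>

lemma powr_split: "0 \<le> (a::real) \<Longrightarrow> a powr r = a powr (r - 1) * a"
  using powr_add[of a "r - 1" 1] by (cases "a = 0") auto

lemma (in heavy_ball) stop_index_eq:
  "stop_index = (if \<exists>n. active (state n) = {} then enat (LEAST n. active (state n) = {}) else \<infinity>)"
proof (cases "\<exists>n. active (state n) = {}")
  case True
  let ?k = "LEAST n. active (state n) = {}"
  have "active (state ?k) = {}" using True by (rule LeastI_ex)
  then have "stop_index = enat ?k"
    unfolding stop_index_def by (intro cInf_eq_minimum) (auto intro: Least_le)
  then show ?thesis using True by simp
next
  case False
  then show ?thesis by (simp add: stop_index_def Inf_enat_def)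
qed

context nonlinear_system
begin

text \<open>The discrepancy test turns \<open>\<Phi>\<close> into at least \<open>c0\<close> times \<open>\<Psi>\<close>; \<open>c1\<close> is the share of
\<open>t * \<Phi>\<close> that remains after the quadratic cost of the step, and \<open>c2\<close> is the constant in
\<open>t * \<Phi> \<ge> c2 * \<Psi> powr (2/r)\<close>.\<close>

definition c0 :: real where "c0 = (1 - \<eta>) - (1 + \<eta>) / \<tau>"
definition c1 :: real where "c1 = 1 - \<mu>0 / (4 * \<sigma>)"
definition c2 :: real where "c2 = c0 * min (\<mu>0 * c0 / (B0 * N)\<^sup>2) \<mu>1"

lemma c_pos: "0 < c0" "0 < c1" "0 < c2"
  using margin_pos \<mu>0 \<sigma> \<mu>1 B0 N_pos by (auto simp: c0_def c1_def c2_def)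

end

text \<open>A run for one fixed sequence of batches. Noise levels may vanish, so that the run with exact data
is an instance.\<close>

locale hb_run =
  nonlinear_system \<Theta> Y domF F L y N x0 \<xi>0 \<sigma> \<rho> B0 \<eta> r \<mu>0 \<mu>1 \<upsilon>0 \<upsilon>1 \<beta> \<tau> +
  heavy_ball \<Theta> Y F L N x0 \<xi>0 \<eta> \<sigma> r \<mu>0 \<mu>1 \<upsilon>0 \<upsilon>1 \<beta> \<tau> yd \<delta> I
  for \<Theta> :: "'x::{real_inner, banach} \<Rightarrow> ereal"
    and Y :: "nat \<Rightarrow> 'y::real_normed_vector set"
    and domF :: "nat \<Rightarrow> 'x set"
    and F :: "nat \<Rightarrow> 'x \<Rightarrow> 'y"
    and L :: "nat \<Rightarrow> 'x \<Rightarrow> ('x \<Rightarrow>\<^sub>L 'y)"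
    and y :: "nat \<Rightarrow> 'y"
    and N :: nat
    and x0 \<xi>0 :: 'x
    and \<sigma> \<rho> B0 \<eta> r \<mu>0 \<mu>1 \<upsilon>0 \<upsilon>1 \<beta> \<tau> :: real
    and yd :: "nat \<Rightarrow> 'y" and \<delta> :: "nat \<Rightarrow> real" and I :: "nat \<Rightarrow> nat set" +
  assumes yd_range: "\<And>i. i \<in> {1..N} \<Longrightarrow> yd i \<in> Y i"
    and noise: "\<And>i. i \<in> {1..N} \<Longrightarrow> norm (yd i - y i) \<le> \<delta> i"
    and I_sub: "\<And>n. I n \<subseteq> {1..N}"
begin

declare state.simps [simp del]

lemma \<delta>_nonneg: "i \<in> {1..N} \<Longrightarrow> 0 \<le> \<delta> i"
  using noise[of i] norm_ge_zero order_trans by blast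

lemma \<delta>min_nonneg: "0 \<le> \<delta>min"
  unfolding \<delta>min_def using \<delta>_nonneg N_pos by (subst Min_ge_iff) auto

lemma \<Gamma>_D: "i \<in> \<Gamma> n x \<Longrightarrow> i \<in> {1..N}" "i \<in> \<Gamma> n x \<Longrightarrow> \<tau> * \<delta> i < res x i" "i \<in> \<Gamma> n x \<Longrightarrow> 0 < res x i"
proof -
  assume i: "i \<in> \<Gamma> n x"
  show 1: "i \<in> {1..N}" "\<tau> * \<delta> i < res x i" using i I_sub unfolding \<Gamma>_def by blast+
  have "0 \<le> \<tau> * \<delta> i" using \<tau>_pos \<delta>_nonneg[OF 1(1)] by simp
  then show "0 < res x i" using 1(2) by linarith
qed

lemma finite_\<Gamma> [simp]: "finite (\<Gamma> n x)"
  by (rule finite_subset[of _ "{1..N}"]) (use \<Gamma>_D in auto)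

lemma card_\<Gamma>: "card (\<Gamma> n x) \<le> N"
  using card_mono[of "{1..N}" "\<Gamma> n x"] \<Gamma>_D(1) by (simp add: subset_eq)

lemma residual_in_Y: "i \<in> {1..N} \<Longrightarrow> x \<in> cball x0 (2 * \<rho>) \<Longrightarrow> F i x - yd i \<in> Y i"
  using F_in_Y yd_range Y_subspace subspace_diff by blast

lemma x_subdiff: "xi_it n \<in> subdiff \<Theta> (x_it n)"
  using init argmin_subdiff by (cases n) (auto simp: state_recursion)

lemma x_edom: "x_it n \<in> edom \<Theta>"
  using x_subdiff subdiff_imp_edom by blast

lemma Sol_D: "xh \<in> Sol \<Longrightarrow> xh \<in> cball x0 (2 * \<rho>)" "xh \<in> Sol \<Longrightarrow> xh \<in> edom \<Theta>"
  "xh \<in> Sol \<Longrightarrow> i \<in> {1..N} \<Longrightarrow> F i xh = y i"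
  by (auto simp: Sol_def)

abbreviation "J i x \<equiv> duality_map r (Y i) (F i x - yd i)"

lemma J_facts:
  assumes "i \<in> {1..N}" "x \<in> cball x0 (2 * \<rho>)"
  shows "J i x \<in> dual_space (Y i)" "J i x (F i x - yd i) = res x i powr r"
    "v \<in> Y i \<Longrightarrow> \<bar>J i x v\<bar> \<le> res x i powr (r - 1) * norm v"
    "dual_adjoint (L i x) (J i x) \<bullet> h = J i x (blinfun_apply (L i x) h)"
    "norm (dual_adjoint (L i x) (J i x)) \<le> res x i powr (r - 1) * B0"
proof -
  note p = duality_map_properties[OF Y_subspace[OF assms(1)] Y_smooth[OF assms(1)] r residual_in_Y[OF assms]]
  show 1: "J i x \<in> dual_space (Y i)" "J i x (F i x - yd i) = res x i powr r"
    "\<And>v. v \<in> Y i \<Longrightarrow> \<bar>J i x v\<bar> \<le> res x i powr (r - 1) * norm v"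
    using p by (auto simp: res_def)
  show "dual_adjoint (L i x) (J i x) \<bullet> h = J i x (blinfun_apply (L i x) h)"
    using 1(1) L_range[OF assms] by (intro dual_adjoint_inner)
  have "norm (dual_adjoint (L i x) (J i x)) \<le> res x i powr (r - 1) * norm (L i x)"
    using 1(1,3) L_range[OF assms] by (intro norm_dual_adjoint_le) auto
  also have "\<dots> \<le> res x i powr (r - 1) * B0"
    using L_bound[OF assms] by (intro mult_left_mono) auto
  finally show "norm (dual_adjoint (L i x) (J i x)) \<le> res x i powr (r - 1) * B0" .
qed

text \<open>Testing the duality functional with the residual itself gives the power of its norm; the
linearisation error is controlled by the cone condition and the noise.\<close>

lemma gradient_term_inner:
  assumes i: "i \<in> {1..N}" and x: "x \<in> cball x0 (2 * \<rho>)" and xh: "xh \<in> Sol"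
  shows "((1 - \<eta>) * res x i - (1 + \<eta>) * \<delta> i) * res x i powr (r - 1)
    \<le> dual_adjoint (L i x) (J i x) \<bullet> (x - xh)"
proof -
  let ?w = "F i x - yd i" and ?Lh = "blinfun_apply (L i x) (x - xh)"
  have Yi: "subspace (Y i)" "?w \<in> Y i" "?Lh \<in> Y i"
    using Y_subspace[OF i] residual_in_Y[OF i x] L_range[OF i x] by auto
  have "norm (?w - ?Lh) = norm ((F i x - F i xh - ?Lh) + (y i - yd i))"
    using Sol_D(3)[OF xh i] by (simp add: algebra_simps)
  also have "\<dots> \<le> norm (F i x - F i xh - ?Lh) + norm (y i - yd i)" by (rule norm_triangle_ineq)
  also have "\<dots> \<le> \<eta> * norm (F i x - F i xh) + \<delta> i"
    using tcc[OF i x Sol_D(1)[OF xh]] noise[OF i] by (simp add: norm_minus_commute)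
  also have "\<dots> \<le> \<eta> * (res x i + \<delta> i) + \<delta> i"
  proof -
    have "norm (F i x - F i xh) \<le> res x i + \<delta> i"
      using norm_triangle_ineq[of ?w "yd i - y i"] noise[OF i] Sol_D(3)[OF xh i] by (simp add: res_def)
    from mult_left_mono[OF this \<eta>(1)] show ?thesis by simp
  qed
  finally have n: "norm (?w - ?Lh) \<le> \<eta> * res x i + (1 + \<eta>) * \<delta> i"
    by (simp add: algebra_simps)
  have "res x i powr r - J i x ?Lh = J i x (?w - ?Lh)"
    using dual_space_diff[OF J_facts(1)[OF i x] Yi] J_facts(2)[OF i x] by simp
  also have "\<dots> \<le> res x i powr (r - 1) * norm (?w - ?Lh)"
    using J_facts(3)[OF i x subspace_diff[OF Yi]] by linarith
  also have "\<dots> \<le> res x i powr (r - 1) * (\<eta> * res x i + (1 + \<eta>) * \<delta> i)"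
    using n by (intro mult_left_mono) auto
  finally have "res x i powr r - res x i powr (r - 1) * (\<eta> * res x i + (1 + \<eta>) * \<delta> i) \<le> J i x ?Lh"
    by simp
  moreover have "res x i powr r = res x i powr (r - 1) * res x i"
    by (rule powr_split) (simp add: res_def)
  moreover define l where "l = J i x ?Lh"
  ultimately have "((1 - \<eta>) * res x i - (1 + \<eta>) * \<delta> i) * res x i powr (r - 1) \<le> l"
    by (simp add: algebra_simps)
  then show ?thesis by (simp add: J_facts(4)[OF i x] l_def)
qed

lemma \<Phi>_le_grad_inner:
  assumes x: "x \<in> cball x0 (2 * \<rho>)" and xh: "xh \<in> Sol"
  shows "\<Phi> n x \<le> grad n x \<bullet> (x - xh)"
  unfolding \<Phi>_def grad_def inner_sum_left
  by (rule sum_mono) (rule gradient_term_inner[OF \<Gamma>_D(1) x xh])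

lemma res_nonneg: "0 \<le> res x i" by (simp add: res_def)

lemma \<Psi>_nonneg: "0 \<le> \<Psi> n x"
  by (simp add: \<Psi>_def sum_nonneg)

lemma res_le_\<Psi>: "i \<in> \<Gamma> n x \<Longrightarrow> res x i \<le> \<Psi> n x powr (1 / r)"
proof -
  assume i: "i \<in> \<Gamma> n x"
  have "res x i powr r \<le> \<Psi> n x"
    unfolding \<Psi>_def using i by (intro member_le_sum) auto
  then have "(res x i powr r) powr (1 / r) \<le> \<Psi> n x powr (1 / r)"
    using r by (intro powr_mono2) auto
  then show ?thesis using r res_nonneg by (simp add: powr_powr)
qed

lemma \<Psi>_pos: "\<Gamma> n x \<noteq> {} \<Longrightarrow> 0 < \<Psi> n x"
proof -
  assume "\<Gamma> n x \<noteq> {}"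
  then obtain i where i: "i \<in> \<Gamma> n x" by blast
  have "\<Psi> n x \<noteq> 0" using res_le_\<Psi>[OF i] \<Gamma>_D(3)[OF i] by auto
  then show ?thesis using \<Psi>_nonneg[of n x] by simp
qed

lemma \<Phi>_bounds: "c0 * \<Psi> n x \<le> \<Phi> n x" "\<Phi> n x \<le> \<Psi> n x"
proof -
  have "c0 * res x i powr r \<le> ((1 - \<eta>) * res x i - (1 + \<eta>) * \<delta> i) * res x i powr (r - 1) \<and>
    ((1 - \<eta>) * res x i - (1 + \<eta>) * \<delta> i) * res x i powr (r - 1) \<le> res x i powr r"
    if i: "i \<in> \<Gamma> n x" for i
  proof -
    have s: "res x i powr r = res x i powr (r - 1) * res x i" by (rule powr_split) (rule res_nonneg)
    have "(1 + \<eta>) * \<delta> i \<le> (1 + \<eta>) * (res x i / \<tau>)"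
      using \<Gamma>_D(2)[OF i] \<tau>_pos \<eta> by (intro mult_left_mono) (auto simp: field_simps)
    then have "c0 * res x i \<le> (1 - \<eta>) * res x i - (1 + \<eta>) * \<delta> i"
      by (simp add: c0_def algebra_simps)
    moreover have "(1 - \<eta>) * res x i - (1 + \<eta>) * \<delta> i \<le> res x i"
    proof -
      have "0 \<le> \<eta> * res x i" "0 \<le> (1 + \<eta>) * \<delta> i"
        using \<eta> res_nonneg \<delta>_nonneg[OF \<Gamma>_D(1)[OF i]] by auto
      then show ?thesis by (simp add: algebra_simps)
    qed
    ultimately have "c0 * res x i * res x i powr (r - 1)
          \<le> ((1 - \<eta>) * res x i - (1 + \<eta>) * \<delta> i) * res x i powr (r - 1)"
      "((1 - \<eta>) * res x i - (1 + \<eta>) * \<delta> i) * res x i powr (r - 1) \<le> res x i * res x i powr (r - 1)"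
      by (auto intro!: mult_right_mono)
    then show ?thesis unfolding s by (simp add: mult_ac)
  qed
  then show "c0 * \<Psi> n x \<le> \<Phi> n x" "\<Phi> n x \<le> \<Psi> n x"
    unfolding \<Psi>_def \<Phi>_def sum_distrib_left by (auto intro!: sum_mono)
qed

lemma \<Phi>_nonneg: "0 \<le> \<Phi> n x"
  using \<Phi>_bounds(1)[of n x] mult_nonneg_nonneg[OF less_imp_le[OF c_pos(1)] \<Psi>_nonneg[of n x]] by linarith

lemma norm_grad_le:
  assumes x: "x \<in> cball x0 (2 * \<rho>)"
  shows "norm (grad n x) \<le> B0 * N * \<Psi> n x powr ((r - 1) / r)"
proof -
  have "norm (grad n x) \<le> (\<Sum>i\<in>\<Gamma> n x. \<Psi> n x powr ((r - 1) / r) * B0)"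
    unfolding grad_def
  proof (rule sum_norm_le)
    fix i assume i: "i \<in> \<Gamma> n x"
    have "res x i powr (r - 1) \<le> (\<Psi> n x powr (1 / r)) powr (r - 1)"
      using res_le_\<Psi>[OF i] r res_nonneg by (intro powr_mono2) auto
    also have "\<dots> = \<Psi> n x powr ((r - 1) / r)" by (simp add: powr_powr)
    finally show "norm (dual_adjoint (L i x) (J i x)) \<le> \<Psi> n x powr ((r - 1) / r) * B0"
      using J_facts(5)[OF \<Gamma>_D(1)[OF i] x] B0 by (meson less_imp_le mult_right_mono order_trans)
  qed
  also have "\<dots> = real (card (\<Gamma> n x)) * (\<Psi> n x powr ((r - 1) / r) * B0)" by simp
  also have "\<dots> \<le> real N * (\<Psi> n x powr ((r - 1) / r) * B0)"
    using card_\<Gamma> B0 by (intro mult_right_mono) auto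
  finally show ?thesis by (simp add: mult_ac)
qed

lemma grad_nonzero:
  assumes x: "x \<in> cball x0 (2 * \<rho>)" and "\<Gamma> n x \<noteq> {}"
  shows "grad n x \<noteq> 0"
proof
  assume "grad n x = 0"
  obtain xh where "xh \<in> Sol" using Sol_near by blast
  then have "\<Phi> n x \<le> 0" using \<Phi>_le_grad_inner[OF x, of xh n] \<open>grad n x = 0\<close> by simp
  moreover have "0 < c0 * \<Psi> n x" using c_pos \<Psi>_pos assms by simp
  ultimately show False using \<Phi>_bounds(1)[of n x] by linarith
qed

lemma stepsize_empty: "\<Gamma> n x = {} \<Longrightarrow> stepsize n x = 0" "\<Gamma> n x = {} \<Longrightarrow> grad n x = 0"
  "\<Gamma> n x = {} \<Longrightarrow> \<Psi> n x = 0" "\<Gamma> n x = {} \<Longrightarrow> \<Phi> n x = 0"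
  by (auto simp: stepsize_def grad_def \<Psi>_def \<Phi>_def)

lemma stepsize_nonneg: "0 \<le> stepsize n x"
  using \<mu>0 \<mu>1 \<Phi>_nonneg by (auto simp: stepsize_def)

lemma stepsize_le: "stepsize n x \<le> \<mu>1 * \<Psi> n x powr (2 / r - 1)"
  using \<mu>1 by (auto simp: stepsize_def)

lemma stepsize_grad: "stepsize n x * (norm (grad n x))\<^sup>2 \<le> \<mu>0 * \<Phi> n x"
proof (cases "grad n x = 0")
  case True
  then show ?thesis using \<mu>0 \<Phi>_nonneg by simp
next
  case False
  have "stepsize n x \<le> \<mu>0 * \<Phi> n x / (norm (grad n x))\<^sup>2"
    using \<mu>0 \<Phi>_nonneg by (auto simp: stepsize_def)
  then show ?thesis using False by (simp add: field_simps)
qed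

text \<open>Both terms of the minimum that defines the step size are at least a multiple of
\<open>\<Psi> powr (2/r - 1)\<close>: this is by definition true of the second, and for the first it follows from
\<open>norm_grad_le\<close>. A vanishing gradient, for which the quotient would be \<open>0\<close>, is possible only if
\<open>\<Gamma> = {}\<close>.\<close>

lemma stepsize_\<Phi>_ge:
  assumes x: "x \<in> cball x0 (2 * \<rho>)"
  shows "c2 * \<Psi> n x powr (2 / r) \<le> stepsize n x * \<Phi> n x"
proof (cases "\<Gamma> n x = {}")
  case True
  then show ?thesis by (simp add: stepsize_empty)
next
  case False
  let ?P = "\<Psi> n x" and ?g = "norm (grad n x)"
  have P: "0 < ?P" using \<Psi>_pos[OF False] .
  have g: "0 < ?g" using grad_nonzero[OF x False] by simp
  have BN: "0 < B0 * N" using B0 N_pos by simp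
  have g2: "?g\<^sup>2 \<le> (B0 * N)\<^sup>2 * ?P powr (2 - 2 / r)"
  proof -
    have "?g\<^sup>2 \<le> (B0 * N * ?P powr ((r - 1) / r))\<^sup>2"
      using norm_grad_le[OF x] by (intro power_mono) auto
    also have "\<dots> = (B0 * N)\<^sup>2 * (?P powr ((r - 1) / r))\<^sup>2" by (rule power_mult_distrib)
    also have "(?P powr ((r - 1) / r))\<^sup>2 = ?P powr (2 - 2 / r)"
      using P r by (simp add: power2_eq_square powr_add[symmetric] diff_divide_distrib)
    finally show ?thesis .
  qed
  have 1: "\<mu>0 * c0 / (B0 * N)\<^sup>2 * ?P powr (2 / r - 1) \<le> \<mu>0 * \<Phi> n x / ?g\<^sup>2"
  proof -
    have "?P powr (2 / r - 1) * ?P powr (2 - 2 / r) = ?P"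
      using P by (simp add: powr_add[symmetric])
    then have "\<mu>0 * c0 / (B0 * N)\<^sup>2 * ?P powr (2 / r - 1) * ((B0 * N)\<^sup>2 * ?P powr (2 - 2 / r))
        = \<mu>0 * (c0 * ?P)"
      using less_imp_neq[OF BN] by (simp add: field_simps)
    also have "\<dots> \<le> \<mu>0 * \<Phi> n x"
      using \<Phi>_bounds(1) \<mu>0 by (intro mult_left_mono) auto
    finally have "\<mu>0 * c0 / (B0 * N)\<^sup>2 * ?P powr (2 / r - 1) * ?g\<^sup>2 \<le> \<mu>0 * \<Phi> n x"
      using g2 \<mu>0 c_pos(1)
      by (meson divide_nonneg_nonneg less_imp_le mult_left_mono mult_nonneg_nonneg order_trans
          powr_ge_zero zero_le_power2)
    then show ?thesis using g by (simp add: pos_le_divide_eq)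
  qed
  have 2: "min (\<mu>0 * c0 / (B0 * N)\<^sup>2) \<mu>1 * ?P powr (2 / r - 1) \<le> stepsize n x"
  proof -
    have "min (\<mu>0 * c0 / (B0 * N)\<^sup>2) \<mu>1 * ?P powr (2 / r - 1)
        = min (\<mu>0 * c0 / (B0 * N)\<^sup>2 * ?P powr (2 / r - 1)) (\<mu>1 * ?P powr (2 / r - 1))"
      using P by (simp add: min_mult_distrib_right)
    also have "\<dots> \<le> stepsize n x"
      using 1 False by (auto simp: stepsize_def intro: min.mono)
    finally show ?thesis .
  qed
  have "c2 * ?P powr (2 / r) = (min (\<mu>0 * c0 / (B0 * N)\<^sup>2) \<mu>1 * ?P powr (2 / r - 1)) * (c0 * ?P)"
    using powr_split[of ?P "2 / r"] P by (simp add: c2_def)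
  also have "\<dots> \<le> stepsize n x * \<Phi> n x"
    using 2 \<Phi>_bounds(1) c_pos(1) P stepsize_nonneg by (intro mult_mono) auto
  finally show ?thesis .
qed

lemma stepsize_grad_le:
  assumes x: "x \<in> cball x0 (2 * \<rho>)"
  shows "norm (stepsize n x *\<^sub>R grad n x) \<le> \<mu>1 * B0 * N * \<Psi> n x powr (1 / r)"
proof -
  have "norm (stepsize n x *\<^sub>R grad n x)
      \<le> (\<mu>1 * \<Psi> n x powr (2 / r - 1)) * (B0 * N * \<Psi> n x powr ((r - 1) / r))"
    using stepsize_le norm_grad_le[OF x] stepsize_nonneg \<mu>1 by (auto intro!: mult_mono)
  also have "\<dots> = \<mu>1 * B0 * N * (\<Psi> n x powr (2 / r - 1) * \<Psi> n x powr ((r - 1) / r))" by simp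
  also have "\<Psi> n x powr (2 / r - 1) * \<Psi> n x powr ((r - 1) / r) = \<Psi> n x powr (1 / r)"
  proof -
    have "2 / r - 1 + (r - 1) / r = 1 / r" using r by (simp add: field_simps)
    then show ?thesis by (simp add: powr_add[symmetric])
  qed
  finally show ?thesis .
qed

lemma stepsize_\<Phi>_le: "stepsize n x * \<Phi> n x \<le> \<mu>1 * \<Psi> n x powr (2 / r)"
proof -
  have "stepsize n x * \<Phi> n x \<le> (\<mu>1 * \<Psi> n x powr (2 / r - 1)) * \<Psi> n x"
    using stepsize_le \<Phi>_bounds(2) \<mu>1 \<Phi>_nonneg by (intro mult_mono) auto
  also have "\<dots> = \<mu>1 * \<Psi> n x powr (2 / r)"
    using powr_split[OF \<Psi>_nonneg, of n x "2 / r"] by simp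
  finally show ?thesis .
qed

abbreviation "t n \<equiv> stepsize n (x_it n)"
abbreviation "g n \<equiv> grad n (x_it n)"
abbreviation "m n \<equiv> mom (state n)"
abbreviation "bt n \<equiv> bet n (state n)"
abbreviation "gm n \<equiv> gam (state n)"

text \<open>The slope at \<open>0\<close> of the quadratic in the momentum parameter that bounds the next Bregman distance.\<close>

definition q :: "nat \<Rightarrow> real" where
  "q n = gm n - t n / (2 * \<sigma>) * (g n \<bullet> m n)"

text \<open>Unless a safeguard sets it to \<open>0\<close>, the momentum parameter is the minimiser of the quadratic bound, cut
off at \<open>\<beta>\<close>.\<close>

lemma bet_alt: "bt n = (if norm (m n) \<ge> \<upsilon>0 * \<delta>min \<and> q n \<le> - \<upsilon>1 * \<delta>min * (norm (m n))\<^sup>2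
    then min (- 2 * \<sigma> * q n / (norm (m n))\<^sup>2) \<beta> else 0)"
proof -
  have "t n * (g n \<bullet> m n) - 2 * \<sigma> * gm n = - 2 * \<sigma> * q n"
    using \<sigma> by (simp add: q_def algebra_simps)
  then show ?thesis
    by (simp add: bet_def Let_def q_def x_it_def[symmetric])
qed

lemma bet_facts: "0 \<le> bt n" "bt n \<le> \<beta>" "bt n \<noteq> 0 \<Longrightarrow> q n \<le> 0"
  "bt n * (bt n * (norm (m n))\<^sup>2 + 2 * \<sigma> * q n) \<le> 0"
proof -
  have q: "q n \<le> 0" if "q n \<le> - \<upsilon>1 * \<delta>min * (norm (m n))\<^sup>2"
  proof -
    have "0 \<le> \<upsilon>1 * \<delta>min * (norm (m n))\<^sup>2" using \<upsilon> \<delta>min_nonneg by simp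
    then show ?thesis using that by simp
  qed
  show 1: "bt n \<noteq> 0 \<Longrightarrow> q n \<le> 0" using q by (auto simp: bet_alt split: if_splits)
  show 2: "0 \<le> bt n"
    using q \<beta> \<sigma> by (auto simp: bet_alt mult_nonneg_nonpos divide_nonpos_nonneg)
  show "bt n \<le> \<beta>" using \<beta> by (auto simp: bet_alt)
  have "bt n * (norm (m n))\<^sup>2 \<le> - 2 * \<sigma> * q n" if "bt n \<noteq> 0"
  proof (cases "m n = 0")
    case True
    then show ?thesis using 1[OF that] \<sigma> by (simp add: mult_nonneg_nonpos)
  next
    case False
    have "bt n \<le> - 2 * \<sigma> * q n / (norm (m n))\<^sup>2"
      using that by (auto simp: bet_alt split: if_splits)
    then show ?thesis using False by (simp add: field_simps)
  qed
  then show "bt n * (bt n * (norm (m n))\<^sup>2 + 2 * \<sigma> * q n) \<le> 0"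
    using 2 by (cases "bt n = 0") (auto intro!: mult_nonneg_nonpos)
qed

lemma mom_Suc: "m (Suc n) = bt n *\<^sub>R m n - t n *\<^sub>R g n"
  by (simp add: state_recursion)

lemma mom_0: "m 0 = 0" by (simp add: mom_def state.simps)

text \<open>Strong convexity gives
\<open>D(n+1) - D(n) \<le> d \<bullet> (x(n) - xh) + (norm d)\<^sup>2 / (4 * \<sigma>)\<close> with \<open>d = \<xi>(n+1) - \<xi>(n)\<close>. The gradient part of
\<open>d\<close> contributes at most \<open>- c1 * t * \<Phi>\<close>, and the choice of the momentum parameter makes the rest at
most \<open>- (bt * norm m)\<^sup>2 / (4 * \<sigma>)\<close>. The second claim propagates the majorant \<open>\<gamma>\<close> of the unknown inner
product, on which the first claim depends.\<close>

lemma descent_step: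
  assumes x: "x_it n \<in> cball x0 (2 * \<rho>)" and xh: "xh \<in> Sol" and gm: "m n \<bullet> (x_it n - xh) \<le> gm n"
  shows "D (xi_it (Suc n)) xh (x_it (Suc n)) + c1 * (t n * \<Phi> n (x_it n)) + (bt n * norm (m n))\<^sup>2 / (4 * \<sigma>)
      \<le> D (xi_it n) xh (x_it n)"
    and "m (Suc n) \<bullet> (x_it (Suc n) - xh) \<le> gm (Suc n)"
proof -
  define d where "d = m (Suc n)"
  have d: "d = xi_it (Suc n) - xi_it n" by (simp add: d_def state_recursion(5))
  have tP: "t n * \<Phi> n (x_it n) \<le> t n * (g n \<bullet> (x_it n - xh))"
    using \<Phi>_le_grad_inner[OF x xh] stepsize_nonneg by (intro mult_left_mono) auto
  have bm: "bt n * (m n \<bullet> (x_it n - xh)) \<le> bt n * gm n"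
    using gm bet_facts(1) by (intro mult_left_mono) auto
  have dx: "d \<bullet> (x_it n - xh) \<le> bt n * gm n - t n * \<Phi> n (x_it n)"
    using tP bm unfolding d_def mom_Suc inner_diff_left inner_scaleR_left by linarith
  have "m (Suc n) \<bullet> (x_it (Suc n) - xh) = d \<bullet> (x_it (Suc n) - x_it n) + d \<bullet> (x_it n - xh)"
    by (simp add: d_def inner_simps)
  then show "m (Suc n) \<bullet> (x_it (Suc n) - xh) \<le> gm (Suc n)"
    using dx by (simp add: state_recursion(6) d_def)
  let ?s = "x_it (Suc n) - x_it n"
  have "D (xi_it (Suc n)) xh (x_it (Suc n)) - D (xi_it n) xh (x_it n)
      = d \<bullet> (x_it n - xh) + d \<bullet> ?s - D (xi_it n) (x_it (Suc n)) (x_it n)"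
    by (simp add: D_def d inner_simps)
  also have "\<dots> \<le> d \<bullet> (x_it n - xh) + d \<bullet> ?s - \<sigma> * (norm ?s)\<^sup>2"
    using D_ge[OF x_subdiff x_edom] by simp
  also have "\<dots> \<le> d \<bullet> (x_it n - xh) + (norm d)\<^sup>2 / (4 * \<sigma>)"
  proof -
    have "0 \<le> (norm (d - (2 * \<sigma>) *\<^sub>R ?s))\<^sup>2 / (4 * \<sigma>)" using \<sigma> by simp
    also have "(norm (d - (2 * \<sigma>) *\<^sub>R ?s))\<^sup>2 = (norm d)\<^sup>2 - 4 * \<sigma> * (d \<bullet> ?s) + 4 * \<sigma> * (\<sigma> * (norm ?s)\<^sup>2)"
    proof -
      have "(norm (d - c *\<^sub>R s))\<^sup>2 = (norm d)\<^sup>2 - 2 * c * (d \<bullet> s) + c * (c * (norm s)\<^sup>2)" for c and s :: 'x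
        unfolding power2_norm_eq_inner
        by (simp add: inner_diff_left inner_diff_right inner_commute[of s d] algebra_simps)
      from this[of "2 * \<sigma>" ?s] show ?thesis by simp
    qed
    also have "\<dots> / (4 * \<sigma>) = (norm d)\<^sup>2 / (4 * \<sigma>) - d \<bullet> ?s + \<sigma> * (norm ?s)\<^sup>2"
      using \<sigma> by (simp add: add_divide_distrib diff_divide_distrib)
    finally show ?thesis by simp
  qed
  finally have 1: "D (xi_it (Suc n)) xh (x_it (Suc n)) - D (xi_it n) xh (x_it n)
      \<le> bt n * gm n - t n * \<Phi> n (x_it n) + (norm d)\<^sup>2 / (4 * \<sigma>)"
    using dx by linarith
  have nd: "(norm d)\<^sup>2 = t n * (t n * (norm (g n))\<^sup>2) - 2 * bt n * (t n * (g n \<bullet> m n)) + (bt n * norm (m n))\<^sup>2"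
    unfolding d_def mom_Suc power_mult_distrib power2_norm_eq_inner
      inner_diff_left inner_diff_right inner_scaleR_left inner_scaleR_right inner_commute[of "m n" "g n"]
    by (simp add: power2_eq_square algebra_simps)
  have "t n * (t n * (norm (g n))\<^sup>2) \<le> t n * (\<mu>0 * \<Phi> n (x_it n))"
    by (rule mult_left_mono[OF stepsize_grad stepsize_nonneg])
  then have "(norm d)\<^sup>2 / (4 * \<sigma>) \<le> (\<mu>0 * (t n * \<Phi> n (x_it n))
      - 2 * (bt n * (t n * (g n \<bullet> m n))) + (bt n * norm (m n))\<^sup>2) / (4 * \<sigma>)"
    unfolding nd using \<sigma> by (intro divide_right_mono) (auto simp: mult_ac)
  also have "\<dots> = (1 - c1) * (t n * \<Phi> n (x_it n)) - bt n * (t n / (2 * \<sigma>) * (g n \<bullet> m n))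
      + (bt n * norm (m n))\<^sup>2 / (4 * \<sigma>)"
    using \<sigma> by (simp add: c1_def add_divide_distrib diff_divide_distrib)
  finally have "bt n * gm n - t n * \<Phi> n (x_it n) + (norm d)\<^sup>2 / (4 * \<sigma>)
      \<le> - (c1 * (t n * \<Phi> n (x_it n))) + bt n * q n + (bt n * norm (m n))\<^sup>2 / (4 * \<sigma>)"
    by (simp add: q_def algebra_simps)
  moreover have "bt n * q n \<le> - 2 * ((bt n * norm (m n))\<^sup>2 / (4 * \<sigma>))"
    using bet_facts(4)[of n] \<sigma> by (simp add: field_simps power2_eq_square)
  ultimately show "D (xi_it (Suc n)) xh (x_it (Suc n)) + c1 * (t n * \<Phi> n (x_it n)) + (bt n * norm (m n))\<^sup>2 / (4 * \<sigma>)
      \<le> D (xi_it n) xh (x_it n)"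
    using 1 by linarith
qed

lemma decrease_nonneg: "0 \<le> c1 * (t n * \<Phi> n (x_it n)) + (bt n * norm (m n))\<^sup>2 / (4 * \<sigma>)"
  using c_pos(2) stepsize_nonneg \<Phi>_nonneg \<sigma> by simp

text \<open>The Bregman distance to a solution within \<open>\<rho>\<close> of \<open>x0\<close> never exceeds its initial value. The induction must
carry the majorant \<open>\<gamma>\<close> along, since \<open>descent_step\<close> needs it and membership in the ball.\<close>

lemma x_in_ball: "x_it n \<in> cball x0 (2 * \<rho>)"
proof -
  obtain xt where xt: "xt \<in> Sol" "D \<xi>0 xt x0 \<le> \<sigma> * \<rho>\<^sup>2" "norm (xt - x0) \<le> \<rho>"
    using Sol_near by blast
  have ball: "x_it n \<in> cball x0 (2 * \<rho>)" if "D (xi_it n) xt (x_it n) \<le> \<sigma> * \<rho>\<^sup>2" for n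
  proof -
    have "\<sigma> * (norm (xt - x_it n))\<^sup>2 \<le> \<sigma> * \<rho>\<^sup>2"
      using D_ge[OF x_subdiff Sol_D(2)[OF xt(1)], of n] that by linarith
    then have "(norm (xt - x_it n))\<^sup>2 \<le> \<rho>\<^sup>2" using \<sigma> by simp
    then have "norm (xt - x_it n) \<le> \<rho>" using \<rho> by (rule power2_le_imp_le[OF _ less_imp_le])
    then have "dist x0 (x_it n) \<le> 2 * \<rho>"
      using dist_triangle[of x0 "x_it n" xt] xt(3) by (simp add: dist_norm norm_minus_commute)
    then show ?thesis by simp
  qed
  have "D (xi_it n) xt (x_it n) \<le> \<sigma> * \<rho>\<^sup>2 \<and> m n \<bullet> (x_it n - xt) \<le> gm n"
  proof (induction n)
    case 0
    then show ?case using xt(2) by (simp add: state_recursion mom_0)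
  next
    case (Suc n)
    then show ?case
      using descent_step[OF ball xt(1), of n] decrease_nonneg[of n] by auto
  qed
  then show ?thesis using ball by blast
qed

lemma momentum_bound: "xh \<in> Sol \<Longrightarrow> m n \<bullet> (x_it n - xh) \<le> gm n"
proof (induction n)
  case 0
  then show ?case by (simp add: state_recursion mom_0)
next
  case (Suc n)
  then show ?case using descent_step(2)[OF x_in_ball] by blast
qed

lemmas descent = descent_step(1)[OF x_in_ball _ momentum_bound]

lemma D_antimono: "n \<le> k \<Longrightarrow> xh \<in> Sol \<Longrightarrow> D (xi_it k) xh (x_it k) \<le> D (xi_it n) xh (x_it n)"
proof (induction k rule: dec_induct)
  case (step k)
  then show ?case using descent[of xh k] decrease_nonneg[of k] by linarith
qed simp

lemma decrease_sum:
  assumes xh: "xh \<in> Sol"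
  shows "(\<Sum>k<n. c1 * (t k * \<Phi> k (x_it k)) + (bt k * norm (m k))\<^sup>2 / (4 * \<sigma>)) \<le> D \<xi>0 xh x0"
proof -
  have "D (xi_it n) xh (x_it n) +
      (\<Sum>k<n. c1 * (t k * \<Phi> k (x_it k)) + (bt k * norm (m k))\<^sup>2 / (4 * \<sigma>)) \<le> D \<xi>0 xh x0"
  proof (induction n)
    case 0
    then show ?case by (simp add: state_recursion)
  next
    case (Suc n)
    then show ?case using descent[OF xh xh, of n] by simp
  qed
  then show ?thesis using D_nonneg[OF x_subdiff Sol_D(2)[OF xh], of n] by linarith
qed

lemma \<Psi>_sum: "(\<Sum>k<n. \<Psi> k (x_it k) powr (2 / r)) \<le> \<sigma> * \<rho>\<^sup>2 / (c1 * c2)"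
proof -
  obtain xt where xt: "xt \<in> Sol" "D \<xi>0 xt x0 \<le> \<sigma> * \<rho>\<^sup>2" using Sol_near by blast
  have "c1 * c2 * (\<Sum>k<n. \<Psi> k (x_it k) powr (2 / r))
      \<le> (\<Sum>k<n. c1 * (t k * \<Phi> k (x_it k)) + (bt k * norm (m k))\<^sup>2 / (4 * \<sigma>))"
    unfolding sum_distrib_left
  proof (rule sum_mono)
    fix k
    have "c1 * (c2 * \<Psi> k (x_it k) powr (2 / r)) \<le> c1 * (t k * \<Phi> k (x_it k))"
      using stepsize_\<Phi>_ge[OF x_in_ball] c_pos(2) by (intro mult_left_mono) auto
    moreover have "0 \<le> (bt k * norm (m k))\<^sup>2 / (4 * \<sigma>)" using \<sigma> by simp
    ultimately show "c1 * c2 * \<Psi> k (x_it k) powr (2 / r)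
      \<le> c1 * (t k * \<Phi> k (x_it k)) + (bt k * norm (m k))\<^sup>2 / (4 * \<sigma>)" by (simp add: mult.assoc)
  qed
  also have "\<dots> \<le> \<sigma> * \<rho>\<^sup>2" using decrease_sum[OF xt(1), of n] xt(2) by linarith
  finally show ?thesis using c_pos by (simp add: field_simps)
qed

subsection \<open>Termination and the stopping index\<close>

lemma x_stationary:
  assumes "\<Gamma> n (x_it n) = {}" "bt n = 0"
  shows "x_it (Suc n) = x_it n"
proof -
  have "xi_it (Suc n) = xi_it n"
    using assms by (simp add: state_recursion(7) stepsize_empty)
  then have "2 * \<sigma> * norm (x_it (Suc n) - x_it n) \<le> 0"
    using subgradient_monotone[OF x_subdiff[of "Suc n"] x_subdiff[of n]] by simp
  then show ?thesis using \<sigma> by (simp add: mult_le_0_iff)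
qed

text \<open>The set of remaining indices is reset whenever the iterate may move, so the test passed by a removed index
still refers to the current iterate.\<close>

lemma inactive_residual:
  "i \<in> {1..N} \<Longrightarrow> i \<notin> active (state n) \<Longrightarrow> res (x_it n) i \<le> \<tau> * \<delta> i"
proof (induction n)
  case (Suc n)
  show ?case
  proof (cases "\<Gamma> n (x_it n) = {} \<and> bt n = 0")
    case True
    then have "i \<notin> active (state n) \<or> i \<in> I n"
      using Suc.prems by (simp add: state_recursion(9))
    then have "res (x_it n) i \<le> \<tau> * \<delta> i"
      using Suc True by (auto simp: \<Gamma>_def)
    then show ?thesis using x_stationary True by simp
  next
    case False
    then have "active (state (Suc n)) = {1..N}" by (simp only: state_recursion(9) if_False)
    then show ?thesis using Suc.prems by simp
  qed
qed (simp add: state_recursion)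

lemma stop_index_finite:
  "stop_index < \<infinity> \<longleftrightarrow> (\<exists>n. active (state n) = {})"
  "stop_index < \<infinity> \<Longrightarrow> active (state (the_enat stop_index)) = {}"
proof -
  show iff: "stop_index < \<infinity> \<longleftrightarrow> (\<exists>n. active (state n) = {})" unfolding stop_index_eq by simp
  assume "stop_index < \<infinity>"
  then have ex: "\<exists>n. active (state n) = {}" using iff by blast
  then have "the_enat stop_index = (LEAST n. active (state n) = {})" unfolding stop_index_eq by simp
  then show "active (state (the_enat stop_index)) = {}" using LeastI_ex[OF ex] by simp
qed

lemma active_sub: "active (state n) \<subseteq> {1..N}"
  by (induction n) (auto simp: state_recursion)

text \<open>With positive noise levels each nontrivial step decreases the Bregman distance by at least a fixed
amount: a sampled index that fails the discrepancy test makes \<open>\<Psi>\<close> large, and the safeguards on the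
momentum parameter keep the norm of a nonzero added momentum away from \<open>0\<close>.\<close>

lemma eventually_inactive:
  assumes \<delta>: "\<And>i. i \<in> {1..N} \<Longrightarrow> 0 < \<delta> i"
  shows "\<forall>\<^sub>F n in sequentially. \<Gamma> n (x_it n) = {} \<and> bt n = 0"
proof -
  obtain xt where xt: "xt \<in> Sol" using Sol_near by blast
  have dm: "0 < \<delta>min" unfolding \<delta>min_def using \<delta> N_pos by (subst Min_gr_iff) auto
  have le: "\<delta>min \<le> \<delta> i" if "i \<in> {1..N}" for i
    unfolding \<delta>min_def using that by (intro Min_le) auto
  have "summable (\<lambda>k. c1 * (t k * \<Phi> k (x_it k)) + (bt k * norm (m k))\<^sup>2 / (4 * \<sigma>))"
  proof (rule bounded_imp_summable[OF decrease_nonneg])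
    show "(\<Sum>k\<le>n. c1 * (t k * \<Phi> k (x_it k)) + (bt k * norm (m k))\<^sup>2 / (4 * \<sigma>)) \<le> D \<xi>0 xt x0" for n
      using decrease_sum[OF xt, of "Suc n"] by (simp only: lessThan_Suc_atMost)
  qed
  then have lim: "(\<lambda>k. c1 * (t k * \<Phi> k (x_it k)) + (bt k * norm (m k))\<^sup>2 / (4 * \<sigma>)) \<longlonglongrightarrow> 0"
    by (rule summable_LIMSEQ_zero)
  define K1 where "K1 = c1 * (c2 * (\<tau> * \<delta>min)\<^sup>2)"
  have K1: "0 < K1" using c_pos \<tau>_pos dm by (simp add: K1_def)
  define K2 where "K2 = min (2 * \<sigma> * \<upsilon>1 * \<delta>min) \<beta> * (\<upsilon>0 * \<delta>min)"
  \<comment> \<open>\<open>K\<close> bounds the drop of any nontrivial step from below; for \<open>\<beta> = 0\<close> there is no momentum to count\<close>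
  define K where "K = (if \<beta> = 0 then K1 else min K1 (K2\<^sup>2 / (4 * \<sigma>)))"
  have K2: "0 < K2" if "\<beta> \<noteq> 0" using that \<beta> \<sigma> \<upsilon> dm by (simp add: K2_def)
  have K: "0 < K" using K1 K2 \<sigma> by (auto simp: K_def)
  have "\<forall>\<^sub>F k in sequentially. c1 * (t k * \<Phi> k (x_it k)) + (bt k * norm (m k))\<^sup>2 / (4 * \<sigma>) < K"
    using lim K by (rule order_tendstoD(2))
  then show ?thesis
  proof eventually_elim
    case (elim k)
    have n1: "0 \<le> c1 * (t k * \<Phi> k (x_it k))" "0 \<le> (bt k * norm (m k))\<^sup>2 / (4 * \<sigma>)"
      using c_pos(2) stepsize_nonneg \<Phi>_nonneg \<sigma> by auto
    have "\<Gamma> k (x_it k) = {}"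
    proof (rule ccontr)
      assume "\<Gamma> k (x_it k) \<noteq> {}"
      then obtain i where i: "i \<in> \<Gamma> k (x_it k)" by blast
      have "\<tau> * \<delta>min \<le> \<tau> * \<delta> i" using le[OF \<Gamma>_D(1)[OF i]] \<tau>_pos by simp
      also have "\<dots> \<le> \<Psi> k (x_it k) powr (1 / r)"
        using \<Gamma>_D(2)[OF i] res_le_\<Psi>[OF i] by linarith
      finally have "(\<tau> * \<delta>min)\<^sup>2 \<le> (\<Psi> k (x_it k) powr (1 / r))\<^sup>2"
        using \<tau>_pos dm by (intro power_mono) auto
      also have "\<dots> = \<Psi> k (x_it k) powr (2 / r)"
        by (simp add: power2_eq_square powr_add[symmetric])
      finally have "K1 \<le> c1 * (c2 * \<Psi> k (x_it k) powr (2 / r))"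
        unfolding K1_def using c_pos by simp
      also have "\<dots> \<le> c1 * (t k * \<Phi> k (x_it k))"
        using stepsize_\<Phi>_ge[OF x_in_ball] c_pos by simp
      finally show False using elim n1 K1 by (auto simp: K_def split: if_splits)
    qed
    moreover have "bt k = 0"
    proof (rule ccontr)
      assume b: "bt k \<noteq> 0"
      then have \<beta>0: "\<beta> \<noteq> 0" using bet_facts(1,2)[of k] by auto
      have c: "\<upsilon>0 * \<delta>min \<le> norm (m k)" "q k \<le> - \<upsilon>1 * \<delta>min * (norm (m k))\<^sup>2"
        "bt k = min (- 2 * \<sigma> * q k / (norm (m k))\<^sup>2) \<beta>"
        using b by (auto simp: bet_alt split: if_splits)
      have mk: "0 < norm (m k)" using c(1) \<upsilon> dm by (smt (verit) mult_pos_pos)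
      have "2 * \<sigma> * (\<upsilon>1 * \<delta>min * (norm (m k))\<^sup>2) \<le> 2 * \<sigma> * (- q k)"
        using c(2) \<sigma> by (intro mult_left_mono) auto
      then have "(2 * \<sigma> * \<upsilon>1 * \<delta>min) * (norm (m k))\<^sup>2 \<le> - 2 * \<sigma> * q k"
        by (simp add: mult.assoc)
      then have "2 * \<sigma> * \<upsilon>1 * \<delta>min \<le> - 2 * \<sigma> * q k / (norm (m k))\<^sup>2"
        using mk by (intro pos_le_divide_eq[THEN iffD2]) auto
      then have "min (2 * \<sigma> * \<upsilon>1 * \<delta>min) \<beta> \<le> bt k" unfolding c(3) by (intro min.mono) auto
      then have "K2 \<le> bt k * norm (m k)"
        unfolding K2_def using c(1) \<beta> \<upsilon> dm bet_facts(1) by (intro mult_mono) auto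
      then have "K2\<^sup>2 \<le> (bt k * norm (m k))\<^sup>2" using K2[OF \<beta>0] by (intro power_mono) auto
      then have "K2\<^sup>2 / (4 * \<sigma>) \<le> (bt k * norm (m k))\<^sup>2 / (4 * \<sigma>)"
        using \<sigma> by (intro divide_right_mono) auto
      then show False using elim n1 \<beta>0 by (auto simp: K_def)
    qed
    ultimately show ?case by blast
  qed
qed

lemma stops:
  assumes \<delta>: "\<And>i. i \<in> {1..N} \<Longrightarrow> 0 < \<delta> i"
    and io: "\<And>i n. i \<in> {1..N} \<Longrightarrow> \<exists>k\<ge>n. i \<in> I k"
  shows "stop_index < \<infinity>"
proof -
  obtain n0 where n0: "\<And>n. n \<ge> n0 \<Longrightarrow> \<Gamma> n (x_it n) = {} \<and> bt n = 0"
    using eventually_inactive[OF \<delta>] by (auto simp: eventually_sequentially)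
  have act: "active (state (Suc n)) = active (state n) - I n" if "n \<ge> n0" for n
    using n0[OF that] by (simp only: state_recursion(9)) simp
  have anti: "active (state k) \<subseteq> active (state n)" if "n0 \<le> n" "n \<le> k" for n k
    using that(2) by (induction k rule: dec_induct) (use that(1) act in auto)
  obtain f where f: "\<And>i. i \<in> {1..N} \<Longrightarrow> f i \<ge> n0 \<and> i \<in> I (f i)"
    using io[of _ n0] by metis
  define k where "k = Suc (n0 + (\<Sum>i\<in>{1..N}. f i))"
  have "i \<notin> active (state k)" if i: "i \<in> {1..N}" for i
  proof -
    have "i \<notin> active (state (Suc (f i)))" using act[of "f i"] f[OF i] by simp
    moreover have "f i \<le> (\<Sum>i\<in>{1..N}. f i)" using i by (intro member_le_sum) auto
    then have "active (state k) \<subseteq> active (state (Suc (f i)))"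
      using f[OF i] by (intro anti) (auto simp: k_def)
    ultimately show ?thesis by blast
  qed
  then have "active (state k) = {}" using active_sub[of k] by blast
  then show ?thesis using stop_index_finite(1) by blast
qed

end

section \<open>Convergence with exact data\<close>

text \<open>The convolution of \<open>f\<close> with the geometric sequence of ratio \<open>\<beta>\<close>, which is how past
gradients accumulate in the momentum.\<close>

primrec discounted_sum :: "real \<Rightarrow> (nat \<Rightarrow> real) \<Rightarrow> nat \<Rightarrow> real" where
  "discounted_sum \<beta> f 0 = f 0"
| "discounted_sum \<beta> f (Suc k) = \<beta> * discounted_sum \<beta> f k + f (Suc k)"

lemma discounted_sum_summable:
  assumes \<beta>: "0 \<le> \<beta>" "\<beta> < 1" and f: "\<And>k. 0 \<le> f k" "summable f"
  shows "0 \<le> discounted_sum \<beta> f k" "summable (discounted_sum \<beta> f)"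
    "suminf (discounted_sum \<beta> f) \<le> suminf f / (1 - \<beta>)"
proof -
  show n: "0 \<le> discounted_sum \<beta> f k" for k
    using \<beta> f by (induction k) auto
  have e: "(1 - \<beta>) * (\<Sum>k\<le>n. discounted_sum \<beta> f k) + \<beta> * discounted_sum \<beta> f n = (\<Sum>k\<le>n. f k)" for n
  proof (induction n)
    case (Suc n)
    have "(1 - \<beta>) * (\<Sum>k\<le>Suc n. discounted_sum \<beta> f k) + \<beta> * discounted_sum \<beta> f (Suc n)
      = ((1 - \<beta>) * (\<Sum>k\<le>n. discounted_sum \<beta> f k) + \<beta> * discounted_sum \<beta> f n) + f (Suc n)"
      by (simp add: algebra_simps)
    then show ?case using Suc by simp
  qed (simp add: algebra_simps)
  have b: "(\<Sum>k\<le>n. discounted_sum \<beta> f k) \<le> suminf f / (1 - \<beta>)" for n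
  proof -
    have "(1 - \<beta>) * (\<Sum>k\<le>n. discounted_sum \<beta> f k) \<le> (\<Sum>k\<le>n. f k)"
      using e[of n] mult_nonneg_nonneg[OF \<beta>(1) n[of n]] by linarith
    also have "\<dots> \<le> suminf f" using f by (intro sum_le_suminf) auto
    finally show ?thesis using \<beta> by (simp add: field_simps)
  qed
  show s: "summable (discounted_sum \<beta> f)" by (rule bounded_imp_summable[OF n b])
  show "suminf (discounted_sum \<beta> f) \<le> suminf f / (1 - \<beta>)"
  proof (rule suminf_le_const[OF s])
    show "(\<Sum>k<n. discounted_sum \<beta> f k) \<le> suminf f / (1 - \<beta>)" for n
      using b[of n] n[of n] by (simp flip: lessThan_Suc_atMost)
  qed
qed

text \<open>The constant of \<open>gradient_pairing_bound\<close>.\<close>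

definition (in nonlinear_system) C3 :: real where
  "C3 = 3 * \<mu>1 * (real N)\<^sup>2 * (1 + \<eta>)"

lemma (in nonlinear_system) C3_nonneg: "0 \<le> C3"
  using \<mu>1 \<eta> by (simp add: C3_def)

locale exact_run =
  hb_run \<Theta> Y domF F L y N x0 \<xi>0 \<sigma> \<rho> B0 \<eta> r \<mu>0 \<mu>1 \<upsilon>0 \<upsilon>1 \<beta> \<tau> y "\<lambda>_. 0" I
  for \<Theta> :: "'x::{real_inner, banach} \<Rightarrow> ereal"
    and Y :: "nat \<Rightarrow> 'y::real_normed_vector set"
    and domF F L y N x0 \<xi>0 \<sigma> \<rho> B0 \<eta> r \<mu>0 \<mu>1 \<upsilon>0 \<upsilon>1 \<beta> \<tau> I
begin

definition Q :: "nat \<Rightarrow> real" where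
  "Q n = (\<Sum>i\<in>{1..N}. (res (x_it n) i)\<^sup>2)"

definition R :: "nat \<Rightarrow> real" where
  "R n = sqrt (Q n)"

text \<open>The clause \<open>R j = 0\<close> keeps records available after the run has reached a solution.\<close>

definition record_index :: "nat \<Rightarrow> bool" where
  "record_index k \<longleftrightarrow> (\<forall>j<k. R j = 0 \<or> R k \<le> R j)"

lemma Q_nonneg: "0 \<le> Q n" by (simp add: Q_def sum_nonneg)

lemma R_nonneg: "0 \<le> R n" by (simp add: R_def Q_nonneg)

lemma R_sq: "(R n)\<^sup>2 = Q n" by (simp add: R_def Q_nonneg)

lemma res_le_R: "i \<in> {1..N} \<Longrightarrow> res (x_it n) i \<le> R n"
proof -
  assume "i \<in> {1..N}"
  then have "(res (x_it n) i)\<^sup>2 \<le> Q n" unfolding Q_def by (intro member_le_sum) auto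
  then show ?thesis unfolding R_def by (rule real_le_rsqrt)
qed

lemma \<Gamma>_empty_if_R: "R n = 0 \<Longrightarrow> \<Gamma> n (x_it n) = {}"
proof (rule ccontr)
  assume "R n = 0" "\<Gamma> n (x_it n) \<noteq> {}"
  then obtain i where i: "i \<in> \<Gamma> n (x_it n)" by blast
  show False using res_le_R[OF \<Gamma>_D(1)[OF i], of n] \<Gamma>_D(3)[OF i] \<open>R n = 0\<close> by linarith
qed

lemma \<Psi>_le_R: "\<Psi> n (x_it n) powr (1 / r) \<le> real N * R n"
proof -
  have "\<Psi> n (x_it n) \<le> (\<Sum>i\<in>\<Gamma> n (x_it n). R n powr r)"
    unfolding \<Psi>_def using res_le_R[OF \<Gamma>_D(1)] res_nonneg r by (intro sum_mono powr_mono2) auto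
  also have "\<dots> \<le> real N * R n powr r"
    using card_\<Gamma> by (simp add: mult_right_mono)
  finally have "\<Psi> n (x_it n) powr (1 / r) \<le> (real N * R n powr r) powr (1 / r)"
    using \<Psi>_nonneg r by (intro powr_mono2) auto
  also have "\<dots> = real N powr (1 / r) * R n"
    using R_nonneg r by (simp add: powr_mult powr_powr)
  also have "\<dots> \<le> real N powr 1 * R n"
    using R_nonneg r N_pos by (intro mult_right_mono powr_mono) auto
  finally show ?thesis using N_pos by simp
qed

lemma L_diff_bound:
  assumes i: "i \<in> {1..N}" and xh: "xh \<in> Sol"
  shows "norm (blinfun_apply (L i (x_it j)) (x_it k - xh)) \<le> (1 + \<eta>) * (2 * R j + R k)"
proof -
  let ?L = "blinfun_apply (L i (x_it j))"
  have "?L (x_it k - xh) = ?L (x_it j - xh) - ?L (x_it j - x_it k)"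
    by (simp flip: blinfun.diff_right)
  then have "norm (?L (x_it k - xh)) \<le> norm (?L (x_it j - xh)) + norm (?L (x_it j - x_it k))"
    by (simp add: norm_triangle_ineq4)
  also have "\<dots> \<le> (1 + \<eta>) * norm (F i (x_it j) - F i xh) + (1 + \<eta>) * norm (F i (x_it j) - F i (x_it k))"
    using F_linearised_bound(1)[OF i x_in_ball] x_in_ball Sol_D(1)[OF xh] by (intro add_mono) auto
  also have "\<dots> \<le> (1 + \<eta>) * R j + (1 + \<eta>) * (R j + R k)"
  proof -
    have 1: "norm (F i (x_it j) - F i xh) \<le> R j"
      using res_le_R[OF i, of j] Sol_D(3)[OF xh i] by (simp add: res_def)
    have "norm (F i (x_it j) - F i (x_it k)) \<le> norm (F i (x_it j) - y i) + norm (F i (x_it k) - y i)"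
      using norm_triangle_ineq4[of "F i (x_it j) - y i" "F i (x_it k) - y i"] by simp
    then have 2: "norm (F i (x_it j) - F i (x_it k)) \<le> R j + R k"
      using res_le_R[OF i, of j] res_le_R[OF i, of k] by (simp add: res_def)
    show ?thesis using 1 2 \<eta> by (intro add_mono mult_left_mono) auto
  qed
  finally show ?thesis by (simp add: algebra_simps)
qed

text \<open>The increment of \<open>\<xi>\<close> paired with \<open>x(k) - xh\<close> involves the product of the residuals at \<open>j\<close> and at \<open>k\<close>.
If \<open>k\<close> is a record, the latter is dominated by the former, and the bound becomes quadratic in the residual at
\<open>j\<close>, hence summable over \<open>j\<close>.\<close>

lemma gradient_pairing_bound:
  assumes xh: "xh \<in> Sol" and rec: "R j = 0 \<or> R k \<le> R j"
  shows "\<bar>t j * (g j \<bullet> (x_it k - xh))\<bar> \<le> C3 * Q j"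
proof (cases "R j = 0")
  case True
  then show ?thesis using stepsize_empty(1)[OF \<Gamma>_empty_if_R[OF True]] C3_nonneg Q_nonneg by simp
next
  case False
  let ?P = "\<Psi> j (x_it j)"
  have "\<bar>g j \<bullet> (x_it k - xh)\<bar> \<le> (\<Sum>i\<in>\<Gamma> j (x_it j). ?P powr ((r - 1) / r) * ((1 + \<eta>) * (3 * R j)))"
    unfolding grad_def inner_sum_left
  proof (rule order_trans[OF sum_abs], rule sum_mono)
    fix i assume G: "i \<in> \<Gamma> j (x_it j)"
    note i = \<Gamma>_D(1)[OF G]
    have "\<bar>dual_adjoint (L i (x_it j)) (J i (x_it j)) \<bullet> (x_it k - xh)\<bar>
        \<le> res (x_it j) i powr (r - 1) * norm (blinfun_apply (L i (x_it j)) (x_it k - xh))"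
      using J_facts(3)[OF i x_in_ball L_range[OF i x_in_ball]] J_facts(4)[OF i x_in_ball] by simp
    also have "\<dots> \<le> ?P powr ((r - 1) / r) * ((1 + \<eta>) * (3 * R j))"
    proof (intro mult_mono)
      have "res (x_it j) i powr (r - 1) \<le> (?P powr (1 / r)) powr (r - 1)"
        using res_le_\<Psi>[OF G] r res_nonneg by (intro powr_mono2) auto
      then show "res (x_it j) i powr (r - 1) \<le> ?P powr ((r - 1) / r)" by (simp add: powr_powr)
      have "(1 + \<eta>) * (2 * R j + R k) \<le> (1 + \<eta>) * (3 * R j)"
        using rec False \<eta> by (intro mult_left_mono) auto
      then show "norm (blinfun_apply (L i (x_it j)) (x_it k - xh)) \<le> (1 + \<eta>) * (3 * R j)"
        using L_diff_bound[OF i xh, of j k] by linarith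
    qed auto
    finally show "\<bar>dual_adjoint (L i (x_it j)) (J i (x_it j)) \<bullet> (x_it k - xh)\<bar>
        \<le> ?P powr ((r - 1) / r) * ((1 + \<eta>) * (3 * R j))" .
  qed
  also have "\<dots> \<le> real N * (?P powr ((r - 1) / r) * ((1 + \<eta>) * (3 * R j)))"
    unfolding sum_constant using card_\<Gamma> R_nonneg \<eta> by (intro mult_right_mono) auto
  finally have "\<bar>t j * (g j \<bullet> (x_it k - xh))\<bar>
      \<le> (\<mu>1 * ?P powr (2 / r - 1)) * (real N * (?P powr ((r - 1) / r) * ((1 + \<eta>) * (3 * R j))))"
    unfolding abs_mult using stepsize_le stepsize_nonneg \<mu>1 by (intro mult_mono) auto
  also have "\<dots> = \<mu>1 * real N * ((1 + \<eta>) * (3 * R j)) * (?P powr (2 / r - 1) * ?P powr ((r - 1) / r))"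
    by simp
  also have "?P powr (2 / r - 1) * ?P powr ((r - 1) / r) = ?P powr (1 / r)"
  proof -
    have "2 / r - 1 + (r - 1) / r = 1 / r" using r by (simp add: field_simps)
    then show ?thesis by (simp add: powr_add[symmetric])
  qed
  also have "\<mu>1 * real N * ((1 + \<eta>) * (3 * R j)) * ?P powr (1 / r)
      \<le> \<mu>1 * real N * ((1 + \<eta>) * (3 * R j)) * (real N * R j)"
    using \<Psi>_le_R \<mu>1 \<eta> R_nonneg by (intro mult_left_mono) auto
  also have "\<dots> = C3 * Q j"
    by (simp add: C3_def R_sq[symmetric] power2_eq_square)
  finally show ?thesis .
qed

abbreviation "S \<equiv> discounted_sum \<beta> Q"

lemma momentum_pairing_bound:
  assumes xh: "xh \<in> Sol" and rec: "record_index k"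
  shows "n < k \<Longrightarrow> \<bar>m (Suc n) \<bullet> (x_it k - xh)\<bar> \<le> C3 * S n"
proof (induction n)
  case 0
  have "R 0 = 0 \<or> R k \<le> R 0" using 0 rec by (auto simp: record_index_def)
  then show ?case
    using gradient_pairing_bound[OF xh, of 0 k] by (simp add: mom_Suc mom_0)
next
  case (Suc n)
  have "R (Suc n) = 0 \<or> R k \<le> R (Suc n)" using Suc rec by (auto simp: record_index_def)
  then have 1: "\<bar>t (Suc n) * (g (Suc n) \<bullet> (x_it k - xh))\<bar> \<le> C3 * Q (Suc n)"
    by (rule gradient_pairing_bound[OF xh])
  have 2: "\<bar>bt (Suc n) * (m (Suc n) \<bullet> (x_it k - xh))\<bar> \<le> \<beta> * (C3 * S n)"
    unfolding abs_mult using Suc bet_facts(1,2) \<beta> by (intro mult_mono) auto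
  have "m (Suc (Suc n)) \<bullet> (x_it k - xh)
      = bt (Suc n) * (m (Suc n) \<bullet> (x_it k - xh)) - t (Suc n) * (g (Suc n) \<bullet> (x_it k - xh))"
    unfolding mom_Suc[of "Suc n"] by (simp only: inner_diff_left inner_scaleR_left)
  then show ?case using 1 2 by (simp add: algebra_simps)
qed

lemma xi_difference: "n \<le> k \<Longrightarrow> (xi_it k - xi_it n) \<bullet> v = (\<Sum>j=n..<k. m (Suc j) \<bullet> v)"
proof (induction k rule: dec_induct)
  case (step k)
  then show ?case by (simp add: state_recursion(5) inner_simps)
qed simp

lemma record_exists:
  assumes Q: "summable Q"
  shows "\<exists>k>n. record_index k"
proof -
  have "(\<lambda>n. sqrt (Q n)) \<longlonglongrightarrow> sqrt 0"
    using summable_LIMSEQ_zero[OF Q] by (rule tendsto_real_sqrt)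
  then have R0: "R \<longlonglongrightarrow> 0" by (simp add: R_def[abs_def])
  \<comment> \<open>\<open>1\<close> is a dummy that keeps the set nonempty\<close>
  define e where "e = Min (insert 1 {R j | j. j \<le> n \<and> R j > 0})"
  have fin: "finite (insert 1 {R j | j. j \<le> n \<and> R j > 0})" by simp
  have e: "0 < e" unfolding e_def using fin by (subst Min_gr_iff) auto
  have le: "e \<le> R j" if "j \<le> n" "R j \<noteq> 0" for j
    unfolding e_def using fin that R_nonneg[of j] by (intro Min_le) auto
  have "\<forall>\<^sub>F k in sequentially. R k < e" using R0 e by (rule order_tendstoD(2))
  then have "\<exists>k. k > n \<and> R k < e"
    using eventually_happens[OF eventually_conj[OF eventually_gt_at_top[of n]]] by fastforce
  then have k: "(LEAST k. k > n \<and> R k < e) > n \<and> R (LEAST k. k > n \<and> R k < e) < e"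
    by (rule LeastI_ex)
  define k where "k = (LEAST k. k > n \<and> R k < e)"
  have "R j = 0 \<or> R k \<le> R j" if "j < k" for j
  proof (cases "j \<le> n")
    case True
    then show ?thesis using le[of j] k unfolding k_def[symmetric] by linarith
  next
    case False
    then have "\<not> R j < e" using not_less_Least[of j "\<lambda>k. k > n \<and> R k < e"] that by (auto simp: k_def)
    then show ?thesis using k by (simp add: k_def)
  qed
  then show ?thesis using k by (auto simp: record_index_def k_def)
qed

text \<open>Three-point identity for the Bregman distance; the pairing term is summed over the increments of
\<open>\<xi>\<close>.\<close>

lemma D_record:
  assumes xh: "xh \<in> Sol" and rec: "record_index k" and nk: "n < k"
  shows "D (xi_it n) (x_it k) (x_it n)
    \<le> D (xi_it n) xh (x_it n) - D (xi_it k) xh (x_it k) + C3 * (\<Sum>j=n..<k. S j)"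
proof -
  have 1: "D (xi_it n) (x_it k) (x_it n)
      = D (xi_it n) xh (x_it n) - D (xi_it k) xh (x_it k) + (xi_it k - xi_it n) \<bullet> (x_it k - xh)"
    by (simp add: D_def inner_simps)
  have 2: "(xi_it k - xi_it n) \<bullet> (x_it k - xh) \<le> (\<Sum>j=n..<k. C3 * S j)"
    unfolding xi_difference[OF less_imp_le[OF nk]]
  proof (rule sum_mono)
    fix j assume "j \<in> {n..<k}"
    then show "m (Suc j) \<bullet> (x_it k - xh) \<le> C3 * S j"
      using momentum_pairing_bound[OF xh rec, of j] by simp
  qed
  show ?thesis using 2 unfolding 1 sum_distrib_left by linarith
qed

text \<open>For all \<open>n\<close> and all later records \<open>k\<close> the Bregman distance from \<open>x(n)\<close> to \<open>x(k)\<close> is at most \<open>e n\<close>,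
with \<open>e\<close> tending to \<open>0\<close>. This makes the records Cauchy, and since it holds for every \<open>n\<close>, the lower
semicontinuity of \<open>\<theta>\<close> extends the estimate to the limit of the records and all \<open>x(n)\<close>. The final bound,
which is the case \<open>n = 0\<close>, later serves as an integrable majorant.\<close>

lemma exact_limit:
  assumes Q: "summable Q"
  obtains xs where "xs \<in> Sol" "x_it \<longlonglongrightarrow> xs" "(\<lambda>n. D (xi_it n) xs (x_it n)) \<longlonglongrightarrow> 0"
    "D \<xi>0 xs x0 \<le> \<sigma> * \<rho>\<^sup>2 + C3 / (1 - \<beta>) * suminf Q"
proof -
  obtain xh where xh: "xh \<in> Sol" "D \<xi>0 xh x0 \<le> \<sigma> * \<rho>\<^sup>2" using Sol_near by blast
  note S = discounted_sum_summable[OF \<beta> Q_nonneg Q]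
  define a where "a n = D (xi_it n) xh (x_it n)" for n
  have a_nonneg: "0 \<le> a n" for n
    unfolding a_def using D_nonneg[OF x_subdiff Sol_D(2)[OF xh(1)]] .
  have a_anti: "decseq a"
    unfolding decseq_def a_def using D_antimono xh(1) by blast
  obtain a' where a': "a \<longlonglongrightarrow> a'" "\<And>n. a' \<le> a n"
    using decseq_convergent[OF a_anti, of 0] a_nonneg by blast
  have a'0: "0 \<le> a'" using LIMSEQ_le_const[OF a'(1)] a_nonneg by blast
  \<comment> \<open>decrease of the distance to \<open>xh\<close> after \<open>n\<close>, plus the tail of the summable pairing terms\<close>
  define e where "e n = a n - a' + C3 * (suminf S - (\<Sum>j<n. S j))" for n
  have e: "D (xi_it n) (x_it k) (x_it n) \<le> e n" if "record_index k" "n < k" for n k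
  proof -
    have "(\<Sum>j=n..<k. S j) = (\<Sum>j<k. S j) - (\<Sum>j<n. S j)"
      using sum_diff_nat_ivl[of 0 n k S] that(2) by (simp add: lessThan_atLeast0)
    moreover have "(\<Sum>j<k. S j) \<le> suminf S"
      by (rule sum_le_suminf[OF S(2)]) (auto intro: S(1))
    ultimately have "(\<Sum>j=n..<k. S j) \<le> suminf S - (\<Sum>j<n. S j)" by linarith
    then have "C3 * (\<Sum>j=n..<k. S j) \<le> C3 * (suminf S - (\<Sum>j<n. S j))"
      using C3_nonneg by (intro mult_left_mono) auto
    then show ?thesis using D_record[OF xh(1) that] a'(2)[of k] by (simp add: e_def a_def)
  qed
  have e0: "e \<longlonglongrightarrow> 0"
  proof -
    have "(\<lambda>n. a n - a' + C3 * (suminf S - (\<Sum>j<n. S j))) \<longlonglongrightarrow> a' - a' + C3 * (suminf S - suminf S)"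
      by (intro tendsto_intros a'(1) summable_LIMSEQ S)
    then show ?thesis by (simp add: e_def[abs_def])
  qed
  have "infinite {k. record_index k}"
    unfolding infinite_nat_iff_unbounded using record_exists[OF Q] by auto
  then obtain \<phi> :: "nat \<Rightarrow> nat" where \<phi>: "strict_mono \<phi>" "\<And>k. record_index (\<phi> k)"
    using infinite_enumerate by blast
  have e\<phi>: "(\<lambda>k. e (\<phi> k)) \<longlonglongrightarrow> 0"
    using LIMSEQ_subseq_LIMSEQ[OF e0 \<phi>(1)] by (simp add: o_def)
  have sq: "\<sigma> * (norm (x_it k - x_it n))\<^sup>2 \<le> e n" if "record_index k" "n < k" for n k
    using D_ge[OF x_subdiff x_edom, of k n] e[OF that] by linarith
  have "Cauchy (\<lambda>k. x_it (\<phi> k))"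
  proof (rule metric_CauchyI)
    fix d :: real assume d: "0 < d"
    have "\<forall>\<^sub>F k in sequentially. e (\<phi> k) < \<sigma> * d\<^sup>2"
      using e\<phi> \<sigma> d by (intro order_tendstoD(2)) auto
    then obtain K where K: "\<And>k. k \<ge> K \<Longrightarrow> e (\<phi> k) < \<sigma> * d\<^sup>2"
      by (auto simp: eventually_sequentially)
    have lt: "dist (x_it (\<phi> k)) (x_it (\<phi> j)) < d" if "j \<ge> K" "j < k" for j k
    proof -
      have "\<sigma> * (norm (x_it (\<phi> k) - x_it (\<phi> j)))\<^sup>2 < \<sigma> * d\<^sup>2"
        using sq[OF \<phi>(2) strict_monoD[OF \<phi>(1) that(2)]] K[OF that(1)] by (rule le_less_trans)
      then have "(norm (x_it (\<phi> k) - x_it (\<phi> j)))\<^sup>2 < d\<^sup>2" using \<sigma> by simp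
      then show ?thesis using d by (simp add: dist_norm power_less_imp_less_base)
    qed
    show "\<exists>K. \<forall>k\<ge>K. \<forall>j\<ge>K. dist (x_it (\<phi> k)) (x_it (\<phi> j)) < d"
    proof (intro exI allI impI)
      fix k j assume "K \<le> k" "K \<le> j"
      then show "dist (x_it (\<phi> k)) (x_it (\<phi> j)) < d"
        using lt[of j k] lt[of k j] d by (cases j k rule: linorder_cases) (auto simp: dist_commute)
    qed
  qed
  then obtain xs where xs: "(\<lambda>k. x_it (\<phi> k)) \<longlonglongrightarrow> xs"
    using Cauchy_convergent_iff convergent_def by blast
  have R0: "(\<lambda>k. R (\<phi> k)) \<longlonglongrightarrow> 0"
  proof -
    have "(\<lambda>n. sqrt (Q n)) \<longlonglongrightarrow> sqrt 0"
      using summable_LIMSEQ_zero[OF Q] by (rule tendsto_real_sqrt)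
    then show ?thesis using LIMSEQ_subseq_LIMSEQ[OF _ \<phi>(1), of R 0] by (simp add: R_def[abs_def] o_def)
  qed
  have Fxs: "F i xs = y i" if i: "i \<in> {1..N}" for i
  proof -
    have "(\<lambda>k. F i (x_it (\<phi> k)) - y i) \<longlonglongrightarrow> F i xs - y i"
      by (intro tendsto_intros F_sequence(2)[OF i x_in_ball xs])
    moreover have "(\<lambda>k. F i (x_it (\<phi> k)) - y i) \<longlonglongrightarrow> 0"
      using res_le_R[OF i] by (intro Lim_null_comparison[OF _ R0]) (simp add: res_def)
    ultimately show ?thesis using LIMSEQ_unique by fastforce
  qed
  have ball: "xs \<in> cball x0 (2 * \<rho>)"
    using F_sequence(1)[OF _ x_in_ball xs, of 1] N_pos by simp
  have Dn: "xs \<in> edom \<Theta> \<and> D (xi_it n) xs (x_it n) \<le> e n" for n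
  proof -
    \<comment> \<open>the shift by \<open>Suc n\<close> restricts to records after \<open>n\<close>\<close>
    define u where "u k = x_it (\<phi> (k + Suc n))" for k
    have u: "u \<longlonglongrightarrow> xs"
      unfolding u_def by (rule LIMSEQ_ignore_initial_segment[OF xs])
    have ud: "u k \<in> edom \<Theta>" for k by (simp add: u_def x_edom)
    have le: "\<theta> (u k) \<le> \<theta> (x_it n) + xi_it n \<bullet> (u k - x_it n) + e n" for k
    proof -
      have "n < \<phi> (k + Suc n)" using seq_suble[OF \<phi>(1), of "k + Suc n"] by linarith
      from e[OF \<phi>(2) this] show ?thesis by (simp add: D_def u_def)
    qed
    have lim: "(\<lambda>k. \<theta> (x_it n) + xi_it n \<bullet> (u k - x_it n) + e n)
        \<longlonglongrightarrow> \<theta> (x_it n) + xi_it n \<bullet> (xs - x_it n) + e n"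
      by (intro tendsto_intros u)
    show ?thesis using edom_sequence[OF ud u le lim] by (simp add: D_def)
  qed
  have Sol: "xs \<in> Sol" using ball Dn Fxs by (simp add: Sol_def)
  have lim: "x_it \<longlonglongrightarrow> xs"
  proof -
    have n: "(norm (x_it n - xs))\<^sup>2 \<le> e n / \<sigma>" for n
      using D_ge[OF x_subdiff[of n] Sol_D(2)[OF Sol]] Dn[of n] \<sigma>
      by (simp add: field_simps norm_minus_commute)
    have "(\<lambda>n. (norm (x_it n - xs))\<^sup>2) \<longlonglongrightarrow> 0"
    proof (rule tendsto_sandwich[OF _ _ tendsto_const])
      show "(\<lambda>n. e n / \<sigma>) \<longlonglongrightarrow> 0" using tendsto_divide[OF e0 tendsto_const[of \<sigma>]] \<sigma> by simp
    qed (use n in auto)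
    then have "(\<lambda>n. sqrt ((norm (x_it n - xs))\<^sup>2)) \<longlonglongrightarrow> sqrt 0" by (rule tendsto_real_sqrt)
    then have "(\<lambda>n. x_it n - xs) \<longlonglongrightarrow> 0" by (simp add: tendsto_norm_zero_iff)
    then show ?thesis by (rule LIM_zero_cancel)
  qed
  have D0: "(\<lambda>n. D (xi_it n) xs (x_it n)) \<longlonglongrightarrow> 0"
    by (rule tendsto_sandwich[OF _ _ tendsto_const e0])
      (use Dn D_nonneg[OF x_subdiff Sol_D(2)[OF Sol]] in auto)
  have "D \<xi>0 xs x0 \<le> e 0" using Dn[of 0] by (simp add: state_recursion)
  also have "\<dots> \<le> \<sigma> * \<rho>\<^sup>2 + C3 * suminf S"
    using xh(2) a'0 by (simp add: e_def a_def state_recursion)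
  also have "C3 * suminf S \<le> C3 * (suminf Q / (1 - \<beta>))"
    using S(3) C3_nonneg by (intro mult_left_mono)
  finally show ?thesis using that Sol lim D0 by simp
qed

lemmas exact_limit_unfolded = exact_limit[unfolded Q_def[abs_def]]

end

section \<open>The solution of minimal Bregman distance\<close>

context nonlinear_system
begin

lemma linearisation_vanishes:
  assumes i: "i \<in> {1..N}" and x: "x \<in> Sol" and z: "z \<in> Sol"
  shows "blinfun_apply (L i x) (x - z) = 0"
proof -
  have "norm (blinfun_apply (L i x) (x - z)) \<le> (1 + \<eta>) * norm (F i x - F i z)"
    using x z by (intro F_linearised_bound(1)[OF i]) (auto simp: Sol_def)
  then show ?thesis using x z i by (simp add: Sol_def)
qed

text \<open>The condition on the initial distance confines all relevant solutions to the ball, where the cone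
condition turns the solution set into the intersection of the ball with an affine space; so it is convex and closed, and strongly convex
minimisation applies.\<close>

lemma x_dagger_minimal:
  defines "xd \<equiv> x_dagger \<Theta> N domF F y x0 \<xi>0"
  shows "xd \<in> Sol" "\<And>z. z \<in> Sol \<Longrightarrow> D \<xi>0 z x0 \<le> D \<xi>0 xd x0 \<Longrightarrow> z = xd"
proof -
  have x0e: "x0 \<in> edom \<Theta>" by (rule subdiff_imp_edom[OF init])
  obtain xt where xt: "xt \<in> Sol" "D \<xi>0 xt x0 \<le> \<sigma> * \<rho>\<^sup>2" using Sol_near by blast
  have "\<exists>!x. x \<in> Sol \<and> (\<forall>z\<in>Sol. \<theta> x - \<xi>0 \<bullet> x \<le> \<theta> z - \<xi>0 \<bullet> z)"
  proof (rule tilted_minimiser)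
    show "Sol \<subseteq> edom \<Theta>" "Sol \<noteq> {}" using xt by (auto simp: Sol_def)
    show "(1/2) *\<^sub>R (x + z) \<in> Sol" if "x \<in> Sol" "z \<in> Sol" "(1/2) *\<^sub>R (x + z) \<in> edom \<Theta>" for x z
    proof -
      have "(1/2) *\<^sub>R x + (1/2) *\<^sub>R z \<in> cball x0 (2 * \<rho>)"
        using that by (intro convexD[OF convex_cball]) (auto simp: Sol_def)
      then have mb: "(1/2) *\<^sub>R (x + z) \<in> cball x0 (2 * \<rho>)" by (simp add: scaleR_add_right)
      have "F i ((1/2) *\<^sub>R (x + z)) = y i" if i: "i \<in> {1..N}" for i
      proof -
        have "x - (1/2) *\<^sub>R (x + z) = (1/2) *\<^sub>R (x - z)"
          by (simp add: algebra_simps flip: scaleR_left.add)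
        then have "blinfun_apply (L i x) (x - (1/2) *\<^sub>R (x + z)) = 0"
          using linearisation_vanishes[OF i \<open>x \<in> Sol\<close> \<open>z \<in> Sol\<close>] by (simp add: blinfun.scaleR_right)
        then have "(1 - \<eta>) * norm (F i x - F i ((1/2) *\<^sub>R (x + z))) \<le> 0"
          using F_linearised_bound(2)[OF i _ mb, of x] \<open>x \<in> Sol\<close> by (simp add: Sol_def)
        then have "F i x = F i ((1/2) *\<^sub>R (x + z))" using \<eta> by (simp add: mult_le_0_iff)
        then show ?thesis using \<open>x \<in> Sol\<close> i by (simp add: Sol_def)
      qed
      then show ?thesis using that mb by (simp add: Sol_def)
    qed
    show "x \<in> Sol" if u: "\<And>k. u k \<in> Sol" "u \<longlonglongrightarrow> x" "x \<in> edom \<Theta>" for u x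
    proof -
      have ub: "u k \<in> cball x0 (2 * \<rho>)" for k using u(1) by (simp add: Sol_def)
      have "F i x = y i" if i: "i \<in> {1..N}" for i
      proof -
        have "(\<lambda>k. F i (u k)) \<longlonglongrightarrow> F i x" by (rule F_sequence(2)[OF i ub u(2)])
        moreover have "F i (u k) = y i" for k using u(1) i by (simp add: Sol_def)
        ultimately show ?thesis by (simp add: LIMSEQ_const_iff)
      qed
      moreover have "x \<in> cball x0 (2 * \<rho>)" using F_sequence(1)[OF _ ub u(2), of 1] N_pos by simp
      ultimately show ?thesis using u(3) by (simp add: Sol_def)
    qed
  qed
  then obtain w where w: "w \<in> Sol" "\<And>z. z \<in> Sol \<Longrightarrow> \<theta> w - \<xi>0 \<bullet> w \<le> \<theta> z - \<xi>0 \<bullet> z"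
    and uniq: "\<And>w'. w' \<in> Sol \<Longrightarrow> (\<And>z. z \<in> Sol \<Longrightarrow> \<theta> w' - \<xi>0 \<bullet> w' \<le> \<theta> z - \<xi>0 \<bullet> z) \<Longrightarrow> w' = w"
    by metis
  have wD: "D \<xi>0 w x0 \<le> D \<xi>0 z x0" if "z \<in> Sol" for z
    using w(2)[OF that] by (simp add: D_def inner_simps)
  have uD: "w' = w" if "w' \<in> Sol" "D \<xi>0 w' x0 \<le> D \<xi>0 w x0" for w'
  proof (rule uniq[OF that(1)])
    show "\<theta> w' - \<xi>0 \<bullet> w' \<le> \<theta> z - \<xi>0 \<bullet> z" if "z \<in> Sol" for z
      using w(2)[OF that] \<open>D \<xi>0 w' x0 \<le> D \<xi>0 w x0\<close> by (simp add: D_def inner_simps)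
  qed
  let ?P = "\<lambda>x. is_solution N domF F y x \<and> x \<in> edom \<Theta>"
  have SolP: "?P z" if "z \<in> Sol" for z
    using that ball_dom by (auto simp: Sol_def is_solution_def)
  have PSol: "z \<in> Sol" if "?P z" "D \<xi>0 z x0 \<le> D \<xi>0 w x0" for z
  proof -
    have "\<sigma> * (norm (z - x0))\<^sup>2 \<le> \<sigma> * \<rho>\<^sup>2"
      using D_ge[OF init, of z] that wD[OF xt(1)] xt(2) by linarith
    then have "(norm (z - x0))\<^sup>2 \<le> \<rho>\<^sup>2" using \<sigma> by simp
    then have "norm (z - x0) \<le> \<rho>" using \<rho> by (rule power2_le_imp_le[OF _ less_imp_le])
    then have "norm (x0 - z) \<le> 2 * \<rho>" using \<rho> by (simp add: norm_minus_commute)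
    then show ?thesis using that by (simp add: Sol_def is_solution_def dist_norm)
  qed
  have br: "bregman \<Theta> \<xi>0 z x0 < bregman \<Theta> \<xi>0 z' x0 \<longleftrightarrow> D \<xi>0 z x0 < D \<xi>0 z' x0" if "?P z" "?P z'" for z z'
    using that x0e by (simp add: bregman_real)
  have "xd = w"
    unfolding xd_def x_dagger_def
  proof (rule the_equality)
    show "is_arg_min (\<lambda>x. bregman \<Theta> \<xi>0 x x0) ?P w"
      unfolding is_arg_min_def
    proof (intro conjI notI)
      show "is_solution N domF F y w" "w \<in> edom \<Theta>" using SolP[OF w(1)] by auto
      assume "\<exists>z. ?P z \<and> bregman \<Theta> \<xi>0 z x0 < bregman \<Theta> \<xi>0 w x0"
      then obtain z where z: "?P z" "D \<xi>0 z x0 < D \<xi>0 w x0" using br SolP[OF w(1)] by blast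
      then show False using wD[OF PSol[OF z(1)]] by simp
    qed
    fix x assume x: "is_arg_min (\<lambda>x. bregman \<Theta> \<xi>0 x x0) ?P x"
    then have xP: "?P x" by (simp add: is_arg_min_def)
    have "\<not> D \<xi>0 w x0 < D \<xi>0 x x0"
      using x br[OF SolP[OF w(1)] xP] SolP[OF w(1)] by (auto simp: is_arg_min_def)
    then show "x = w" using uD[OF PSol[OF xP]] by simp
  qed
  then show "xd \<in> Sol" "\<And>z. z \<in> Sol \<Longrightarrow> D \<xi>0 z x0 \<le> D \<xi>0 xd x0 \<Longrightarrow> z = xd"
    using w(1) uD by auto
qed

end

context exact_run
begin

text \<open>The linearisation at \<open>xd\<close> annihilates \<open>xd - xs\<close>, so the range of its adjoint is orthogonal to this
vector, and so is its closure, which contains all terms of the gradients. Hence \<open>\<xi>(n)\<close> and \<open>\<xi>0\<close> pair equally with \<open>xs - xd\<close>, and the difference of the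
two Bregman distances from \<open>x0\<close> is at most \<open>D \<xi>(n) xs x(n)\<close>, which tends to \<open>0\<close>.\<close>

lemma limit_is_x_dagger:
  defines "xd \<equiv> x_dagger \<Theta> N domF F y x0 \<xi>0"
  assumes range: "\<forall>i\<in>{1..N}. \<forall>x\<in>cball x0 (2 * \<rho>).
      ran_adjoint (Y i) (L i x) \<subseteq> closure (ran_adjoint (Y i) (L i xd))"
    and xs: "xs \<in> Sol" and lim: "(\<lambda>n. D (xi_it n) xs (x_it n)) \<longlonglongrightarrow> 0"
  shows "xs = xd"
proof -
  have xd: "xd \<in> Sol" unfolding xd_def by (rule x_dagger_minimal)
  have orth: "dual_adjoint (L i x) (J i x) \<bullet> (xd - xs) = 0"
    if i: "i \<in> {1..N}" and x: "x \<in> cball x0 (2 * \<rho>)" for i x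
  proof -
    have "ran_adjoint (Y i) (L i xd) \<subseteq> {u. u \<bullet> (xd - xs) = 0}"
    proof
      fix u assume "u \<in> ran_adjoint (Y i) (L i xd)"
      then obtain \<zeta> where z: "\<zeta> \<in> dual_space (Y i)" "u = dual_adjoint (L i xd) \<zeta>"
        by (auto simp: ran_adjoint_def)
      have "u \<bullet> (xd - xs) = \<zeta> (blinfun_apply (L i xd) (xd - xs))"
        unfolding z(2) using L_range[OF i Sol_D(1)[OF xd]] by (intro dual_adjoint_inner[OF z(1)])
      also have "\<dots> = 0"
        using linearisation_vanishes[OF i xd xs] dual_space_zero[OF z(1) Y_subspace[OF i]] by simp
      finally show "u \<in> {u. u \<bullet> (xd - xs) = 0}" by simp
    qed
    moreover have "closed {u. u \<bullet> (xd - xs) = 0}"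
      by (intro closed_Collect_eq continuous_intros)
    ultimately have "closure (ran_adjoint (Y i) (L i xd)) \<subseteq> {u. u \<bullet> (xd - xs) = 0}"
      by (rule closure_minimal)
    moreover have "dual_adjoint (L i x) (J i x) \<in> ran_adjoint (Y i) (L i x)"
      using J_facts(1)[OF i x] by (simp add: ran_adjoint_def)
    ultimately show ?thesis using range i x by blast
  qed
  have g: "g n \<bullet> (xd - xs) = 0" for n
    unfolding grad_def inner_sum_left by (intro sum.neutral ballI orth[OF \<Gamma>_D(1) x_in_ball])
  have m: "m n \<bullet> (xd - xs) = 0" for n
    by (induction n) (simp_all add: mom_0 mom_Suc inner_diff_left g)
  have xi: "(xi_it n - \<xi>0) \<bullet> (xd - xs) = 0" for n
    using xi_difference[of 0 n "xd - xs"] m by (simp add: state_recursion(2))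
  have "D \<xi>0 xs x0 - D \<xi>0 xd x0 \<le> D (xi_it n) xs (x_it n)" for n
  proof -
    have "D \<xi>0 xs x0 - D \<xi>0 xd x0 = D (xi_it n) xs (x_it n) - D (xi_it n) xd (x_it n)"
      using xi[of n] by (simp add: D_def inner_simps)
    then show ?thesis using D_nonneg[OF x_subdiff[of n] Sol_D(2)[OF xd]] by linarith
  qed
  then have "D \<xi>0 xs x0 - D \<xi>0 xd x0 \<le> 0"
    by (intro LIMSEQ_le_const[OF lim]) auto
  then show ?thesis using x_dagger_minimal(2)[OF xs] by (simp add: xd_def)
qed

end

section \<open>Stability with respect to the data\<close>

text \<open>For sums over index sets that jump with the data: a term may drop out only if its limit is \<open>0\<close>.\<close>

lemma tendsto_if_eventually:
  fixes f :: "nat \<Rightarrow> 'a::real_normed_vector"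
  assumes f: "f \<longlonglongrightarrow> a" and P: "a \<noteq> 0 \<Longrightarrow> \<forall>\<^sub>F l in sequentially. P l"
  shows "(\<lambda>l. if P l then f l else 0) \<longlonglongrightarrow> a"
proof (cases "a = 0")
  case True
  then have "(\<lambda>l. norm (f l)) \<longlonglongrightarrow> 0" using f tendsto_norm_zero by blast
  then show ?thesis
    unfolding True by (rule Lim_null_comparison[rotated]) (auto intro!: always_eventually)
next
  case False
  have "\<forall>\<^sub>F l in sequentially. f l = (if P l then f l else 0)"
    using P[OF False] by eventually_elim simp
  then show ?thesis using f by (rule Lim_transform_eventually[rotated])
qed

lemma tendsto_null_bound:
  fixes f :: "nat \<Rightarrow> 'a::real_normed_vector"
  assumes "\<And>l. norm (f l) \<le> h l" "h \<longlonglongrightarrow> 0"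
  shows "f \<longlonglongrightarrow> 0"
  by (rule Lim_null_comparison[OF always_eventually[OF allI] assms(2)]) (rule assms(1))

locale noisy_family =
  exact_run \<Theta> Y domF F L y N x0 \<xi>0 \<sigma> \<rho> B0 \<eta> r \<mu>0 \<mu>1 \<upsilon>0 \<upsilon>1 \<beta> \<tau> I
  for \<Theta> :: "'x::{real_inner, banach} \<Rightarrow> ereal"
    and Y :: "nat \<Rightarrow> 'y::real_normed_vector set"
    and domF F L y N x0 \<xi>0 \<sigma> \<rho> B0 \<eta> r \<mu>0 \<mu>1 \<upsilon>0 \<upsilon>1 \<beta> \<tau> I +
  fixes yd :: "nat \<Rightarrow> nat \<Rightarrow> 'y" and \<delta> :: "nat \<Rightarrow> nat \<Rightarrow> real"
  assumes run: "\<And>l. hb_run \<Theta> Y domF F L y N x0 \<xi>0 \<sigma> \<rho> B0 \<eta> r \<mu>0 \<mu>1 \<upsilon>0 \<upsilon>1 \<beta> \<tau> (yd l) (\<delta> l) I"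
    and \<delta>_tendsto: "\<And>i. i \<in> {1..N} \<Longrightarrow> (\<lambda>l. \<delta> l i) \<longlonglongrightarrow> 0"
begin

abbreviation "resl l \<equiv> heavy_ball.res F (yd l)"
abbreviation "\<Gamma>l l \<equiv> heavy_ball.\<Gamma> F \<tau> (yd l) (\<delta> l) I"
abbreviation "gradl l \<equiv> heavy_ball.grad Y F L r \<tau> (yd l) (\<delta> l) I"
abbreviation "\<Phi>l l \<equiv> heavy_ball.\<Phi> F \<eta> r \<tau> (yd l) (\<delta> l) I"
abbreviation "\<Psi>l l \<equiv> heavy_ball.\<Psi> F r \<tau> (yd l) (\<delta> l) I"
abbreviation "stepl l \<equiv> heavy_ball.stepsize Y F L \<eta> r \<mu>0 \<mu>1 \<tau> (yd l) (\<delta> l) I"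
abbreviation "statel l \<equiv> heavy_ball.state \<Theta> Y F L N x0 \<xi>0 \<eta> \<sigma> r \<mu>0 \<mu>1 \<upsilon>0 \<upsilon>1 \<beta> \<tau> (yd l) (\<delta> l) I"
abbreviation "betl l n \<equiv> heavy_ball.bet Y F L N \<eta> \<sigma> r \<mu>0 \<mu>1 \<upsilon>0 \<upsilon>1 \<beta> \<tau> (yd l) (\<delta> l) I n (statel l n)"
abbreviation "moml l n \<equiv> heavy_ball.mom (statel l n)"
abbreviation "gaml l n \<equiv> heavy_ball.gam (statel l n)"
abbreviation "xl l \<equiv> heavy_ball.x_it \<Theta> Y F L N x0 \<xi>0 \<eta> \<sigma> r \<mu>0 \<mu>1 \<upsilon>0 \<upsilon>1 \<beta> \<tau> (yd l) (\<delta> l) I"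
abbreviation "xil l \<equiv> heavy_ball.xi_it \<Theta> Y F L N x0 \<xi>0 \<eta> \<sigma> r \<mu>0 \<mu>1 \<upsilon>0 \<upsilon>1 \<beta> \<tau> (yd l) (\<delta> l) I"
abbreviation "\<delta>minl l \<equiv> heavy_ball.\<delta>min N (\<delta> l)"

lemma \<delta>min_tendsto: "\<delta>minl \<longlonglongrightarrow> 0"
proof (rule tendsto_null_bound)
  have 1: "1 \<in> {1..N}" using N_pos by simp
  show "(\<lambda>l. \<delta> l 1) \<longlonglongrightarrow> 0" by (rule \<delta>_tendsto[OF 1])
  have "\<delta>minl l \<le> \<delta> l 1" for l
    unfolding heavy_ball.\<delta>min_def using 1 by (intro Min_le) auto
  then show "norm (\<delta>minl l) \<le> \<delta> l 1" for l
    using hb_run.\<delta>min_nonneg[OF run, of l] by simp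
qed

lemma yd_tendsto: "i \<in> {1..N} \<Longrightarrow> (\<lambda>l. yd l i) \<longlonglongrightarrow> y i"
proof -
  assume i: "i \<in> {1..N}"
  have "(\<lambda>l. yd l i - y i) \<longlonglongrightarrow> 0"
    by (rule tendsto_null_bound[OF hb_run.noise[OF run i] \<delta>_tendsto[OF i]])
  then show ?thesis by (rule LIM_zero_cancel)
qed

lemma exact_\<delta>min: "heavy_ball.\<delta>min N (\<lambda>_. 0::real) = 0"
  using N_pos by (simp add: heavy_ball.\<delta>min_def)

context
  fixes u :: "nat \<Rightarrow> 'x" and x :: 'x
  assumes u: "\<And>l. u l \<in> cball x0 (2 * \<rho>)" "u \<longlonglongrightarrow> x"
begin

lemma x_ball: "x \<in> cball x0 (2 * \<rho>)"
  using F_sequence(1)[OF _ u, of 1] N_pos by simp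

lemma residual_tendsto:
  assumes i: "i \<in> {1..N}"
  shows "(\<lambda>l. F i (u l) - yd l i) \<longlonglongrightarrow> F i x - y i" "(\<lambda>l. resl l (u l) i) \<longlonglongrightarrow> res x i"
proof -
  show 1: "(\<lambda>l. F i (u l) - yd l i) \<longlonglongrightarrow> F i x - y i"
    by (intro tendsto_intros F_sequence(2)[OF i u] yd_tendsto[OF i])
  show "(\<lambda>l. resl l (u l) i) \<longlonglongrightarrow> res x i"
    unfolding heavy_ball.res_def by (rule tendsto_norm[OF 1])
qed

lemma discrepancy_eventually:
  assumes i: "i \<in> {1..N}" and "res x i \<noteq> 0"
  shows "\<forall>\<^sub>F l in sequentially. \<tau> * \<delta> l i < resl l (u l) i"
proof -
  have "(\<lambda>l. resl l (u l) i - \<tau> * \<delta> l i) \<longlonglongrightarrow> res x i - \<tau> * 0"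
    by (intro tendsto_intros residual_tendsto(2)[OF i] \<delta>_tendsto[OF i])
  then have "\<forall>\<^sub>F l in sequentially. 0 < resl l (u l) i - \<tau> * \<delta> l i"
    using assms res_nonneg[of x i] by (intro order_tendstoD(1)) auto
  then show ?thesis by eventually_elim simp
qed

text \<open>At a vanishing limit residual the norm bound suffices; otherwise the norm continuity of the duality
mapping is needed, since weak convergence of the gradients would not control the step size.\<close>

lemma adjoint_term_tendsto:
  assumes i: "i \<in> {1..N}"
  shows "(\<lambda>l. dual_adjoint (L i (u l)) (duality_map r (Y i) (F i (u l) - yd l i)))
    \<longlonglongrightarrow> dual_adjoint (L i x) (duality_map r (Y i) (F i x - y i))"
proof (cases "res x i = 0")
  case True
  have "(\<lambda>l. resl l (u l) i powr (r - 1) * B0) \<longlonglongrightarrow> res x i powr (r - 1) * B0"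
    using r residual_tendsto(2)[OF i]
    by (intro tendsto_intros tendsto_powr') (auto simp: heavy_ball.res_def)
  then have "(\<lambda>l. resl l (u l) i powr (r - 1) * B0) \<longlonglongrightarrow> 0" using True by simp
  then have "(\<lambda>l. dual_adjoint (L i (u l)) (duality_map r (Y i) (F i (u l) - yd l i))) \<longlonglongrightarrow> 0"
    by (rule tendsto_null_bound[OF hb_run.J_facts(5)[OF run i u(1)]])
  moreover have "dual_adjoint (L i x) (duality_map r (Y i) (F i x - y i)) = 0"
    using J_facts(5)[OF i x_ball] True by simp
  ultimately show ?thesis by simp
next
  case False
  then have nz: "F i x - y i \<noteq> 0" by (simp add: res_def)
  let ?K = "res x i powr (r - 1)"
  have LL: "(\<lambda>l. L i (u l)) \<longlonglongrightarrow> L i x"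
    by (rule continuous_on_tendsto_compose[OF L_cont[OF i] u(2) x_ball always_eventually[OF allI[OF u(1)]]])
  have nL: "(\<lambda>l. norm (L i (u l) - L i x)) \<longlonglongrightarrow> 0"
    using LL by (simp add: tendsto_norm_zero LIM_zero)
  show ?thesis
  proof (rule tendstoI)
    fix e :: real assume e: "0 < e"
    \<comment> \<open>leaves \<open>e / 2\<close> for the functional after multiplication with \<open>norm (L i (u l)) \<le> B0\<close>\<close>
    define e1 where "e1 = e / (2 * B0)"
    have e1: "0 < e1" using e B0 by (simp add: e1_def)
    have "(\<lambda>l. ?K * norm (L i (u l) - L i x)) \<longlonglongrightarrow> ?K * 0" by (intro tendsto_intros nL)
    then have ev1: "\<forall>\<^sub>F l in sequentially. ?K * norm (L i (u l) - L i x) < e / 2"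
      using e by (intro order_tendstoD(2)) auto
    have ev2: "\<forall>\<^sub>F l in sequentially. \<forall>v\<in>Y i. \<bar>duality_map r (Y i) (F i (u l) - yd l i) v
        - duality_map r (Y i) (F i x - y i) v\<bar> \<le> e1 * norm v"
      using residual_in_Y[OF i x_ball] nz hb_run.residual_in_Y[OF run i u(1)]
      by (intro duality_map_continuous[OF Y_subspace[OF i] Y_smooth[OF i] r _ _ _ residual_tendsto(1)[OF i] e1])
    show "\<forall>\<^sub>F l in sequentially. dist (dual_adjoint (L i (u l)) (duality_map r (Y i) (F i (u l) - yd l i)))
         (dual_adjoint (L i x) (duality_map r (Y i) (F i x - y i))) < e"
      using ev1 ev2
    proof eventually_elim
      case (elim l)
      have "norm (dual_adjoint (L i (u l)) (duality_map r (Y i) (F i (u l) - yd l i))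
         - dual_adjoint (L i x) (duality_map r (Y i) (F i x - y i)))
         \<le> e1 * norm (L i (u l)) + ?K * norm (L i (u l) - L i x)"
        using elim e1 J_facts(3)[OF i x_ball] L_range[OF i u(1)] L_range[OF i x_ball]
        by (intro norm_dual_adjoint_diff_le[OF hb_run.J_facts(1)[OF run i u(1)] _ J_facts(1)[OF i x_ball] _ Y_subspace[OF i]]) auto
      also have "e1 * norm (L i (u l)) \<le> e1 * B0"
        using L_bound[OF i u(1)] e1 by (intro mult_left_mono) auto
      also have "e1 * B0 = e / 2" using B0 by (simp add: e1_def)
      finally show ?case using elim by (simp add: dist_norm)
    qed
  qed
qed

lemma I_D: "i \<in> I n \<Longrightarrow> i \<in> {1..N}" using I_sub by blast

lemma finite_I: "finite (I n)" by (rule finite_subset[OF I_sub]) simp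

lemma sum_over_\<Gamma>l: "(\<Sum>i\<in>\<Gamma>l l n v. f i) = (\<Sum>i\<in>I n. if \<tau> * \<delta> l i < resl l v i then f i else 0)"
  unfolding heavy_ball.\<Gamma>_def using finite_I by (simp add: sum.inter_filter)

lemma sum_over_\<Gamma>: "(\<And>i. i \<in> I n \<Longrightarrow> res v i = 0 \<Longrightarrow> f i = 0) \<Longrightarrow> (\<Sum>i\<in>\<Gamma> n v. f i) = (\<Sum>i\<in>I n. f i)"
proof (rule sum.mono_neutral_left[OF finite_I])
  assume z: "\<And>i. i \<in> I n \<Longrightarrow> res v i = 0 \<Longrightarrow> f i = 0"
  show "\<forall>i\<in>I n - \<Gamma> n v. f i = 0"
  proof
    fix i assume i: "i \<in> I n - \<Gamma> n v"
    then have "res v i = 0" using res_nonneg[of v i] by (simp add: \<Gamma>_def)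
    then show "f i = 0" using z i by simp
  qed
qed (auto simp: \<Gamma>_def)

lemma grad_tendsto: "(\<lambda>l. gradl l n (u l)) \<longlonglongrightarrow> grad n x"
proof -
  have z: "dual_adjoint (L i x) (duality_map r (Y i) (F i x - y i)) = 0" if "i \<in> I n" "res x i = 0" for i
    using J_facts(5)[OF I_D[OF that(1)] x_ball] that by simp
  have e: "grad n x = (\<Sum>i\<in>I n. dual_adjoint (L i x) (duality_map r (Y i) (F i x - y i)))"
    unfolding grad_def by (rule sum_over_\<Gamma>) (rule z)
  show ?thesis
    unfolding e heavy_ball.grad_def[of _ _ _ _ _ "yd _"] sum_over_\<Gamma>l
  proof (intro tendsto_sum tendsto_if_eventually adjoint_term_tendsto[OF I_D])
    fix i assume i: "i \<in> I n" "dual_adjoint (L i x) (duality_map r (Y i) (F i x - y i)) \<noteq> 0"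
    then show "\<forall>\<^sub>F l in sequentially. \<tau> * \<delta> l i < resl l (u l) i"
      using discrepancy_eventually[OF I_D[OF i(1)]] z by blast
  qed
qed

lemma \<Phi>_\<Psi>_tendsto: "(\<lambda>l. \<Phi>l l n (u l)) \<longlonglongrightarrow> \<Phi> n x" "(\<lambda>l. \<Psi>l l n (u l)) \<longlonglongrightarrow> \<Psi> n x"
proof -
  have p: "(\<lambda>l. resl l (u l) i powr s) \<longlonglongrightarrow> res x i powr s" if "i \<in> I n" "0 < s" for i s
    using residual_tendsto(2)[OF I_D[OF that(1)]] that(2)
    by (intro tendsto_powr') (auto simp: heavy_ball.res_def)
  have z: "((1 - \<eta>) * res x i - (1 + \<eta>) * 0) * res x i powr (r - 1) = 0" "res x i powr r = 0"
    if "res x i = 0" for i using that by auto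
  have e: "\<Phi> n x = (\<Sum>i\<in>I n. ((1 - \<eta>) * res x i - (1 + \<eta>) * 0) * res x i powr (r - 1))"
    "\<Psi> n x = (\<Sum>i\<in>I n. res x i powr r)"
    unfolding \<Phi>_def \<Psi>_def by (rule sum_over_\<Gamma>, erule z)+
  show "(\<lambda>l. \<Phi>l l n (u l)) \<longlonglongrightarrow> \<Phi> n x"
    unfolding e heavy_ball.\<Phi>_def[of _ _ _ _ "yd _"] sum_over_\<Gamma>l
  proof (intro tendsto_sum tendsto_if_eventually)
    fix i assume i: "i \<in> I n"
    show "(\<lambda>l. ((1 - \<eta>) * resl l (u l) i - (1 + \<eta>) * \<delta> l i) * resl l (u l) i powr (r - 1))
        \<longlonglongrightarrow> ((1 - \<eta>) * res x i - (1 + \<eta>) * 0) * res x i powr (r - 1)"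
      using r by (intro tendsto_intros residual_tendsto(2)[OF I_D[OF i]] \<delta>_tendsto[OF I_D[OF i]] p[OF i]) simp
    show "\<forall>\<^sub>F l in sequentially. \<tau> * \<delta> l i < resl l (u l) i"
      if "((1 - \<eta>) * res x i - (1 + \<eta>) * 0) * res x i powr (r - 1) \<noteq> 0"
      using discrepancy_eventually[OF I_D[OF i]] z(1)[of i] that by blast
  qed
  show "(\<lambda>l. \<Psi>l l n (u l)) \<longlonglongrightarrow> \<Psi> n x"
    unfolding e heavy_ball.\<Psi>_def[of _ _ _ "yd _"] sum_over_\<Gamma>l
  proof (intro tendsto_sum tendsto_if_eventually)
    fix i assume i: "i \<in> I n"
    show "(\<lambda>l. resl l (u l) i powr r) \<longlonglongrightarrow> res x i powr r" using p[OF i] r by simp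
    show "\<forall>\<^sub>F l in sequentially. \<tau> * \<delta> l i < resl l (u l) i" if "res x i powr r \<noteq> 0"
      using discrepancy_eventually[OF I_D[OF i]] z(2)[of i] that by blast
  qed
qed

text \<open>If the exact index set is empty the step size may diverge, but the products tend to \<open>0\<close> because
they are bounded by powers of \<open>\<Psi>\<close> with positive exponents.\<close>

lemma step_tendsto:
  "(\<lambda>l. stepl l n (u l) *\<^sub>R gradl l n (u l)) \<longlonglongrightarrow> stepsize n x *\<^sub>R grad n x"
  "(\<lambda>l. stepl l n (u l) * \<Phi>l l n (u l)) \<longlonglongrightarrow> stepsize n x * \<Phi> n x"
proof -
  have "(\<lambda>l. stepl l n (u l) *\<^sub>R gradl l n (u l)) \<longlonglongrightarrow> stepsize n x *\<^sub>R grad n x \<and>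
    (\<lambda>l. stepl l n (u l) * \<Phi>l l n (u l)) \<longlonglongrightarrow> stepsize n x * \<Phi> n x"
  proof (cases "\<Gamma> n x = {}")
    case True
    have "(\<lambda>l. \<Psi>l l n (u l) powr s) \<longlonglongrightarrow> \<Psi> n x powr s" if "0 < s" for s
      using \<Phi>_\<Psi>_tendsto(2)[of n] that hb_run.\<Psi>_nonneg[OF run] by (intro tendsto_powr') auto
    then have P: "(\<lambda>l. \<Psi>l l n (u l) powr s) \<longlonglongrightarrow> 0" if "0 < s" for s
      using that stepsize_empty(3)[OF True] by fastforce
    have "(\<lambda>l. \<mu>1 * B0 * N * \<Psi>l l n (u l) powr (1 / r)) \<longlonglongrightarrow> 0"
      using r by (intro tendsto_mult_right_zero P) simp
    then have 1: "(\<lambda>l. stepl l n (u l) *\<^sub>R gradl l n (u l)) \<longlonglongrightarrow> 0"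
      by (rule tendsto_null_bound[OF hb_run.stepsize_grad_le[OF run u(1)]])
    have "(\<lambda>l. \<mu>1 * \<Psi>l l n (u l) powr (2 / r)) \<longlonglongrightarrow> 0"
      using r by (intro tendsto_mult_right_zero P) simp
    moreover have "norm (stepl l n (u l) * \<Phi>l l n (u l)) \<le> \<mu>1 * \<Psi>l l n (u l) powr (2 / r)" for l
      using hb_run.stepsize_\<Phi>_le[OF run, of l n "u l"]
        mult_nonneg_nonneg[OF hb_run.stepsize_nonneg[OF run] hb_run.\<Phi>_nonneg[OF run], of l n "u l" l n "u l"]
      by simp
    ultimately have 2: "(\<lambda>l. stepl l n (u l) * \<Phi>l l n (u l)) \<longlonglongrightarrow> 0"
      by (rule tendsto_null_bound[rotated])
    show ?thesis using 1 2 stepsize_empty[OF True] by simp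
  next
    case False
    have P: "0 < \<Psi> n x" by (rule \<Psi>_pos[OF False])
    have g: "grad n x \<noteq> 0" by (rule grad_nonzero[OF x_ball False])
    have "(\<lambda>l. min (\<mu>0 * \<Phi>l l n (u l) / (norm (gradl l n (u l)))\<^sup>2) (\<mu>1 * \<Psi>l l n (u l) powr (2 / r - 1)))
      \<longlonglongrightarrow> min (\<mu>0 * \<Phi> n x / (norm (grad n x))\<^sup>2) (\<mu>1 * \<Psi> n x powr (2 / r - 1))"
      using P g by (intro tendsto_intros grad_tendsto \<Phi>_\<Psi>_tendsto) auto
    moreover have "\<forall>\<^sub>F l in sequentially. min (\<mu>0 * \<Phi>l l n (u l) / (norm (gradl l n (u l)))\<^sup>2)
        (\<mu>1 * \<Psi>l l n (u l) powr (2 / r - 1)) = stepl l n (u l)"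
      using order_tendstoD(1)[OF \<Phi>_\<Psi>_tendsto(2) P]
    proof eventually_elim
      case (elim l)
      then have "\<Gamma>l l n (u l) \<noteq> {}" by (auto simp: heavy_ball.\<Psi>_def)
      then show ?case by (simp add: heavy_ball.stepsize_def)
    qed
    ultimately have "(\<lambda>l. stepl l n (u l)) \<longlonglongrightarrow> min (\<mu>0 * \<Phi> n x / (norm (grad n x))\<^sup>2) (\<mu>1 * \<Psi> n x powr (2 / r - 1))"
      by (rule Lim_transform_eventually)
    also have "min (\<mu>0 * \<Phi> n x / (norm (grad n x))\<^sup>2) (\<mu>1 * \<Psi> n x powr (2 / r - 1)) = stepsize n x"
      using False by (simp add: stepsize_def)
    finally show ?thesis by (intro conjI tendsto_intros grad_tendsto \<Phi>_\<Psi>_tendsto)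
  qed
  then show "(\<lambda>l. stepl l n (u l) *\<^sub>R gradl l n (u l)) \<longlonglongrightarrow> stepsize n x *\<^sub>R grad n x"
    "(\<lambda>l. stepl l n (u l) * \<Phi>l l n (u l)) \<longlonglongrightarrow> stepsize n x * \<Phi> n x" by auto
qed

end

abbreviation "ql l n \<equiv> gaml l n - stepl l n (xl l n) / (2 * \<sigma>) * (gradl l n (xl l n) \<bullet> moml l n)"

lemmas bet_alt_l = hb_run.bet_alt[OF run, unfolded hb_run.q_def[OF run]]
lemmas bet_facts_l = hb_run.bet_facts[OF run, unfolded hb_run.q_def[OF run]]

text \<open>Where the exact momentum vanishes the noisy parameters may oscillate. Their products with
the momentum still tend to \<open>0\<close>, and so do those with \<open>\<gamma>\<close>: when the parameter is nonzero,
\<open>\<gamma>\<close> is bounded below by the inner product that it dominates and above by the sign condition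
\<open>q \<le> 0\<close>, and both bounds vanish with the momentum.\<close>

lemma momentum_tendsto:
  assumes x: "(\<lambda>l. xl l n) \<longlonglongrightarrow> x_it n" and m: "(\<lambda>l. moml l n) \<longlonglongrightarrow> m n" and gm: "(\<lambda>l. gaml l n) \<longlonglongrightarrow> gm n"
  shows "(\<lambda>l. betl l n *\<^sub>R moml l n) \<longlonglongrightarrow> bt n *\<^sub>R m n \<and> (\<lambda>l. betl l n * gaml l n) \<longlonglongrightarrow> bt n * gm n"
proof -
  note ball = hb_run.x_in_ball[OF run]
  define p where "p l = stepl l n (xl l n) *\<^sub>R gradl l n (xl l n)" for l
  have p: "p \<longlonglongrightarrow> t n *\<^sub>R g n" unfolding p_def by (rule step_tendsto(1)[OF ball x])
  have ql: "ql l n = gaml l n - (p l \<bullet> moml l n) / (2 * \<sigma>)" for l by (simp add: p_def)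
  have q: "q n = gm n - ((t n *\<^sub>R g n) \<bullet> m n) / (2 * \<sigma>)" by (simp add: q_def)
  have qlim: "(\<lambda>l. ql l n) \<longlonglongrightarrow> q n"
    unfolding ql q using \<sigma> by (intro tendsto_intros gm p m) auto
  show ?thesis
  proof (cases "m n = 0")
    case True
    have nm: "(\<lambda>l. norm (moml l n)) \<longlonglongrightarrow> 0" using m True by (simp add: tendsto_norm_zero)
    have b1: "betl l n \<le> 1" for l using bet_facts_l(2)[of l n] \<beta> by linarith
    have "bt n = 0" by (simp add: bet_alt True) (use \<beta> in simp)
    have 1: "(\<lambda>l. betl l n *\<^sub>R moml l n) \<longlonglongrightarrow> 0"
    proof (rule tendsto_null_bound[OF _ nm])
      show "norm (betl l n *\<^sub>R moml l n) \<le> norm (moml l n)" for l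
        using mult_right_mono[OF b1[of l], of "norm (moml l n)"] bet_facts_l(1)[of l n] by simp
    qed
    obtain xh where xh: "xh \<in> Sol" using Sol_near by blast
    have 2: "(\<lambda>l. betl l n * gaml l n) \<longlonglongrightarrow> 0"
    proof (rule tendsto_null_bound)
      have "(\<lambda>l. norm (moml l n) * (4 * \<rho>) + \<bar>(p l \<bullet> moml l n) / (2 * \<sigma>)\<bar>)
          \<longlonglongrightarrow> 0 * (4 * \<rho>) + \<bar>((t n *\<^sub>R g n) \<bullet> m n) / (2 * \<sigma>)\<bar>"
        using \<sigma> by (intro tendsto_intros nm p m) auto
      then show "(\<lambda>l. norm (moml l n) * (4 * \<rho>) + \<bar>(p l \<bullet> moml l n) / (2 * \<sigma>)\<bar>) \<longlonglongrightarrow> 0"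
        by (simp add: True)
      fix l
      show "norm (betl l n * gaml l n) \<le> norm (moml l n) * (4 * \<rho>) + \<bar>(p l \<bullet> moml l n) / (2 * \<sigma>)\<bar>"
      proof (cases "betl l n = 0")
        case False
        then have up: "gaml l n \<le> (p l \<bullet> moml l n) / (2 * \<sigma>)" using bet_facts_l(3) ql by fastforce
        have "norm (xl l n - xh) \<le> 4 * \<rho>"
          using ball[of l n] Sol_D(1)[OF xh] dist_triangle3[of "xl l n" xh x0]
          unfolding mem_cball dist_norm[of "xl l n" xh] by linarith
        then have "norm (moml l n) * norm (xl l n - xh) \<le> norm (moml l n) * (4 * \<rho>)"
          by (intro mult_left_mono) auto
        moreover have "- (norm (moml l n) * norm (xl l n - xh)) \<le> moml l n \<bullet> (xl l n - xh)"
          using Cauchy_Schwarz_ineq2[of "moml l n" "xl l n - xh"] by linarith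
        ultimately have "- (norm (moml l n) * (4 * \<rho>)) \<le> gaml l n"
          using hb_run.momentum_bound[OF run xh, of l n] by linarith
        then have "\<bar>gaml l n\<bar> \<le> norm (moml l n) * (4 * \<rho>) + \<bar>(p l \<bullet> moml l n) / (2 * \<sigma>)\<bar>"
        proof -
          have "0 \<le> norm (moml l n) * (4 * \<rho>)" using \<rho> by simp
          moreover have "(p l \<bullet> moml l n) / (2 * \<sigma>) \<le> \<bar>(p l \<bullet> moml l n) / (2 * \<sigma>)\<bar>"
            by (rule abs_ge_self)
          moreover have "0 \<le> \<bar>(p l \<bullet> moml l n) / (2 * \<sigma>)\<bar>" by (rule abs_ge_zero)
          ultimately show ?thesis using up \<open>- (norm (moml l n) * (4 * \<rho>)) \<le> gaml l n\<close> by linarith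
        qed
        moreover have "\<bar>betl l n\<bar> * \<bar>gaml l n\<bar> \<le> 1 * \<bar>gaml l n\<bar>"
          using b1[of l] bet_facts_l(1)[of l n] by (intro mult_right_mono) auto
        ultimately show ?thesis by (simp add: abs_mult)
      qed (use \<rho> in simp)
    qed
    show ?thesis using 1 2 \<open>bt n = 0\<close> by simp
  next
    case False
    have nm: "(\<lambda>l. norm (moml l n)) \<longlonglongrightarrow> norm (m n)" using m by (rule tendsto_norm)
    have lim: "(\<lambda>l. - 2 * \<sigma> * ql l n / (norm (moml l n))\<^sup>2) \<longlonglongrightarrow> - 2 * \<sigma> * q n / (norm (m n))\<^sup>2"
      using False by (intro tendsto_intros qlim nm) auto
    have "(\<lambda>l. betl l n) \<longlonglongrightarrow> bt n"
    proof (cases "q n < 0")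
      case True
      have b: "bt n = min (- 2 * \<sigma> * q n / (norm (m n))\<^sup>2) \<beta>"
        using True by (simp add: bet_alt exact_\<delta>min)
      have "(\<lambda>l. \<upsilon>0 * \<delta>minl l - norm (moml l n)) \<longlonglongrightarrow> \<upsilon>0 * 0 - norm (m n)"
        by (intro tendsto_intros \<delta>min_tendsto nm)
      then have e1: "\<forall>\<^sub>F l in sequentially. \<upsilon>0 * \<delta>minl l - norm (moml l n) < 0"
        using False by (intro order_tendstoD(2)) auto
      have "(\<lambda>l. ql l n + \<upsilon>1 * \<delta>minl l * (norm (moml l n))\<^sup>2) \<longlonglongrightarrow> q n + \<upsilon>1 * 0 * (norm (m n))\<^sup>2"
        by (intro tendsto_intros \<delta>min_tendsto nm qlim)
      then have e2: "\<forall>\<^sub>F l in sequentially. ql l n + \<upsilon>1 * \<delta>minl l * (norm (moml l n))\<^sup>2 < 0"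
        using True by (intro order_tendstoD(2)) auto
      have "\<forall>\<^sub>F l in sequentially. min (- 2 * \<sigma> * ql l n / (norm (moml l n))\<^sup>2) \<beta> = betl l n"
        using e1 e2
      proof eventually_elim
        case (elim l)
        then have "\<upsilon>0 * \<delta>minl l \<le> norm (moml l n) \<and> ql l n \<le> - \<upsilon>1 * \<delta>minl l * (norm (moml l n))\<^sup>2"
          by simp
        then show ?case unfolding bet_alt_l by (simp only: if_True simp_thms)
      qed
      moreover have "(\<lambda>l. min (- 2 * \<sigma> * ql l n / (norm (moml l n))\<^sup>2) \<beta>) \<longlonglongrightarrow> bt n"
        unfolding b by (intro tendsto_min lim tendsto_const)
      ultimately show ?thesis by (rule Lim_transform_eventually[rotated])
    next
      case qn: False
      have b: "bt n = 0"
        using qn \<beta> by (auto simp: bet_alt exact_\<delta>min)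
      have "(\<lambda>l. max 0 (- 2 * \<sigma> * ql l n / (norm (moml l n))\<^sup>2)) \<longlonglongrightarrow> max 0 (- 2 * \<sigma> * q n / (norm (m n))\<^sup>2)"
        by (intro tendsto_max lim tendsto_const)
      moreover have "- 2 * \<sigma> * q n / (norm (m n))\<^sup>2 \<le> 0"
        using qn \<sigma> by (intro divide_nonpos_nonneg) (auto simp: mult_nonneg_nonneg)
      ultimately have "(\<lambda>l. max 0 (- 2 * \<sigma> * ql l n / (norm (moml l n))\<^sup>2)) \<longlonglongrightarrow> 0"
        by (simp only: max_absorb1)
      moreover have "norm (betl l n) \<le> max 0 (- 2 * \<sigma> * ql l n / (norm (moml l n))\<^sup>2)" for l
      proof -
        have "betl l n \<le> max 0 (- 2 * \<sigma> * ql l n / (norm (moml l n))\<^sup>2)"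
          unfolding bet_alt_l by (simp only: split: if_split) (simp add: min_le_iff_disj)
        then show ?thesis using bet_facts_l(1)[of l n] by simp
      qed
      ultimately show ?thesis unfolding b by (rule tendsto_null_bound[rotated])
    qed
    then show ?thesis by (intro conjI tendsto_intros m gm)
  qed
qed

lemmas recursion_l = heavy_ball.state_recursion[of \<Theta> Y F L N x0 \<xi>0 \<eta> \<sigma> r \<mu>0 \<mu>1 \<upsilon>0 \<upsilon>1 \<beta> \<tau> "yd l" "\<delta> l" I for l]

text \<open>The induction carries the convergence of \<open>\<xi>\<close>, of the momentum and of \<open>\<gamma>\<close>, but not that of the momentum
parameter, which may fail.\<close>

lemma stability:
  "(\<lambda>l. xil l n) \<longlonglongrightarrow> xi_it n" "(\<lambda>l. xl l n) \<longlonglongrightarrow> x_it n"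
proof -
  have X: "(\<lambda>l. xl l n) \<longlonglongrightarrow> x_it n" if "(\<lambda>l. xil l n) \<longlonglongrightarrow> xi_it n" for n
  proof -
    have "(\<lambda>l. xl l n - x_it n) \<longlonglongrightarrow> 0"
    proof (rule tendsto_null_bound)
      have "(\<lambda>l. norm (xil l n - xi_it n)) \<longlonglongrightarrow> 0" using that by (simp add: tendsto_norm_zero LIM_zero)
      then show "(\<lambda>l. norm (xil l n - xi_it n) / (2 * \<sigma>)) \<longlonglongrightarrow> 0" by (rule tendsto_divide_zero)
      show "norm (xl l n - x_it n) \<le> norm (xil l n - xi_it n) / (2 * \<sigma>)" for l
        using subgradient_monotone[OF hb_run.x_subdiff[OF run, of l n] x_subdiff[of n]] \<sigma> by (simp add: field_simps)
    qed
    then show ?thesis by (rule LIM_zero_cancel)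
  qed
  have "(\<lambda>l. xil l n) \<longlonglongrightarrow> xi_it n \<and> (\<lambda>l. moml l n) \<longlonglongrightarrow> m n \<and> (\<lambda>l. gaml l n) \<longlonglongrightarrow> gm n"
  proof (induction n)
    case 0
    have "moml l 0 = 0" for l using hb_run.mom_0[OF run] .
    then show ?case by (simp add: recursion_l(2,3) state_recursion(2,3) mom_0)
  next
    case (Suc n)
    then have xi: "(\<lambda>l. xil l n) \<longlonglongrightarrow> xi_it n" and m: "(\<lambda>l. moml l n) \<longlonglongrightarrow> m n"
      and gm: "(\<lambda>l. gaml l n) \<longlonglongrightarrow> gm n" by auto
    note x = X[OF xi]
    note b = momentum_tendsto[OF x m gm]
    note s = step_tendsto[OF hb_run.x_in_ball[OF run] x]
    have xi': "(\<lambda>l. xil l (Suc n)) \<longlonglongrightarrow> xi_it (Suc n)"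
      unfolding recursion_l(7) state_recursion(7) by (intro tendsto_add tendsto_diff xi s b[THEN conjunct1])
    have m': "(\<lambda>l. moml l (Suc n)) \<longlonglongrightarrow> m (Suc n)"
      unfolding recursion_l(5) state_recursion(5) by (intro tendsto_diff xi xi')
    have "(\<lambda>l. gaml l (Suc n)) \<longlonglongrightarrow> gm (Suc n)"
      unfolding recursion_l(6) state_recursion(6)
      by (intro tendsto_add tendsto_diff tendsto_inner m' X[OF xi'] x s b[THEN conjunct2])
    then show ?case using xi' m' by blast
  qed
  then show "(\<lambda>l. xil l n) \<longlonglongrightarrow> xi_it n" "(\<lambda>l. xl l n) \<longlonglongrightarrow> x_it n" using X by auto
qed

text \<open>The penalty need not be continuous, but its values at the iterates converge, squeezed between the
two subgradient inequalities.\<close>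

lemma D_stability:
  "(\<lambda>l. D (xil l n) z (xl l n)) \<longlonglongrightarrow> D (xi_it n) z (x_it n)"
proof -
  have "(\<lambda>l. \<theta> (xl l n)) \<longlonglongrightarrow> \<theta> (x_it n)"
  proof (rule tendsto_sandwich)
    show "\<forall>\<^sub>F l in sequentially. \<theta> (x_it n) + xi_it n \<bullet> (xl l n - x_it n) \<le> \<theta> (xl l n)"
    proof (intro always_eventually allI)
      show "\<theta> (x_it n) + xi_it n \<bullet> (xl l n - x_it n) \<le> \<theta> (xl l n)" for l
        using D_nonneg[OF x_subdiff hb_run.x_edom[OF run], of n l n] by (simp add: D_def)
    qed
    show "\<forall>\<^sub>F l in sequentially. \<theta> (xl l n) \<le> \<theta> (x_it n) - xil l n \<bullet> (x_it n - xl l n)"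
    proof (intro always_eventually allI)
      show "\<theta> (xl l n) \<le> \<theta> (x_it n) - xil l n \<bullet> (x_it n - xl l n)" for l
        using D_nonneg[OF hb_run.x_subdiff[OF run] x_edom, of l n n] by (simp add: D_def)
    qed
    have "(\<lambda>l. \<theta> (x_it n) + xi_it n \<bullet> (xl l n - x_it n)) \<longlonglongrightarrow> \<theta> (x_it n) + xi_it n \<bullet> (x_it n - x_it n)"
      by (intro tendsto_intros stability)
    then show "(\<lambda>l. \<theta> (x_it n) + xi_it n \<bullet> (xl l n - x_it n)) \<longlonglongrightarrow> \<theta> (x_it n)" by simp
    have "(\<lambda>l. \<theta> (x_it n) - xil l n \<bullet> (x_it n - xl l n)) \<longlonglongrightarrow> \<theta> (x_it n) - xi_it n \<bullet> (x_it n - x_it n)"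
      by (intro tendsto_intros stability)
    then show "(\<lambda>l. \<theta> (x_it n) - xil l n \<bullet> (x_it n - xl l n)) \<longlonglongrightarrow> \<theta> (x_it n)" by simp
  qed
  then show ?thesis unfolding D_def by (intro tendsto_intros stability)
qed

abbreviation "stopl l \<equiv> heavy_ball.stop_index \<Theta> Y F L N x0 \<xi>0 \<eta> \<sigma> r \<mu>0 \<mu>1 \<upsilon>0 \<upsilon>1 \<beta> \<tau> (yd l) (\<delta> l) I"

text \<open>A run cannot stop at \<open>n\<close> for arbitrarily small noise unless the exact iterate \<open>x(n)\<close> is a solution,
because stopping bounds all residuals by the noise. Late stopping is covered by monotonicity.\<close>

lemma D_stopped_tendsto:
  assumes fin: "\<And>l. stopl l < \<infinity>" and xs: "xs \<in> Sol" and lim: "x_it \<longlonglongrightarrow> xs"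
    and D0: "(\<lambda>n. D (xi_it n) xs (x_it n)) \<longlonglongrightarrow> 0"
  shows "(\<lambda>l. D (xil l (the_enat (stopl l))) xs (xl l (the_enat (stopl l)))) \<longlonglongrightarrow> 0"
proof -
  define nl where "nl l = the_enat (stopl l)" for l
  have nn: "0 \<le> D (xil l n) xs (xl l n)" for l n
    by (rule D_nonneg[OF hb_run.x_subdiff[OF run] Sol_D(2)[OF xs]])
  have "\<forall>\<^sub>F l in sequentially. D (xil l (nl l)) xs (xl l (nl l)) < e" if e: "0 < e" for e
  proof -
    have "\<forall>\<^sub>F n in sequentially. D (xi_it n) xs (x_it n) < e" using D0 e by (rule order_tendstoD(2))
    then obtain k where k: "D (xi_it k) xs (x_it k) < e" by (auto simp: eventually_sequentially)
    have late: "\<forall>\<^sub>F l in sequentially. D (xil l k) xs (xl l k) < e"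
      using D_stability k by (rule order_tendstoD(2))
    have early: "\<forall>\<^sub>F l in sequentially. nl l = n \<longrightarrow> D (xil l n) xs (xl l n) < e" for n
    proof (cases "x_it n \<in> Sol")
      case True
      have D_le: "D (xi_it j) (x_it n) (x_it j) \<le> 0" if "n \<le> j" for j
        using D_antimono[OF that True] by (simp add: D_def)
      have stay: "x_it j = x_it n" if "n \<le> j" for j
      proof -
        have "\<sigma> * (norm (x_it n - x_it j))\<^sup>2 \<le> 0"
          using D_ge[OF x_subdiff x_edom, of n j] D_le[OF that]
          by linarith
        then show ?thesis using \<sigma> by (simp add: mult_le_0_iff)
      qed
      have "\<forall>\<^sub>F j in sequentially. x_it j = x_it n"
        by (rule eventually_sequentiallyI[of n]) (rule stay)
      then have "x_it \<longlonglongrightarrow> x_it n" by (rule tendsto_eventually)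
      then have "xs = x_it n" using lim LIMSEQ_unique by blast
      then have "D (xi_it n) xs (x_it n) = 0" by (simp add: D_def)
      then have "\<forall>\<^sub>F l in sequentially. D (xil l n) xs (xl l n) < e"
        using order_tendstoD(2)[OF D_stability[of n xs]] e by simp
      then show ?thesis by eventually_elim simp
    next
      case False
      then obtain i where i: "i \<in> {1..N}" "F i (x_it n) \<noteq> y i"
        using x_in_ball x_edom by (auto simp: Sol_def)
      have "\<forall>\<^sub>F l in sequentially. \<tau> * \<delta> l i < resl l (xl l n) i"
        using i by (intro discrepancy_eventually[OF hb_run.x_in_ball[OF run] stability(2)]) (auto simp: res_def)
      then show ?thesis
      proof eventually_elim
        case (elim l)
        have "nl l \<noteq> n"
        proof
          assume "nl l = n"
          have "active (statel l n) = {}"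
            using hb_run.stop_index_finite(2)[OF run fin[of l]] \<open>nl l = n\<close> by (simp add: nl_def)
          then have "resl l (xl l n) i \<le> \<tau> * \<delta> l i"
            using hb_run.inactive_residual[OF run i(1), of l n] by simp
          then show False using elim by simp
        qed
        then show ?case by simp
      qed
    qed
    have "\<forall>\<^sub>F l in sequentially. \<forall>n\<in>{..<k}. nl l = n \<longrightarrow> D (xil l n) xs (xl l n) < e"
      by (rule eventually_ball_finite[OF finite_lessThan ballI[OF early]])
    then show ?thesis using late
    proof eventually_elim
      case (elim l)
      show ?case
      proof (cases "nl l < k")
        case True
        then show ?thesis using elim by auto
      next
        case False
        then have "D (xil l (nl l)) xs (xl l (nl l)) \<le> D (xil l k) xs (xl l k)"
          by (intro hb_run.D_antimono[OF run _ xs]) simp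
        then show ?thesis using elim by linarith
      qed
    qed
  qed
  then show ?thesis
    unfolding nl_def[symmetric] by (intro order_tendstoI) (auto intro: always_eventually less_le_trans nn)
qed

end

section \<open>Random batches\<close>

text \<open>The state at \<open>n\<close> is a function of the first \<open>n\<close> batches: the source of its measurability and of
its independence of \<open>I n\<close>.\<close>

lemma (in heavy_ball) state_cong:
  assumes "\<And>k. k < n \<Longrightarrow> I k = I' k"
  shows "heavy_ball.state \<Theta> Y F L N x0 \<xi>0 \<eta> \<sigma> r \<mu>0 \<mu>1 \<upsilon>0 \<upsilon>1 \<beta> \<tau> yd \<delta> I' n = state n"
  using assms
proof (induction n)
  case 0
  then show ?case by (simp add: heavy_ball.state.simps)
next
  case (Suc n)
  have G: "heavy_ball.\<Gamma> F \<tau> yd \<delta> I' n = \<Gamma> n"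
    using Suc.prems[of n] by (simp add: heavy_ball.\<Gamma>_def[abs_def])
  have g: "heavy_ball.grad Y F L r \<tau> yd \<delta> I' n = grad n" "heavy_ball.\<Phi> F \<eta> r \<tau> yd \<delta> I' n = \<Phi> n"
    "heavy_ball.\<Psi> F r \<tau> yd \<delta> I' n = \<Psi> n"
    by (simp_all add: heavy_ball.grad_def[abs_def] heavy_ball.\<Phi>_def[abs_def] heavy_ball.\<Psi>_def[abs_def] G)
  have s: "heavy_ball.stepsize Y F L \<eta> r \<mu>0 \<mu>1 \<tau> yd \<delta> I' n = stepsize n"
    unfolding heavy_ball.stepsize_def[abs_def] G g ..
  have b: "heavy_ball.bet Y F L N \<eta> \<sigma> r \<mu>0 \<mu>1 \<upsilon>0 \<upsilon>1 \<beta> \<tau> yd \<delta> I' n = bet n"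
    by (simp add: heavy_ball.bet_def[abs_def] g s)
  have "heavy_ball.xi_next Y F L N \<eta> \<sigma> r \<mu>0 \<mu>1 \<upsilon>0 \<upsilon>1 \<beta> \<tau> yd \<delta> I' n = xi_next n"
    by (simp add: heavy_ball.xi_next_def[abs_def] g s b)
  then show ?case
    using Suc by (simp add: heavy_ball.state.simps Let_def G g s b)
qed

locale random_batches = prob_space M for M :: "'w measure" +
  fixes N b :: nat and I :: "nat \<Rightarrow> 'w \<Rightarrow> nat set"
  assumes b: "1 \<le> b" "b \<le> N" and iid: "uniform_iid_batches M N b I"
begin

abbreviation "B \<equiv> batches N b"

lemma finite_B: "finite B"
  by (rule finite_subset[of _ "Pow {1..N}"]) (auto simp: batches_def)

lemma batch_containing: assumes "i \<in> {1..N}" obtains S where "S \<in> B" "i \<in> S"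
proof -
  have "b - 1 \<le> card ({1..N} - {i})" using assms b by simp
  then obtain T where T: "T \<subseteq> {1..N} - {i}" "card T = b - 1"
    using obtain_subset_with_card_n by metis
  have fT: "finite T" using T(1) by (rule finite_subset) simp
  have "card (insert i T) = b" using T fT b by (subst card_insert_disjoint) auto
  then have "insert i T \<in> B" using T assms by (auto simp: batches_def)
  then show ?thesis using that by blast
qed

lemma card_B: "0 < card B"
proof -
  obtain S where "S \<in> B" using batch_containing[of 1] b by auto
  then show ?thesis using finite_B by (auto simp: card_gt_0_iff)
qed

lemma indep: "indep_vars (\<lambda>_. count_space B) I UNIV"
  using iid by (simp add: uniform_iid_batches_def)

lemma I_measurable: "I n \<in> measurable M (count_space B)"
  using indep by (auto simp: indep_vars_def)

lemma I_in_B: "\<omega> \<in> space M \<Longrightarrow> I n \<omega> \<in> B"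
  using measurable_space[OF I_measurable] by fastforce

lemma I_subset: "\<omega> \<in> space M \<Longrightarrow> I n \<omega> \<subseteq> {1..N}"
  using I_in_B by (auto simp: batches_def)

text \<open>The probability of one particular batch, a lower bound for the probability that a batch
contains a given index.\<close>

definition p :: real where "p = 1 / card B"

lemma p_pos: "0 < p" using card_B by (simp add: p_def)

lemma hit_measurable: "{\<omega> \<in> space M. i \<in> I n \<omega>} \<in> events"
proof -
  have "I n -` {S \<in> B. i \<in> S} \<inter> space M \<in> events"
    by (rule measurable_sets[OF I_measurable]) auto
  also have "I n -` {S \<in> B. i \<in> S} \<inter> space M = {\<omega> \<in> space M. i \<in> I n \<omega>}"
    using I_in_B by auto
  finally show ?thesis .
qed

lemma hit_prob:
  assumes "i \<in> {1..N}"
  shows "p \<le> prob {\<omega> \<in> space M. i \<in> I n \<omega>}"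
proof -
  obtain S where S: "S \<in> B" "i \<in> S" using batch_containing assms by blast
  have "measure (uniform_count_measure B) {S} = p"
    using S finite_B by (subst measure_uniform_count_measure) (auto simp: p_def)
  then have "p = measure (distr M (count_space B) (I n)) {S}"
    using iid by (simp add: uniform_iid_batches_def)
  also have "\<dots> = prob (I n -` {S} \<inter> space M)"
    using S by (subst measure_distr[OF I_measurable]) auto
  also have "\<dots> \<le> prob {\<omega> \<in> space M. i \<in> I n \<omega>}"
    using S hit_measurable by (intro finite_measure_mono) auto
  finally show ?thesis .
qed

lemma hit_infinitely_often: "AE \<omega> in M. \<forall>i\<in>{1..N}. \<forall>n. \<exists>k\<ge>n. i \<in> I k \<omega>"
proof -
  have "AE \<omega> in M. \<exists>k\<ge>n. i \<in> I k \<omega>" if i: "i \<in> {1..N}" for i n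
  proof -
    define E where "E = {\<omega> \<in> space M. \<forall>k\<ge>n. i \<notin> I k \<omega>}"
    have E: "E = space M - (\<Union>k\<in>{n..}. {\<omega> \<in> space M. i \<in> I k \<omega>})" by (auto simp: E_def)
    have Em: "E \<in> events" unfolding E using hit_measurable by (intro sets.Diff sets.countable_UN') auto
    have bound: "prob E \<le> (1 - p) ^ m" for m
    proof (cases "m = 0")
      case False
      define A where "A = {S \<in> B. i \<notin> S}"
      have ev: "I k -` A \<inter> space M = space M - {\<omega> \<in> space M. i \<in> I k \<omega>}" for k
        using I_in_B by (auto simp: A_def)
      have "E \<subseteq> (\<Inter>k\<in>{n..<n+m}. I k -` A \<inter> space M)"
        using I_in_B False by (auto simp: E_def A_def)
      then have "prob E \<le> prob (\<Inter>k\<in>{n..<n+m}. I k -` A \<inter> space M)"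
        using False by (intro finite_measure_mono sets.finite_INT measurable_sets[OF I_measurable])
          (auto simp: A_def)
      also have "\<dots> = (\<Prod>k\<in>{n..<n+m}. prob (I k -` A \<inter> space M))"
        using False by (intro indep_varsD[OF indep]) (auto simp: A_def)
      also have "\<dots> \<le> (\<Prod>k\<in>{n..<n+m}. 1 - p)"
      proof (intro prod_mono conjI)
        fix k
        show "prob (I k -` A \<inter> space M) \<le> 1 - p"
          unfolding ev using hit_prob[OF i, of k] by (simp add: prob_compl[OF hit_measurable])
      qed simp
      finally show ?thesis by simp
    qed simp
    have p1: "0 \<le> 1 - p" using hit_prob[OF i, of 0] prob_le_1 by (smt (verit))
    have "(\<lambda>m. (1 - p) ^ m) \<longlonglongrightarrow> 0" using p_pos p1 by (intro LIMSEQ_power_zero) simp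
    then have "prob E \<le> 0" using bound by (intro LIMSEQ_le_const) auto
    then have "E \<in> null_sets M" using Em
      by (simp add: null_sets_def emeasure_eq_measure measure_le_0_iff)
    then show ?thesis by (rule AE_I') (auto simp: E_def)
  qed
  then have "AE \<omega> in M. \<forall>n. \<exists>k\<ge>n. i \<in> I k \<omega>" if "i \<in> {1..N}" for i
    using that by (simp add: AE_all_countable)
  then show ?thesis by (intro AE_finite_allI) auto
qed

definition depends_on_first :: "nat \<Rightarrow> ((nat \<Rightarrow> nat set) \<Rightarrow> 'c) \<Rightarrow> bool" where
  "depends_on_first n h \<longleftrightarrow> (\<forall>J J'. (\<forall>k<n. J k = J' k) \<longrightarrow> h J = h J')"

abbreviation past :: "nat \<Rightarrow> 'w \<Rightarrow> nat \<Rightarrow> nat set" where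
  "past n \<omega> \<equiv> restrict (\<lambda>k. I k \<omega>) {..<n}"

lemma past_PiM: "PiM {..<n::nat} (\<lambda>_. count_space B) = count_space (PiE {..<n} (\<lambda>_. B))"
  by (rule count_space_PiM_finite) (auto intro: countable_finite finite_B)

lemma past_measurable: "past n \<in> measurable M (count_space (PiE {..<n} (\<lambda>_. B)))"
  unfolding past_PiM[symmetric] by (intro measurable_restrict I_measurable)

lemma finite_pasts: "finite (PiE {..<n::nat} (\<lambda>_. B))"
  by (intro finite_PiE finite_B) simp

lemma depends_past: "depends_on_first n h \<Longrightarrow> h (past n \<omega>) = h (\<lambda>k. I k \<omega>)"
  unfolding depends_on_first_def by (metis lessThan_iff restrict_apply')

text \<open>The past takes finitely many values, so measurability holds although the iterates live
in a space that need not be separable.\<close>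

lemma batch_function_measurable:
  assumes f: "\<And>J. (\<lambda>\<omega>. f J \<omega>) \<in> measurable M K" and dep: "depends_on_first n f"
  shows "(\<lambda>\<omega>. f (\<lambda>k. I k \<omega>) \<omega>) \<in> measurable M K"
proof -
  have "(\<lambda>\<omega>. f (past n \<omega>) \<omega>) \<in> measurable M K"
    by (rule measurable_compose_countable'[OF f past_measurable countable_finite[OF finite_pasts]])
  then show ?thesis by (simp only: depends_past[OF dep])
qed

text \<open>The batch \<open>I n\<close> is independent of the first \<open>n\<close> batches, so the expectation factorises.\<close>

lemma hit_expectation:
  fixes f :: "(nat \<Rightarrow> nat set) \<Rightarrow> real"
  assumes dep: "depends_on_first n f" and f0: "\<And>J. 0 \<le> f J" and i: "i \<in> {1..N}"
  shows "ennreal p * (\<integral>\<^sup>+\<omega>. ennreal (f (\<lambda>k. I k \<omega>)) \<partial>M)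
    \<le> (\<integral>\<^sup>+\<omega>. ennreal (indicator (I n \<omega>) i * f (\<lambda>k. I k \<omega>)) \<partial>M)"
proof -
  let ?X = "\<lambda>\<omega>. indicator (I n \<omega>) i :: real" and ?Z = "\<lambda>\<omega>. f (\<lambda>k. I k \<omega>)"
  have ind: "indep_var (PiM {..<n} (\<lambda>_. count_space B)) (past n) (PiM {n} (\<lambda>_. count_space B)) (\<lambda>\<omega>. restrict (\<lambda>k. I k \<omega>) {n})"
    by (rule indep_var_restrict[OF indep]) auto
  have m1: "f \<in> measurable (PiM {..<n} (\<lambda>_. count_space B)) borel"
    unfolding past_PiM by simp
  have m2: "(\<lambda>J. indicator (J n) i :: real) \<in> measurable (PiM {n} (\<lambda>_. count_space B)) borel"
  proof -
    have "(\<lambda>J. J n) \<in> measurable (PiM {n} (\<lambda>_. count_space B)) (count_space B)"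
      by (rule measurable_component_singleton) simp
    then show ?thesis by (rule measurable_compose) simp
  qed
  have "indep_var borel (f \<circ> past n) borel ((\<lambda>J. indicator (J n) i :: real) \<circ> (\<lambda>\<omega>. restrict (\<lambda>k. I k \<omega>) {n}))"
    by (rule indep_var_compose[OF ind m1 m2])
  then have iv: "indep_var borel ?Z borel ?X"
    by (simp add: o_def depends_past[OF dep])
  define C where "C = Max (f ` PiE {..<n} (\<lambda>_. B))"
  have Zm: "?Z \<in> borel_measurable M" and Xm: "?X \<in> borel_measurable M"
    using iv unfolding indep_var_def indep_vars_def by (auto split: bool.splits) 
  have Zb: "?Z \<omega> \<le> C" if "\<omega> \<in> space M" for \<omega>
  proof -
    have "past n \<omega> \<in> PiE {..<n} (\<lambda>_. B)" using I_in_B[OF that] by auto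
    then have "f (past n \<omega>) \<le> C" unfolding C_def using finite_pasts by (intro Max_ge) auto
    then show ?thesis by (simp add: depends_past[OF dep])
  qed
  have Zi: "integrable M ?Z"
    by (rule integrable_const_bound[of _ C]) (use Zb f0 Zm in auto)
  have Xi: "integrable M ?X"
    by (rule integrable_const_bound[of _ 1]) (use Xm in \<open>auto simp: indicator_def\<close>)
  have XE: "expectation ?X = prob {\<omega> \<in> space M. i \<in> I n \<omega>}"
  proof -
    have "expectation ?X = expectation (indicator {\<omega> \<in> space M. i \<in> I n \<omega>})"
      by (intro Bochner_Integration.integral_cong) (auto simp: indicator_def)
    then show ?thesis using hit_measurable by simp
  qed
  have "p * expectation ?Z \<le> expectation ?X * expectation ?Z"
    unfolding XE using hit_prob[OF i] f0 by (intro mult_right_mono integral_nonneg_AE) auto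
  also have "\<dots> = expectation (\<lambda>\<omega>. ?Z \<omega> * ?X \<omega>)"
    using indep_var_lebesgue_integral[OF iv Zi Xi] by (simp add: mult.commute)
  finally have "ennreal (p * expectation ?Z) \<le> ennreal (expectation (\<lambda>\<omega>. ?Z \<omega> * ?X \<omega>))"
    by (rule ennreal_leI)
  also have "ennreal (expectation (\<lambda>\<omega>. ?Z \<omega> * ?X \<omega>)) = (\<integral>\<^sup>+\<omega>. ennreal (?Z \<omega> * ?X \<omega>) \<partial>M)"
    using f0 by (intro nn_integral_eq_integral[symmetric] indep_var_integrable[OF iv Zi Xi]) auto
  also have "ennreal (p * expectation ?Z) = ennreal p * (\<integral>\<^sup>+\<omega>. ennreal (?Z \<omega>) \<partial>M)"
    using p_pos f0 nn_integral_eq_integral[OF Zi] by (simp add: ennreal_mult integral_nonneg_AE)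
  finally show ?thesis by (simp add: mult.commute)
qed

end

section \<open>Convergence of the stopped iterates\<close>

locale random_problem =
  nonlinear_system \<Theta> Y domF F L y N x0 \<xi>0 \<sigma> \<rho> B0 \<eta> r \<mu>0 \<mu>1 \<upsilon>0 \<upsilon>1 \<beta> \<tau> +
  random_batches M N b I
  for \<Theta> :: "'x::{real_inner, banach} \<Rightarrow> ereal"
    and Y :: "nat \<Rightarrow> 'y::real_normed_vector set"
    and domF F L y N x0 \<xi>0 \<sigma> \<rho> B0 \<eta> r \<mu>0 \<mu>1 \<upsilon>0 \<upsilon>1 \<beta> \<tau> b
    and M :: "'w measure" and I +
  fixes yd :: "nat \<Rightarrow> nat \<Rightarrow> 'y" and \<delta> :: "nat \<Rightarrow> nat \<Rightarrow> real"
  assumes yd_range: "\<And>l i. i \<in> {1..N} \<Longrightarrow> yd l i \<in> Y i"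
    and noise: "\<And>l i. i \<in> {1..N} \<Longrightarrow> norm (yd l i - y i) \<le> \<delta> l i"
    and \<delta>_pos: "\<And>l i. i \<in> {1..N} \<Longrightarrow> \<delta> l i > 0"
    and \<delta>_tendsto: "\<And>i. i \<in> {1..N} \<Longrightarrow> (\<lambda>l. \<delta> l i) \<longlonglongrightarrow> 0"
begin

abbreviation "seq \<omega> \<equiv> (\<lambda>k. I k \<omega>)"
abbreviation "stt y' \<delta>' J \<equiv> heavy_ball.state \<Theta> Y F L N x0 \<xi>0 \<eta> \<sigma> r \<mu>0 \<mu>1 \<upsilon>0 \<upsilon>1 \<beta> \<tau> y' \<delta>' J"
abbreviation "xx y' \<delta>' J \<equiv> heavy_ball.x_it \<Theta> Y F L N x0 \<xi>0 \<eta> \<sigma> r \<mu>0 \<mu>1 \<upsilon>0 \<upsilon>1 \<beta> \<tau> y' \<delta>' J"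
abbreviation "xxi y' \<delta>' J \<equiv> heavy_ball.xi_it \<Theta> Y F L N x0 \<xi>0 \<eta> \<sigma> r \<mu>0 \<mu>1 \<upsilon>0 \<upsilon>1 \<beta> \<tau> y' \<delta>' J"
abbreviation "stop l J \<equiv> heavy_ball.stop_index \<Theta> Y F L N x0 \<xi>0 \<eta> \<sigma> r \<mu>0 \<mu>1 \<upsilon>0 \<upsilon>1 \<beta> \<tau> (yd l) (\<delta> l) J"
abbreviation "xe \<equiv> xx y (\<lambda>_. 0)"
abbreviation "sq J n i \<equiv> (heavy_ball.res F y (xe J n) i)\<^sup>2"

lemma noisy_run:
  "\<omega> \<in> space M \<Longrightarrow> hb_run \<Theta> Y domF F L y N x0 \<xi>0 \<sigma> \<rho> B0 \<eta> r \<mu>0 \<mu>1 \<upsilon>0 \<upsilon>1 \<beta> \<tau> (yd l) (\<delta> l) (seq \<omega>)"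
  using yd_range noise I_subset
  by (intro hb_run.intro nonlinear_system_axioms hb_run_axioms.intro) auto

lemma exact_run:
  "\<omega> \<in> space M \<Longrightarrow> exact_run \<Theta> Y domF F L y N x0 \<xi>0 \<sigma> \<rho> B0 \<eta> r \<mu>0 \<mu>1 \<upsilon>0 \<upsilon>1 \<beta> \<tau> (seq \<omega>)"
  using y_range I_subset
  by (intro exact_run.intro hb_run.intro nonlinear_system_axioms hb_run_axioms.intro) auto

lemmas exact_hb = exact_run[THEN exact_run.axioms]

lemma family:
  "\<omega> \<in> space M \<Longrightarrow> noisy_family \<Theta> Y domF F L y N x0 \<xi>0 \<sigma> \<rho> B0 \<eta> r \<mu>0 \<mu>1 \<upsilon>0 \<upsilon>1 \<beta> \<tau> (seq \<omega>) yd \<delta>"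
  using noisy_run \<delta>_tendsto by (intro noisy_family.intro exact_run noisy_family_axioms.intro)

lemma depends_state: "depends_on_first n (\<lambda>J. h (stt y' \<delta>' J n))"
  unfolding depends_on_first_def
  by (metis heavy_ball.state_cong)

lemma depends_sq: "depends_on_first n (\<lambda>J. sq J n i)"
  unfolding heavy_ball.x_it_def by (rule depends_state)

lemma batch_value_measurable:
  assumes "depends_on_first n h"
  shows "(\<lambda>\<omega>. h (seq \<omega>)) \<in> measurable M borel"
proof (rule batch_function_measurable[where f = "\<lambda>J \<omega>. h J"])
  show "depends_on_first n (\<lambda>J \<omega>. h J)"
    using assms unfolding depends_on_first_def by metis
qed simp

lemma sq_measurable [measurable]: "(\<lambda>\<omega>. sq (seq \<omega>) n i) \<in> borel_measurable M"
  by (rule batch_value_measurable[OF depends_sq])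

lemma sampled_residuals_bound:
  assumes \<omega>: "\<omega> \<in> space M"
  shows "(\<Sum>n<k. \<Sum>i\<in>{1..N}. indicator (I n \<omega>) i * sq (seq \<omega>) n i) \<le> N * (\<sigma> * \<rho>\<^sup>2 / (c1 * c2))"
proof -
  note run = exact_hb[OF \<omega>]
  let ?P = "\<lambda>n. heavy_ball.\<Psi> F r \<tau> y (\<lambda>_. 0) (seq \<omega>) n (xe (seq \<omega>) n) powr (2 / r)"
  have "(\<Sum>n<k. \<Sum>i\<in>{1..N}. indicator (I n \<omega>) i * sq (seq \<omega>) n i) \<le> (\<Sum>n<k. \<Sum>i\<in>{1..N}. ?P n)"
  proof (intro sum_mono)
    fix n i
    show "indicator (I n \<omega>) i * sq (seq \<omega>) n i \<le> ?P n"
    proof (cases "i \<in> I n \<omega> \<and> heavy_ball.res F y (xe (seq \<omega>) n) i \<noteq> 0")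
      case True
      then have "i \<in> heavy_ball.\<Gamma> F \<tau> y (\<lambda>_. 0) (seq \<omega>) n (xe (seq \<omega>) n)"
        using hb_run.res_nonneg[OF run, of "xe (seq \<omega>) n" i] by (simp add: heavy_ball.\<Gamma>_def)
      then have "sq (seq \<omega>) n i \<le> (heavy_ball.\<Psi> F r \<tau> y (\<lambda>_. 0) (seq \<omega>) n (xe (seq \<omega>) n) powr (1 / r))\<^sup>2"
        using hb_run.res_le_\<Psi>[OF run] hb_run.res_nonneg[OF run] by (intro power_mono) auto
      also have "\<dots> = ?P n" by (simp add: power2_eq_square powr_add[symmetric])
      finally show ?thesis using True by simp
    qed auto
  qed
  also have "\<dots> = N * (\<Sum>n<k. ?P n)" by (simp add: sum_distrib_left)
  also have "\<dots> \<le> N * (\<sigma> * \<rho>\<^sup>2 / (c1 * c2))"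
    by (intro mult_left_mono hb_run.\<Psi>_sum[OF run]) simp
  finally show ?thesis .
qed

text \<open>The sum over all steps of all squared residuals of the exact run; it is finite exactly on the paths
on which \<open>exact_limit\<close> is applied.\<close>

definition W :: "'w \<Rightarrow> ennreal" where
  "W \<omega> = (\<Sum>n. ennreal (\<Sum>i\<in>{1..N}. sq (seq \<omega>) n i))"

lemma W_measurable [measurable]: "W \<in> borel_measurable M"
  unfolding W_def[abs_def] by measurable

text \<open>The sampled part of the sum is bounded on every path; taking expectations step by step replaces the
indicator of sampling by its probability, which is at least \<open>p\<close>.\<close>

lemma W_integral: "(\<integral>\<^sup>+\<omega>. W \<omega> \<partial>M) < \<infinity>"
proof -
  let ?C = "N * (\<sigma> * \<rho>\<^sup>2 / (c1 * c2))"
  have "ennreal p * (\<integral>\<^sup>+\<omega>. W \<omega> \<partial>M) = (\<Sum>n. ennreal p * (\<integral>\<^sup>+\<omega>. ennreal (\<Sum>i\<in>{1..N}. sq (seq \<omega>) n i) \<partial>M))"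
    unfolding W_def by (subst nn_integral_suminf) (auto simp: ennreal_suminf_cmult)
  also have "\<dots> \<le> ennreal ?C"
  proof (rule suminf_le_const[OF summableI])
    fix k
    have "(\<Sum>n<k. ennreal p * (\<integral>\<^sup>+\<omega>. ennreal (\<Sum>i\<in>{1..N}. sq (seq \<omega>) n i) \<partial>M))
        = (\<Sum>n<k. \<Sum>i\<in>{1..N}. ennreal p * (\<integral>\<^sup>+\<omega>. ennreal (sq (seq \<omega>) n i) \<partial>M))"
      by (simp add: sum_distrib_left nn_integral_sum flip: sum_ennreal)
    also have "\<dots> \<le> (\<Sum>n<k. \<Sum>i\<in>{1..N}. \<integral>\<^sup>+\<omega>. ennreal (indicator (I n \<omega>) i * sq (seq \<omega>) n i) \<partial>M)"
      by (intro sum_mono hit_expectation[OF depends_sq]) auto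
    also have "\<dots> = (\<integral>\<^sup>+\<omega>. (\<Sum>n<k. \<Sum>i\<in>{1..N}. ennreal (indicator (I n \<omega>) i * sq (seq \<omega>) n i)) \<partial>M)"
    proof -
      have "(\<lambda>\<omega>. indicator (I n \<omega>) i * sq (seq \<omega>) n i) \<in> borel_measurable M" for n i
      proof -
        have "(\<lambda>\<omega>. indicator (I n \<omega>) i :: real) \<in> borel_measurable M"
          by (rule measurable_compose[OF I_measurable]) simp
        then show ?thesis by simp
      qed
      then have m: "(\<lambda>\<omega>. ennreal (indicator (I n \<omega>) i * sq (seq \<omega>) n i)) \<in> borel_measurable M" for n i
        by simp
      have "(\<integral>\<^sup>+\<omega>. (\<Sum>n<k. \<Sum>i\<in>{1..N}. ennreal (indicator (I n \<omega>) i * sq (seq \<omega>) n i)) \<partial>M)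
          = (\<Sum>n<k. \<integral>\<^sup>+\<omega>. (\<Sum>i\<in>{1..N}. ennreal (indicator (I n \<omega>) i * sq (seq \<omega>) n i)) \<partial>M)"
        by (intro nn_integral_sum borel_measurable_sum m)
      also have "\<dots> = (\<Sum>n<k. \<Sum>i\<in>{1..N}. \<integral>\<^sup>+\<omega>. ennreal (indicator (I n \<omega>) i * sq (seq \<omega>) n i) \<partial>M)"
        by (intro sum.cong refl nn_integral_sum m)
      finally show ?thesis by (rule sym)
    qed
    also have "\<dots> \<le> (\<integral>\<^sup>+\<omega>. ennreal ?C \<partial>M)"
    proof (rule nn_integral_mono)
      fix \<omega> assume "\<omega> \<in> space M"
      then show "(\<Sum>n<k. \<Sum>i\<in>{1..N}. ennreal (indicator (I n \<omega>) i * sq (seq \<omega>) n i)) \<le> ennreal ?C"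
        using sampled_residuals_bound[of \<omega> k] by (simp add: sum_nonneg ennreal_leI)
    qed
    also have "\<dots> = ennreal ?C" by (simp add: emeasure_space_1)
    finally show "(\<Sum>n<k. ennreal p * (\<integral>\<^sup>+\<omega>. ennreal (\<Sum>i\<in>{1..N}. sq (seq \<omega>) n i) \<partial>M)) \<le> ennreal ?C" .
  qed
  finally have "ennreal p * (\<integral>\<^sup>+\<omega>. W \<omega> \<partial>M) < \<infinity>"
    by (rule le_less_trans) simp
  then show ?thesis
    using p_pos by (auto simp: ennreal_mult_less_top)
qed

lemma AE_W: "AE \<omega> in M. W \<omega> < \<infinity>"
  using nn_integral_noteq_infinite[OF W_measurable] W_integral by (auto simp: less_top)

lemma W_summable:
  assumes "W \<omega> < \<infinity>"
  shows "summable (\<lambda>n. \<Sum>i\<in>{1..N}. sq (seq \<omega>) n i)"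
    "ennreal (\<Sum>n. \<Sum>i\<in>{1..N}. sq (seq \<omega>) n i) = W \<omega>"
proof -
  show s: "summable (\<lambda>n. \<Sum>i\<in>{1..N}. sq (seq \<omega>) n i)"
    using assms by (intro summable_suminf_not_top) (auto simp: W_def sum_nonneg)
  show "ennreal (\<Sum>n. \<Sum>i\<in>{1..N}. sq (seq \<omega>) n i) = W \<omega>"
    unfolding W_def by (rule suminf_ennreal2[symmetric, OF _ s]) (simp add: sum_nonneg)
qed

text \<open>On the null set where \<open>W\<close> is infinite, any fixed solution serves as value.\<close>

definition xs :: "'w \<Rightarrow> 'x" where
  "xs \<omega> = (if W \<omega> < \<infinity> then lim (xe (seq \<omega>)) else (SOME x. x \<in> Sol))"

lemma some_Sol: "(SOME x. x \<in> Sol) \<in> Sol"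
  using Sol_near by (metis someI)

lemma xs_good:
  assumes \<omega>: "\<omega> \<in> space M" and W: "W \<omega> < \<infinity>"
  shows "xs \<omega> \<in> Sol" "xe (seq \<omega>) \<longlonglongrightarrow> xs \<omega>"
    "(\<lambda>n. D (xxi y (\<lambda>_. 0) (seq \<omega>) n) (xs \<omega>) (xe (seq \<omega>) n)) \<longlonglongrightarrow> 0"
    "ennreal (D \<xi>0 (xs \<omega>) x0) \<le> ennreal (\<sigma> * \<rho>\<^sup>2) + ennreal (C3 / (1 - \<beta>)) * W \<omega>"
proof -
  obtain z where z: "z \<in> Sol" "xe (seq \<omega>) \<longlonglongrightarrow> z"
    "(\<lambda>n. D (xxi y (\<lambda>_. 0) (seq \<omega>) n) z (xe (seq \<omega>) n)) \<longlonglongrightarrow> 0"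
    "D \<xi>0 z x0 \<le> \<sigma> * \<rho>\<^sup>2 + C3 / (1 - \<beta>) * (\<Sum>n. \<Sum>i\<in>{1..N}. sq (seq \<omega>) n i)"
    using exact_run.exact_limit_unfolded[OF exact_run[OF \<omega>] W_summable(1)[OF W]] by blast
  have "xs \<omega> = z" using W limI[OF z(2)] by (simp add: xs_def)
  then show "xs \<omega> \<in> Sol" "xe (seq \<omega>) \<longlonglongrightarrow> xs \<omega>"
    "(\<lambda>n. D (xxi y (\<lambda>_. 0) (seq \<omega>) n) (xs \<omega>) (xe (seq \<omega>) n)) \<longlonglongrightarrow> 0" using z by auto
  have n: "0 \<le> (\<Sum>n. \<Sum>i\<in>{1..N}. sq (seq \<omega>) n i)"
    by (rule suminf_nonneg[OF W_summable(1)[OF W]]) (simp add: sum_nonneg)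
  have C: "0 \<le> C3 / (1 - \<beta>)" using C3_nonneg \<beta> by simp
  have "ennreal (D \<xi>0 (xs \<omega>) x0) \<le> ennreal (\<sigma> * \<rho>\<^sup>2 + C3 / (1 - \<beta>) * (\<Sum>n. \<Sum>i\<in>{1..N}. sq (seq \<omega>) n i))"
    using z(4) \<open>xs \<omega> = z\<close> by (simp add: ennreal_leI)
  also have "\<dots> = ennreal (\<sigma> * \<rho>\<^sup>2) + ennreal (C3 / (1 - \<beta>)) * W \<omega>"
    unfolding W_summable(2)[OF W, symmetric] ennreal_mult[OF C n, symmetric]
    by (rule ennreal_plus[OF _ mult_nonneg_nonneg[OF C n]]) (use \<sigma> in simp)
  finally show "ennreal (D \<xi>0 (xs \<omega>) x0) \<le> ennreal (\<sigma> * \<rho>\<^sup>2) + ennreal (C3 / (1 - \<beta>)) * W \<omega>" .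
qed

lemma xs_Sol: "\<omega> \<in> space M \<Longrightarrow> xs \<omega> \<in> Sol"
  using xs_good(1) some_Sol by (cases "W \<omega> < \<infinity>") (auto simp: xs_def)

lemma xs_measurable [measurable]: "xs \<in> borel_measurable M"
proof (rule borel_measurable_LIMSEQ_metric)
  have "(\<lambda>\<omega>. xe (seq \<omega>) n) \<in> borel_measurable M" for n
    unfolding heavy_ball.x_it_def by (rule batch_value_measurable[OF depends_state])
  then show "(\<lambda>\<omega>. if W \<omega> < \<infinity> then xe (seq \<omega>) n else (SOME x. x \<in> Sol)) \<in> borel_measurable M" for n
    by (intro measurable_If) auto
  show "(\<lambda>n. if W \<omega> < \<infinity> then xe (seq \<omega>) n else (SOME x. x \<in> Sol)) \<longlonglongrightarrow> xs \<omega>" if "\<omega> \<in> space M" for \<omega>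
    using xs_good(2)[OF that] by (cases "W \<omega> < \<infinity>") (auto simp: xs_def)
qed

lemma AE_stop: "AE \<omega> in M. \<forall>l. stop l (seq \<omega>) < \<infinity>"
  using hit_infinitely_often AE_space
proof eventually_elim
  case (elim \<omega>)
  then show ?case
    using hb_run.stops[OF noisy_run \<delta>_pos] by blast
qed

abbreviation "nl l \<omega> \<equiv> the_enat (stop l (seq \<omega>))"
abbreviation "Ds l \<omega> \<equiv> D (xxi (yd l) (\<delta> l) (seq \<omega>) (nl l \<omega>)) (xs \<omega>) (xx (yd l) (\<delta> l) (seq \<omega>) (nl l \<omega>))"

lemma AE_Ds: "AE \<omega> in M. (\<lambda>l. Ds l \<omega>) \<longlonglongrightarrow> 0"
  using AE_stop AE_W AE_space
proof eventually_elim
  case (elim \<omega>)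
  then show ?case
    by (intro noisy_family.D_stopped_tendsto[OF family] xs_good) auto
qed

lemma Ds_ge:
  "\<omega> \<in> space M \<Longrightarrow> \<sigma> * (norm (xx (yd l) (\<delta> l) (seq \<omega>) (nl l \<omega>) - xs \<omega>))\<^sup>2 \<le> Ds l \<omega>"
  using D_ge[OF hb_run.x_subdiff[OF noisy_run], of \<omega> "xs \<omega>" l "nl l \<omega>"] xs_Sol
  by (simp add: Sol_def norm_minus_commute)

lemma AE_Ds_le: "AE \<omega> in M. ennreal (Ds l \<omega>) \<le> ennreal (\<sigma> * \<rho>\<^sup>2) + ennreal (C3 / (1 - \<beta>)) * W \<omega>"
  using AE_W AE_space
proof eventually_elim
  case (elim \<omega>)
  have "Ds l \<omega> \<le> D \<xi>0 (xs \<omega>) x0"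
    using hb_run.D_antimono[OF noisy_run[OF elim(2)] le0 xs_Sol[OF elim(2)], of l "nl l \<omega>"]
    by (simp add: heavy_ball.state_recursion)
  then have "ennreal (Ds l \<omega>) \<le> ennreal (D \<xi>0 (xs \<omega>) x0)" by (rule ennreal_leI)
  also note xs_good(4)[OF elim(2,1)]
  finally show ?case .
qed

lemma \<theta>_measurable [measurable]: "\<theta> \<in> borel_measurable borel"
proof -
  have "\<Theta> \<in> borel_measurable borel"
    by (rule borel_measurableI_greater) (simp add: lower_semicontinuous_open[OF \<Theta>_lsc])
  then show ?thesis unfolding \<theta>_def[abs_def] by measurable
qed

lemma nl_measurable [measurable]: "nl l \<in> measurable M (count_space UNIV)"
proof -
  have [measurable]: "Measurable.pred M (\<lambda>\<omega>. active (stt (yd l) (\<delta> l) (seq \<omega>) n) = {})" for n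
    using batch_function_measurable[OF _ depends_state[where h = "\<lambda>s \<omega>. active s = {}"]] by simp
  show ?thesis
    unfolding heavy_ball.stop_index_eq if_distrib[of the_enat] the_enat.simps by measurable
qed

text \<open>The stopping time and the past before it take countably many values; once they are fixed, only \<open>xs\<close>
varies.\<close>

lemma Ds_measurable [measurable]: "(\<lambda>\<omega>. ennreal (Ds l \<omega>)) \<in> borel_measurable M"
proof (rule measurable_compose_countable[OF _ nl_measurable])
  fix n
  have dep: "depends_on_first n (\<lambda>J \<omega>. ennreal (D (xxi (yd l) (\<delta> l) J n) (xs \<omega>) (xx (yd l) (\<delta> l) J n)))"
    unfolding heavy_ball.xi_it_def heavy_ball.x_it_def by (rule depends_state)
  have "(\<lambda>\<omega>. ennreal (D v (xs \<omega>) u)) \<in> borel_measurable M" for v u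
  proof -
    have "(\<lambda>x. v \<bullet> (x - u)) \<in> borel_measurable borel"
      by (intro borel_measurable_continuous_onI continuous_intros)
    then have [measurable]: "(\<lambda>\<omega>. v \<bullet> (xs \<omega> - u)) \<in> borel_measurable M"
      by (rule measurable_compose[OF xs_measurable])
    have [measurable]: "(\<lambda>\<omega>. \<theta> (xs \<omega>)) \<in> borel_measurable M"
      by (rule measurable_compose[OF xs_measurable \<theta>_measurable])
    show ?thesis unfolding D_def by measurable
  qed
  then show "(\<lambda>\<omega>. ennreal (D (xxi (yd l) (\<delta> l) (seq \<omega>) n) (xs \<omega>) (xx (yd l) (\<delta> l) (seq \<omega>) n))) \<in> borel_measurable M"
    by (rule batch_function_measurable[OF _ dep])
qed

lemma integral_Ds: "(\<lambda>l. \<integral>\<^sup>+\<omega>. ennreal (Ds l \<omega>) \<partial>M) \<longlonglongrightarrow> 0"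
proof -
  have "(\<lambda>l. \<integral>\<^sup>+\<omega>. ennreal (Ds l \<omega>) \<partial>M) \<longlonglongrightarrow> (\<integral>\<^sup>+\<omega>. 0 \<partial>M)"
  proof (rule nn_integral_dominated_convergence[where w = "\<lambda>\<omega>. ennreal (\<sigma> * \<rho>\<^sup>2) + ennreal (C3 / (1 - \<beta>)) * W \<omega>"])
    show "AE \<omega> in M. (\<lambda>l. ennreal (Ds l \<omega>)) \<longlonglongrightarrow> 0"
      using AE_Ds by eventually_elim (use tendsto_ennrealI in fastforce)
    show "(\<integral>\<^sup>+\<omega>. ennreal (\<sigma> * \<rho>\<^sup>2) + ennreal (C3 / (1 - \<beta>)) * W \<omega> \<partial>M) < \<infinity>"
      using W_integral by (simp add: nn_integral_add nn_integral_cmult emeasure_space_1 ennreal_mult_less_top)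
  qed (use AE_Ds_le in auto)
  then show ?thesis by simp
qed

end

theorem theorem4p1:
  fixes \<Theta> :: "'x::{real_inner, banach} \<Rightarrow> ereal"
    and Y :: "nat \<Rightarrow> 'y::real_normed_vector set"
    and domF :: "nat \<Rightarrow> 'x set"
    and F :: "nat \<Rightarrow> 'x \<Rightarrow> 'y"
    and L :: "nat \<Rightarrow> 'x \<Rightarrow> ('x \<Rightarrow>\<^sub>L 'y)"
    and y :: "nat \<Rightarrow> 'y"
    and N b :: nat
    and x0 \<xi>0 :: 'x
    and \<sigma> \<rho> B0 \<eta> r \<mu>0 \<mu>1 \<upsilon>0 \<upsilon>1 \<beta> \<tau> :: real
    and yd :: "nat \<Rightarrow> nat \<Rightarrow> 'y"
    and \<delta> :: "nat \<Rightarrow> nat \<Rightarrow> real"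
    and M :: "'w measure"
    and I :: "nat \<Rightarrow> 'w \<Rightarrow> nat set"
    and X \<Xi> :: "nat \<Rightarrow> 'w \<Rightarrow> nat \<Rightarrow> 'x"
    and nl :: "nat \<Rightarrow> 'w \<Rightarrow> enat"
    \<comment> \<open>the spaces and the system\<close>
  assumes Y_banach: "\<And>i. i \<in> {1..N} \<Longrightarrow> subspace (Y i) \<and> Topological_Spaces.complete (Y i)"
    and Y_smooth: "\<And>i. i \<in> {1..N} \<Longrightarrow> uniformly_smooth (Y i)"
    and F_range: "\<And>i x. i \<in> {1..N} \<Longrightarrow> x \<in> domF i \<Longrightarrow> F i x \<in> Y i"
    and y_range: "\<And>i. i \<in> {1..N} \<Longrightarrow> y i \<in> Y i"
    \<comment> \<open>Assumption (A) and the initial guess\<close>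
    and \<Theta>: "proper \<Theta>" "lower_semicontinuous \<Theta>" "strongly_convex \<Theta>"
    and \<sigma>: "\<sigma> > 0"
      "\<And>z x \<xi>. x \<in> dom_subdiff \<Theta> \<Longrightarrow> \<xi> \<in> subdiff \<Theta> x \<Longrightarrow>
          bregman \<Theta> \<xi> z x \<ge> ereal (\<sigma> * (norm (z - x))\<^sup>2)"
    and init: "x0 \<in> dom_subdiff \<Theta>" "\<xi>0 \<in> subdiff \<Theta> x0"
    \<comment> \<open>Assumption (B)\<close>
    and \<rho>: "\<rho> > 0" "cball x0 (2 * \<rho>) \<subseteq> common_dom N domF"
    and solvable: "\<exists>x\<in>edom \<Theta>. is_solution N domF F y x \<and> bregman \<Theta> \<xi>0 x x0 \<le> ereal (\<sigma> * \<rho>\<^sup>2)"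
    and L_range: "\<And>i x h. i \<in> {1..N} \<Longrightarrow> x \<in> cball x0 (2 * \<rho>) \<Longrightarrow> blinfun_apply (L i x) h \<in> Y i"
    and L_cont: "\<And>i. i \<in> {1..N} \<Longrightarrow> continuous_on (cball x0 (2 * \<rho>)) (L i)"
    and L_bound: "B0 > 0"
      "\<And>i x. i \<in> {1..N} \<Longrightarrow> x \<in> cball x0 (2 * \<rho>) \<Longrightarrow> norm (L i x) \<le> B0"
    and \<eta>: "0 \<le> \<eta>" "\<eta> < 1"
    and tcc: "\<And>i x z. i \<in> {1..N} \<Longrightarrow> x \<in> cball x0 (2 * \<rho>) \<Longrightarrow> z \<in> cball x0 (2 * \<rho>) \<Longrightarrow>
        norm (F i x - F i z - blinfun_apply (L i x) (x - z)) \<le> \<eta> * norm (F i x - F i z)"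
    \<comment> \<open>parameters of the method\<close>
    and batch_size: "1 \<le> b" "b \<le> N"
    and params: "1 < r" "0 < \<mu>0" "\<mu>0 < 4 * \<sigma>" "\<mu>1 > 0" "\<upsilon>0 > 0" "\<upsilon>1 > 0" "0 \<le> \<beta>" "\<beta> < 1"
      "\<tau> > (1 + \<eta>) / (1 - \<eta>)"
    \<comment> \<open>noisy data\<close>
    and data: "\<And>l i. i \<in> {1..N} \<Longrightarrow> yd l i \<in> Y i"
      "\<And>l i. i \<in> {1..N} \<Longrightarrow> norm (yd l i - y i) \<le> \<delta> l i"
      "\<And>l i. i \<in> {1..N} \<Longrightarrow> \<delta> l i > 0"
      "(\<lambda>l. Max (\<delta> l ` {1..N})) \<longlonglongrightarrow> 0"
    \<comment> \<open>one random sequence of batches drives all the runs\<close>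
    and M: "prob_space M"
    and I: "uniform_iid_batches M N b I"
    \<comment> \<open>iterates and stopping indices of the runs\<close>
    and X: "\<And>l \<omega> n. X l \<omega> n =
        heavy_ball.x_it \<Theta> Y F L N x0 \<xi>0 \<eta> \<sigma> r \<mu>0 \<mu>1 \<upsilon>0 \<upsilon>1 \<beta> \<tau> (yd l) (\<delta> l) (\<lambda>k. I k \<omega>) n"
    and \<Xi>: "\<And>l \<omega> n. \<Xi> l \<omega> n =
        heavy_ball.xi_it \<Theta> Y F L N x0 \<xi>0 \<eta> \<sigma> r \<mu>0 \<mu>1 \<upsilon>0 \<upsilon>1 \<beta> \<tau> (yd l) (\<delta> l) (\<lambda>k. I k \<omega>) n"
    and nl: "\<And>l \<omega>. nl l \<omega> =
        heavy_ball.stop_index \<Theta> Y F L N x0 \<xi>0 \<eta> \<sigma> r \<mu>0 \<mu>1 \<upsilon>0 \<upsilon>1 \<beta> \<tau> (yd l) (\<delta> l) (\<lambda>k. I k \<omega>)"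
  shows "\<exists>xs. xs \<in> borel_measurable M
    \<and> (\<forall>\<omega>\<in>space M. xs \<omega> \<in> cball x0 (2 * \<rho>) \<inter> edom \<Theta> \<and> is_solution N domF F y (xs \<omega>))
    \<and> (AE \<omega> in M. \<forall>l. nl l \<omega> < \<infinity>)
    \<and> (AE \<omega> in M. (\<lambda>l. norm (X l \<omega> (the_enat (nl l \<omega>)) - xs \<omega>)) \<longlonglongrightarrow> 0)
    \<and> (AE \<omega> in M. (\<lambda>l. bregman \<Theta> (\<Xi> l \<omega> (the_enat (nl l \<omega>))) (xs \<omega>) (X l \<omega> (the_enat (nl l \<omega>))))
          \<longlonglongrightarrow> 0)
    \<and> (\<lambda>l. \<integral>\<^sup>+ \<omega>. ennreal ((norm (X l \<omega> (the_enat (nl l \<omega>)) - xs \<omega>))\<^sup>2) \<partial>M) \<longlonglongrightarrow> 0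
    \<and> (\<lambda>l. \<integral>\<^sup>+ \<omega>. e2ennreal (bregman \<Theta> (\<Xi> l \<omega> (the_enat (nl l \<omega>))) (xs \<omega>)
                                             (X l \<omega> (the_enat (nl l \<omega>)))) \<partial>M) \<longlonglongrightarrow> 0
    \<and> ((\<forall>i\<in>{1..N}. \<forall>x\<in>cball x0 (2 * \<rho>).
            ran_adjoint (Y i) (L i x)
              \<subseteq> closure (ran_adjoint (Y i) (L i (x_dagger \<Theta> N domF F y x0 \<xi>0))))
        \<longrightarrow> (AE \<omega> in M. xs \<omega> = x_dagger \<Theta> N domF F y x0 \<xi>0))"
proof -
  have N: "1 \<le> N" using batch_size by simp
  interpret random_batches M N b I
    using M batch_size I by (intro random_batches.intro random_batches_axioms.intro)
  have \<delta>0: "(\<lambda>l. \<delta> l i) \<longlonglongrightarrow> 0" if i: "i \<in> {1..N}" for i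
  proof (rule tendsto_null_bound[OF _ data(4)])
    have "\<delta> l i \<le> Max (\<delta> l ` {1..N})" for l using i by (intro Max_ge) auto
    then show "norm (\<delta> l i) \<le> Max (\<delta> l ` {1..N})" for l using data(3)[OF i, of l] by simp
  qed
  interpret random_problem \<Theta> Y domF F L y N x0 \<xi>0 \<sigma> \<rho> B0 \<eta> r \<mu>0 \<mu>1 \<upsilon>0 \<upsilon>1 \<beta> \<tau> b M I yd \<delta>
  proof (intro random_problem.intro random_problem_axioms.intro random_batches_axioms)
    show "nonlinear_system \<Theta> Y domF F L y N x0 \<xi>0 \<sigma> \<rho> B0 \<eta> r \<mu>0 \<mu>1 \<upsilon>0 \<upsilon>1 \<beta> \<tau>"
      by (rule nonlinear_system.intro; (fact N assms | simp add: Y_banach))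
  qed (fact data \<delta>0)+
  have X': "X l \<omega> (the_enat (nl l \<omega>)) = xx (yd l) (\<delta> l) (seq \<omega>) (the_enat (stop l (seq \<omega>)))"
    and \<Xi>': "\<Xi> l \<omega> (the_enat (nl l \<omega>)) = xxi (yd l) (\<delta> l) (seq \<omega>) (the_enat (stop l (seq \<omega>)))" for l \<omega>
    by (simp_all only: X \<Xi> nl)
  have breg: "bregman \<Theta> (\<Xi> l \<omega> (the_enat (nl l \<omega>))) (xs \<omega>) (X l \<omega> (the_enat (nl l \<omega>))) = ereal (Ds l \<omega>)"
    if "\<omega> \<in> space M" for l \<omega>
    unfolding X' \<Xi>' using xs_Sol[OF that] hb_run.x_edom[OF noisy_run[OF that]]
    by (intro bregman_real) (auto simp: Sol_def)
  have err: "(norm (X l \<omega> (the_enat (nl l \<omega>)) - xs \<omega>))\<^sup>2 \<le> Ds l \<omega> / \<sigma>" if "\<omega> \<in> space M" for l \<omega>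
    unfolding X' using Ds_ge[OF that, of l] \<sigma>(1) by (simp add: field_simps)
  show ?thesis
  proof (intro exI[of _ xs] conjI impI ballI)
    show "xs \<in> borel_measurable M" by (rule xs_measurable)
    show "xs \<omega> \<in> cball x0 (2 * \<rho>) \<inter> edom \<Theta>" "is_solution N domF F y (xs \<omega>)" if "\<omega> \<in> space M" for \<omega>
      using xs_Sol[OF that] ball_dom by (auto simp: Sol_def is_solution_def)
    show "AE \<omega> in M. \<forall>l. nl l \<omega> < \<infinity>"
      unfolding nl by (rule AE_stop)
    show "AE \<omega> in M. (\<lambda>l. norm (X l \<omega> (the_enat (nl l \<omega>)) - xs \<omega>)) \<longlonglongrightarrow> 0"
      using AE_Ds AE_space
    proof eventually_elim
      case (elim \<omega>)
      have "(\<lambda>l. (norm (X l \<omega> (the_enat (nl l \<omega>)) - xs \<omega>))\<^sup>2) \<longlonglongrightarrow> 0"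
      proof (rule tendsto_null_bound)
        show "norm ((norm (X l \<omega> (the_enat (nl l \<omega>)) - xs \<omega>))\<^sup>2) \<le> Ds l \<omega> / \<sigma>" for l
          using err[OF elim(2), of l] by simp
        show "(\<lambda>l. Ds l \<omega> / \<sigma>) \<longlonglongrightarrow> 0" by (rule tendsto_divide_zero[OF elim(1)])
      qed
      then have "(\<lambda>l. sqrt ((norm (X l \<omega> (the_enat (nl l \<omega>)) - xs \<omega>))\<^sup>2)) \<longlonglongrightarrow> sqrt 0"
        by (rule tendsto_real_sqrt)
      then show ?case by simp
    qed
    show "AE \<omega> in M. (\<lambda>l. bregman \<Theta> (\<Xi> l \<omega> (the_enat (nl l \<omega>))) (xs \<omega>) (X l \<omega> (the_enat (nl l \<omega>)))) \<longlonglongrightarrow> 0"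
      using AE_Ds AE_space
    proof eventually_elim
      case (elim \<omega>)
      then show ?case unfolding breg[OF elim(2)] zero_ereal_def by (simp only: lim_ereal)
    qed
    show "(\<lambda>l. \<integral>\<^sup>+ \<omega>. ennreal ((norm (X l \<omega> (the_enat (nl l \<omega>)) - xs \<omega>))\<^sup>2) \<partial>M) \<longlonglongrightarrow> 0"
    proof (rule tendsto_sandwich[OF always_eventually always_eventually tendsto_const])
      have "(\<lambda>l. ennreal (1 / \<sigma>) * (\<integral>\<^sup>+\<omega>. ennreal (Ds l \<omega>) \<partial>M)) \<longlonglongrightarrow> ennreal (1 / \<sigma>) * 0"
        by (intro ennreal_tendsto_cmult integral_Ds) simp
      then show "(\<lambda>l. ennreal (1 / \<sigma>) * (\<integral>\<^sup>+\<omega>. ennreal (Ds l \<omega>) \<partial>M)) \<longlonglongrightarrow> 0" by simp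
      show "\<forall>l. (\<integral>\<^sup>+ \<omega>. ennreal ((norm (X l \<omega> (the_enat (nl l \<omega>)) - xs \<omega>))\<^sup>2) \<partial>M)
          \<le> ennreal (1 / \<sigma>) * (\<integral>\<^sup>+\<omega>. ennreal (Ds l \<omega>) \<partial>M)"
      proof
        fix l
        have "(\<integral>\<^sup>+ \<omega>. ennreal ((norm (X l \<omega> (the_enat (nl l \<omega>)) - xs \<omega>))\<^sup>2) \<partial>M)
            \<le> (\<integral>\<^sup>+\<omega>. ennreal (1 / \<sigma>) * ennreal (Ds l \<omega>) \<partial>M)"
        proof (rule nn_integral_mono)
          fix \<omega> assume "\<omega> \<in> space M"
          from ennreal_leI[OF err[OF this, of l]] show "ennreal ((norm (X l \<omega> (the_enat (nl l \<omega>)) - xs \<omega>))\<^sup>2)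
              \<le> ennreal (1 / \<sigma>) * ennreal (Ds l \<omega>)"
            using \<sigma>(1) by (simp flip: ennreal_mult')
        qed
        also have "\<dots> = ennreal (1 / \<sigma>) * (\<integral>\<^sup>+\<omega>. ennreal (Ds l \<omega>) \<partial>M)"
          by (rule nn_integral_cmult[OF Ds_measurable])
        finally show "(\<integral>\<^sup>+ \<omega>. ennreal ((norm (X l \<omega> (the_enat (nl l \<omega>)) - xs \<omega>))\<^sup>2) \<partial>M)
          \<le> ennreal (1 / \<sigma>) * (\<integral>\<^sup>+\<omega>. ennreal (Ds l \<omega>) \<partial>M)" .
      qed
    qed simp
    have "(\<integral>\<^sup>+ \<omega>. e2ennreal (bregman \<Theta> (\<Xi> l \<omega> (the_enat (nl l \<omega>))) (xs \<omega>) (X l \<omega> (the_enat (nl l \<omega>)))) \<partial>M)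
        = (\<integral>\<^sup>+\<omega>. ennreal (Ds l \<omega>) \<partial>M)" for l
      by (rule nn_integral_cong) (simp only: breg e2ennreal_ereal)
    then show "(\<lambda>l. \<integral>\<^sup>+ \<omega>. e2ennreal (bregman \<Theta> (\<Xi> l \<omega> (the_enat (nl l \<omega>))) (xs \<omega>)
        (X l \<omega> (the_enat (nl l \<omega>)))) \<partial>M) \<longlonglongrightarrow> 0"
      using integral_Ds by simp
    assume range: "\<forall>i\<in>{1..N}. \<forall>x\<in>cball x0 (2 * \<rho>).
            ran_adjoint (Y i) (L i x)
              \<subseteq> closure (ran_adjoint (Y i) (L i (x_dagger \<Theta> N domF F y x0 \<xi>0)))"
    show "AE \<omega> in M. xs \<omega> = x_dagger \<Theta> N domF F y x0 \<xi>0"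
      using AE_W AE_space
    proof eventually_elim
      case (elim \<omega>)
      then show ?case
        using exact_run.limit_is_x_dagger[OF exact_run[OF elim(2)] range xs_good(1)[OF elim(2,1)] xs_good(3)[OF elim(2,1)]]
        by simp
    qed
  qed
qed

end
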